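(* Let $n\ge1$ and $[n]_\infty=\{1,\dots,n\}\cup\{\infty\}$. For two permutations $\varphi_{\mathrm{Re}},\varphi_{\mathrm{tr}}$ consider the equation $$\#\big(\Pi(\varphi_{\mathrm{Re}})\wedge\Pi(\varphi_{\mathrm{tr}})\big)-\#\big(\Pi(\varphi_{\mathrm{Re}})\vee\Pi(\varphi_{\mathrm{tr}})\big)=\big(\#(\Pi(\varphi_{\mathrm{Re}})\wedge\Pi(\varphi_{\mathrm{tr}}))-\#(\varphi_{\mathrm{Re}})\big)+\big(\#(\Pi(\varphi_{\mathrm{Re}})\wedge\Pi(\varphi_{\mathrm{tr}}))-\#(\varphi_{\mathrm{tr}})\big).\qquad(\ast)$$ (1) Let $\varphi_{\mathrm{Re}},\varphi_{\mathrm{tr}}\in S([n]_\infty)$. There is a bracket diagram on $X_1,\dots,X_n$, with each pair of brackets labelled $\mathrm{Re}$ or $\mathrm{tr}$, equal to $\mathrm{Re}_{\varphi_{\mathrm{Re}}}\mathrm{tr}_{\varphi_{\mathrm{tr}}}(X_1,\dots,X_n)$, i.e. whose permutations associated with $\mathrm{Re}$ and with $\mathrm{tr}$ are $\varphi_{\mathrm{Re}}$ and $\varphi_{\mathrm{tr}}$ respectively, if and only if $\varphi_{\mathrm{Re}}$ and $\varphi_{\mathrm{tr}}$ have an upper bound in the poset $(S([n]_\infty),\preceq)$ and satisfy $(\ast)$. (2) Let $\varphi_{\mathrm{Re}},\varphi_{\mathrm{tr}}\in\mathrm{PM}([n]_\infty)$. It is possible to find a bracket diagram with functions $\mathrm{Re}$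 and $\mathrm{tr}$ applied to bracketed intervals, in which for each $k\in[n]$ exactly one of the symbols $X_k$, $X_{-k}=X_k^*$ appears, and where $\varphi_{\mathrm{Re}}$ and $\varphi_{\mathrm{tr}}$ are the permutations associated to the functions $\mathrm{Re}$ and $\mathrm{tr}$ respectively, exactly when $\varphi_{\mathrm{Re}}$ is planar on $\varphi_{\mathrm{tr}}^{-1}$ and $(\ast)$ holds.
   Context: Permutations. $S(I)$ is the group of permutations of a finite set $I$, $\#$ the number of orbits (of a permutation) or blocks (of a set partition), $\Pi(\pi)$ the partition of $I$ into orbits of $\pi$; $\wedge$ and $\vee$ are meet and join in the lattice of set partitions ordered by refinement. $\pm I=I\cup(-I)$, with $\infty\neq-\infty$ formal points; $\delta:k\mapsto-k$. $\mathrm{PM}(I)$ is the set of $\pi\in S(\pm I)$ with $\delta\pi\delta=\pi^{-1}$ and no $k,-k$ in the same cycle. Poset. Multiplying a permutation by a transposition $(a,b)$ joins the cycles containing $a$ and $b$ if they are different and splits the cycle if they are in the same cycle. For $\pi,\rho\in S(I)$, $\pi\preceq\rho$ if $\rho$ can be obtained from $\pi$ by successively joining cycles in this manner (zero or more multiplications by transpositions, each joining two cycles). Planarity. For $\pi,\rho\in S(I)$, $\pi$ is planar on $\rho$ if $\#(\pi)+\#(\rho)+\#(\pi\rho)-|I|=2\,\#(\Pi(\pi)\vee\Pi(\rho))$. For $\pi,\rho\in\mathrm{PM}(I)$, $\pi$ is planar on $\rho$ if there is $J\subseteq\pm I$ containing exactly one of $k,-k$ for every $k\in I$, which is a union of cycles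 of $\pi$ and a union of cycles of $\rho$, such that $\pi|_J$ is planar on $\rho|_J$. Bracket diagrams. A bracket diagram on symbols is an ordering of the symbols from left to right together with a legal (properly nested) placement of left and right brackets between (and around) them. Its permutation is obtained by placing a symbol $X_\infty$ before the first term (and, cyclically, after the last): each symbol belongs to its innermost enclosing pair of brackets, or to the outer level if there is none, and the permutation sends the subscript of a symbol to the subscript of the next symbol at the same level, ignoring any further bracketed intervals, cyclically within each bracketed interval, and cyclically including $\infty$ at the outer level. If brackets are labelled $\mathrm{Re}$ or $\mathrm{tr}$ (all brackets together being properly nested), the permutation associated with $\mathrm{Re}$ (respectively $\mathrm{tr}$) is that of the diagram in which only the brackets labelled $\mathrm{Re}$ (respectively $\mathrm{tr}$) are kept. In part (2) the subscripts of the symbols together with $\infty$ form a set $J\subseteq\pm[n]_\infty$ containing exactly one of $k,-k$ for each $k\in[n]_\infty$, and "$\varphi$ is the permutation associated to the function" means that $J$ is a union of cycles of $\varphi$ and the associated permutation of $J$ is $\varphi|_J$. Interpretation: the $X_k$ are $N\times N$ quaternionic matrices, a labelled diagram is read as a product of matrices in which $\mathrm{Re}$ (entrywise real part) and $\mathrm{tr}$ (normalized trace $\frac1N\sum_i A_{ii}$, as a quaternion multiple of the identity matrix) are applied to the bracketed subexpressions. $\mathrm{Re}_{\varphi_{\mathrm{Re}}}\mathrm{tr}_{\varphi_{\mathrm{tr}}}(X_1,\dots,X_n)$ denotes the normalized index contraction in which the matrix indices are contracted along the cycles of $\varphi_{\mathrm{tr}}$ and the indices of the $2\times2$ complex matrix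 representation of the quaternions along the cycles of $\varphi_{\mathrm{Re}}$ (the point $\infty$ marking the uncontracted indices); a labelled diagram with associated permutations $\varphi_{\mathrm{Re}},\varphi_{\mathrm{tr}}$ evaluates to it. *)

theory Defs
  imports
    "HOL-Library.Disjoint_Sets"
    "HOL-Library.Extended_Nat"
    "HOL-Combinatorics.Cycles"
    "HOL-Combinatorics.Orbits"
begin

section \<open>Orbits and the lattice of set partitions\<close>

text \<open>
  An element of \<open>S(I)\<close> is a function \<open>\<pi>\<close> with \<open>\<pi> permutes I\<close>, and products are compositions.
  The underlying set \<open>I\<close> is an explicit argument, because fixed points in \<open>I\<close> count as orbits.
\<close>

definition orbit_partition :: "'a set \<Rightarrow> ('a \<Rightarrow> 'a) \<Rightarrow> 'a set set" where
  "orbit_partition I \<pi> = orbit \<pi> ` I"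

definition partition_meet :: "'a set set \<Rightarrow> 'a set set \<Rightarrow> 'a set set" where
  "partition_meet P Q = common_refinement {P, Q}"

text \<open>
  The least upper bound, obtained as the meet of all upper bounds
  (see \<open>partition_join_upper\<close> and \<open>partition_join_least\<close>).
\<close>

definition partition_join :: "'a set \<Rightarrow> 'a set set \<Rightarrow> 'a set set \<Rightarrow> 'a set set" where
  "partition_join I P Q = common_refinement {R. refines I P R \<and> refines I Q R}"

lemma partition_join_upper:
  assumes "partition_on I P" and "partition_on I Q"
  shows "refines I P (partition_join I P Q)" and "refines I Q (partition_join I P Q)"
proof -
  let ?U = "{R. refines I P R \<and> refines I Q R}"
  have U: "\<And>R. R \<in> ?U \<Longrightarrow> partition_on I R"
    by (auto simp: refines_def)
  have "(if I = {} then {} else {I}) \<in> ?U"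
  proof (cases "I = {}")
    case True
    then show ?thesis
      using assms by (auto simp: refines_def partition_on_empty)
  next
    case False
    then show ?thesis
      using assms partition_on_space[of I] by (auto simp: refines_def dest: partition_onD1)
  qed
  then have ne: "?U \<noteq> {}"
    by blast
  show "refines I P (partition_join I P Q)"
    unfolding partition_join_def
    by (rule common_refinement_coarsest[OF U assms(1) _ ne]) auto
  show "refines I Q (partition_join I P Q)"
    unfolding partition_join_def
    by (rule common_refinement_coarsest[OF U assms(2) _ ne]) auto
qed

lemma partition_join_least:
  assumes "refines I P R" and "refines I Q R"
  shows "refines I (partition_join I P Q) R"
  unfolding partition_join_def
  by (rule refines_common_refinement) (use assms in \<open>auto simp: refines_def\<close>)


section \<open>The poset of permutations\<close>

text \<open>
  Multiplying by the transposition on the left gives the same relation, because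
  \<open>\<pi> \<circ> transpose a b = transpose (\<pi> a) (\<pi> b) \<circ> \<pi>\<close>.
\<close>

definition joins_cycles :: "'a set \<Rightarrow> ('a \<Rightarrow> 'a) \<Rightarrow> ('a \<Rightarrow> 'a) \<Rightarrow> bool" where
  "joins_cycles I \<pi> \<rho> \<longleftrightarrow>
     (\<exists>a\<in>I. \<exists>b\<in>I. orbit \<pi> a \<noteq> orbit \<pi> b \<and> \<rho> = \<pi> \<circ> transpose a b)"

definition perm_le :: "'a set \<Rightarrow> ('a \<Rightarrow> 'a) \<Rightarrow> ('a \<Rightarrow> 'a) \<Rightarrow> bool" where
  "perm_le I = (joins_cycles I)\<^sup>*\<^sup>*"


section \<open>Signed points\<close>

text \<open>\<open>Pos k\<close> and \<open>Neg k\<close> are the formal points \<open>k\<close> and \<open>-k\<close>.\<close>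

datatype 'a signed = Pos 'a | Neg 'a

fun flip :: "'a signed \<Rightarrow> 'a signed" where
  "flip (Pos k) = Neg k"
| "flip (Neg k) = Pos k"

definition signed_set :: "'a set \<Rightarrow> 'a signed set" where
  "signed_set I = Pos ` I \<union> Neg ` I"

definition PM :: "'a set \<Rightarrow> ('a signed \<Rightarrow> 'a signed) set" where
  "PM I = {\<pi>. \<pi> permutes signed_set I \<and> flip \<circ> \<pi> \<circ> flip = inv \<pi> \<and>
              (\<forall>k\<in>I. Neg k \<notin> orbit \<pi> (Pos k))}"

definition sign_choice :: "'a set \<Rightarrow> 'a signed set \<Rightarrow> bool" where
  "sign_choice I J \<longleftrightarrow> J \<subseteq> signed_set I \<and> (\<forall>k\<in>I. Pos k \<in> J \<longleftrightarrow> Neg k \<notin> J)"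

definition union_of_cycles :: "'a set \<Rightarrow> ('a \<Rightarrow> 'a) \<Rightarrow> 'a set \<Rightarrow> bool" where
  "union_of_cycles I \<pi> J \<longleftrightarrow> (\<exists>C \<subseteq> orbit_partition I \<pi>. J = \<Union>C)"


section \<open>Planarity\<close>

definition planar_on :: "'a set \<Rightarrow> ('a \<Rightarrow> 'a) \<Rightarrow> ('a \<Rightarrow> 'a) \<Rightarrow> bool" where
  "planar_on I \<pi> \<rho> \<longleftrightarrow>
     int (card (orbit_partition I \<pi>)) + int (card (orbit_partition I \<rho>))
       + int (card (orbit_partition I (\<pi> \<circ> \<rho>))) - int (card I)
     = 2 * int (card (partition_join I (orbit_partition I \<pi>) (orbit_partition I \<rho>)))"

definition PM_planar_on ::
    "'a set \<Rightarrow> ('a signed \<Rightarrow> 'a signed) \<Rightarrow> ('a signed \<Rightarrow> 'a signed) \<Rightarrow> bool" where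
  "PM_planar_on I \<pi> \<rho> \<longleftrightarrow>
     (\<exists>J. sign_choice I J \<and> union_of_cycles (signed_set I) \<pi> J \<and>
          union_of_cycles (signed_set I) \<rho> J \<and>
          planar_on J (perm_restrict \<pi> J) (perm_restrict \<rho> J))"


section \<open>Bracket diagrams\<close>

text \<open>
  A bracket diagram is a word of symbols and properly nested labelled brackets, represented
  by its parse tree; \<open>Sym k\<close> stands for the symbol \<open>X\<^sub>k\<close>. The tree allows a bracket with
  nothing inside, which has no effect on the associated permutations.
\<close>

datatype label = Re_label | tr_label

datatype 'a item = Sym 'a | Bracket label "'a item list"

type_synonym 'a diagram = "'a item list"

fun symbols :: "'a diagram \<Rightarrow> 'a list" where
  "symbols [] = []"
| "symbols (Sym k # D) = k # symbols D"
| "symbols (Bracket l E # D) = symbols E @ symbols D"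

definition diagram_on :: "'a set \<Rightarrow> 'a diagram \<Rightarrow> bool" where
  "diagram_on S D \<longleftrightarrow> distinct (symbols D) \<and> set (symbols D) = S"

fun keep_brackets :: "label \<Rightarrow> 'a diagram \<Rightarrow> 'a diagram" where
  "keep_brackets l [] = []"
| "keep_brackets l (Sym k # D) = Sym k # keep_brackets l D"
| "keep_brackets l (Bracket l' E # D) =
     (if l' = l then [Bracket l (keep_brackets l E)] else keep_brackets l E) @ keep_brackets l D"

fun outer_level :: "'a diagram \<Rightarrow> 'a list" where
  "outer_level [] = []"
| "outer_level (Sym k # D) = k # outer_level D"
| "outer_level (Bracket l E # D) = outer_level D"

fun bracket_levels :: "'a diagram \<Rightarrow> 'a list list" where
  "bracket_levels [] = []"
| "bracket_levels (Sym k # D) = bracket_levels D"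
| "bracket_levels (Bracket l E # D) = outer_level E # bracket_levels E @ bracket_levels D"

text \<open>
  The parameter \<open>p\<close> is the point at infinity, placed before the first term of the outer level.
  Each level contributes the cycle sending every entry to the next one and the last to the first.
\<close>

definition diagram_perm :: "'a \<Rightarrow> 'a diagram \<Rightarrow> 'a \<Rightarrow> 'a" where
  "diagram_perm p D =
     foldr (\<lambda>c \<pi>. cycle_of_list c \<circ> \<pi>) ((p # outer_level D) # bracket_levels D) id"

definition label_perm :: "label \<Rightarrow> 'a \<Rightarrow> 'a diagram \<Rightarrow> 'a \<Rightarrow> 'a" where
  "label_perm l p D = diagram_perm p (keep_brackets l D)"


section \<open>The point sets and the numerical condition\<close>

definition pts :: "nat \<Rightarrow> enat set" where
  "pts n = enat ` {1..n}"

definition pts_inf :: "nat \<Rightarrow> enat set" where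
  "pts_inf n = pts n \<union> {\<infinity>}"

definition star_eq :: "'a set \<Rightarrow> ('a \<Rightarrow> 'a) \<Rightarrow> ('a \<Rightarrow> 'a) \<Rightarrow> bool" where
  "star_eq I \<phi> \<psi> \<longleftrightarrow>
     (let P = orbit_partition I \<phi>; Q = orbit_partition I \<psi>;
          m = int (card (partition_meet P Q)); j = int (card (partition_join I P Q))
      in m - j = (m - int (card P)) + (m - int (card Q)))"

end

theory Submission
  imports Defs
begin

text \<open>
  Let \<open>\<phi>\<close> and \<open>\<psi>\<close> be permutations of a finite set \<open>I\<close> containing the point at infinity \<open>p\<close>.
  Consider the bipartite graph whose vertices are the cycles of \<open>\<phi>\<close> and the cycles of \<open>\<psi>\<close>, and
  in which every point of \<open>I\<close> is an edge joining the two cycles that contain it. The blocks of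
  the meet are the edges without multiplicity and the blocks of the join are the connected
  components. The numerical condition thus says that the number of vertices is the number of
  edges plus the number of components, that is, the graph is a forest (\<open>star_eq_iff_forest\<close>).

  From a diagram one reads off both conditions. The graph arises from the single edge of the
  outer level by opening the brackets one after the other, and every new bracket is a new
  vertex attached by one edge (\<open>level_id_forest\<close>). Dropping a pair of brackets joins two cycles,
  so the cycle through \<open>p\<close> and all symbols from left to right is an upper bound of both
  permutations (\<open>level_perm_le\<close>).

  Conversely, an upper bound can be enlarged to a single cycle. Cutting it open at \<open>p\<close> orders
  \<open>I\<close> linearly, and both permutations are noncrossing for this order
  (\<open>common_noncrossing_order\<close>). If moreover the graph is a forest, there is a point that is
  fixed by one of the permutations, or has the same predecessor in both
  (\<open>removable_point_exists\<close>). Such a point can be removed, and it can be put back into a diagram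
  for the remaining points by a local change, so a diagram exists by induction
  (\<open>diagram_exists\<close>). Its symbols need not come in the given order, because a point is put back
  directly behind its predecessor in one of the permutations.

  For the second part it remains to compare planarity with the existence of an upper bound.
  Factor \<open>\<psi>\<^sup>-\<^sup>1 \<phi>\<close> into the least possible number of transpositions and multiply \<open>\<psi>\<close> by them one
  after the other. The transpositions that connect the cycles of \<open>\<psi>\<close> can be moved to the
  beginning; planarity says that all others then split a cycle, and so an upper bound is passed
  on the way (\<open>genus_inequality\<close>). For the converse, the induction that constructs a diagram also
  yields a factorization whose length forces planarity (\<open>planar_on_inv_iff_upper_bound\<close>).
  Finally, a permutation in \<open>PM\<close> consists of two mirror images, exchanged by \<open>flip\<close>, and
  both conditions can be checked on one of them.
\<close>

section \<open>Cycles and transpositions\<close>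

lemma mem_orbit_self: "finite I \<Longrightarrow> \<pi> permutes I \<Longrightarrow> x \<in> orbit \<pi> x"
  by (meson permutation_permutes permutation_self_in_orbit)

lemma orbit_eq_iff: "finite I \<Longrightarrow> \<pi> permutes I \<Longrightarrow> orbit \<pi> x = orbit \<pi> y \<longleftrightarrow> y \<in> orbit \<pi> x"
  by (metis cyclic_on_orbit mem_orbit_self orbit_cyclic_eq3)

lemma orbit_closed_subset:
  assumes "x \<in> S" and "\<And>y. y \<in> S \<Longrightarrow> f y \<in> S"
  shows "orbit f x \<subseteq> S"
proof
  fix y assume "y \<in> orbit f x"
  then show "y \<in> S" by induct (use assms in auto)
qed

text \<open>
  Since \<open>\<pi> \<circ> (a b)\<close> sends \<open>a\<close> to \<open>\<pi> b\<close> and agrees with \<open>\<pi>\<close> on the cycle of \<open>b\<close> except at \<open>b\<close>,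
  its cycle through \<open>a\<close> starts by running through the whole cycle of \<open>b\<close>.
\<close>

lemma orbit_join_subset:
  assumes fin: "finite I" and perm: "\<pi> permutes I"
    and ne: "orbit \<pi> a \<noteq> orbit \<pi> b"
  shows "orbit \<pi> b \<subseteq> orbit (\<pi> \<circ> transpose a b) a"
proof
  let ?\<rho> = "\<pi> \<circ> transpose a b"
  fix y assume "y \<in> orbit \<pi> b"
  then show "y \<in> orbit ?\<rho> a"
  proof induct
    case base
    have "?\<rho> a = \<pi> b" by simp
    then show ?case by (metis orbit.base)
  next
    case (step y)
    show ?case
    proof (cases "y = b")
      case True
      have "?\<rho> a = \<pi> b" by simp
      then show ?thesis using True by (metis orbit.base)
    next
      case False
      have "y \<noteq> a"
        using step(1) ne orbit_eq_iff[OF fin perm] by metis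
      then have "?\<rho> y = \<pi> y" using False by simp
      then show ?thesis using step(2) by (metis orbit.step)
    qed
  qed
qed

lemma permutes_comp_transpose:
  "\<pi> permutes I \<Longrightarrow> a \<in> I \<Longrightarrow> b \<in> I \<Longrightarrow> \<pi> \<circ> transpose a b permutes I"
  by (intro permutes_compose permutes_swap_id)

lemma orbit_join:
  assumes fin: "finite I" and perm: "\<pi> permutes I" and ab: "a \<in> I" "b \<in> I"
    and ne: "orbit \<pi> a \<noteq> orbit \<pi> b"
  shows "orbit (\<pi> \<circ> transpose a b) x =
    (if x \<in> orbit \<pi> a \<union> orbit \<pi> b then orbit \<pi> a \<union> orbit \<pi> b else orbit \<pi> x)"
proof -
  let ?\<rho> = "\<pi> \<circ> transpose a b"
  let ?U = "orbit \<pi> a \<union> orbit \<pi> b"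
  have perm': "?\<rho> permutes I" using permutes_comp_transpose[OF perm ab] .
  have sb: "orbit \<pi> b \<subseteq> orbit ?\<rho> a" by (rule orbit_join_subset[OF fin perm ne])
  have "orbit \<pi> a \<subseteq> orbit (\<pi> \<circ> transpose b a) b"
    by (rule orbit_join_subset[OF fin perm ne[symmetric]])
  then have sa: "orbit \<pi> a \<subseteq> orbit ?\<rho> b" by (simp add: transpose_commute)
  have "b \<in> orbit ?\<rho> a" using sb mem_orbit_self[OF fin perm] by blast
  then have eq: "orbit ?\<rho> a = orbit ?\<rho> b" using orbit_eq_iff[OF fin perm'] by blast
  have "orbit ?\<rho> a \<subseteq> ?U"
  proof (rule orbit_closed_subset)
    show "a \<in> ?U" using mem_orbit_self[OF fin perm] by blast
    fix y assume "y \<in> ?U"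
    then show "?\<rho> y \<in> ?U"
      by (cases "y = a"; cases "y = b") (auto intro: orbit.intros)
  qed
  then have U: "orbit ?\<rho> a = ?U" using sa sb eq by blast
  show ?thesis
  proof (cases "x \<in> ?U")
    case True
    then show ?thesis using U orbit_eq_iff[OF fin perm'] by metis
  next
    case False
    have "orbit ?\<rho> x = orbit \<pi> x"
    proof (rule orbit_cong)
      show "x \<in> orbit \<pi> x" by (rule mem_orbit_self[OF fin perm])
      fix s assume "s \<in> orbit \<pi> x"
      then have "s \<noteq> a" "s \<noteq> b"
        using False orbit_eq_iff[OF fin perm] mem_orbit_self[OF fin perm] by (metis UnCI)+
      then show "?\<rho> s = \<pi> s" by simp
    qed
    then show ?thesis using False by simp
  qed
qed

text \<open>
  Let \<open>k\<close> be the least positive exponent with \<open>\<pi>\<^sup>k a = b\<close>. The arc \<open>\<pi> a, \<dots>, \<pi>\<^sup>k a = b\<close> of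
  the cycle is closed under \<open>\<pi> \<circ> (a b)\<close> and does not contain \<open>a\<close>.
\<close>

lemma orbit_split:
  assumes fin: "finite I" and perm: "\<pi> permutes I" and ab: "a \<in> I" "b \<in> I" "a \<noteq> b"
    and eq: "orbit \<pi> a = orbit \<pi> b"
  shows "orbit (\<pi> \<circ> transpose a b) a \<noteq> orbit (\<pi> \<circ> transpose a b) b"
proof -
  let ?\<rho> = "\<pi> \<circ> transpose a b"
  have perm': "?\<rho> permutes I" using permutes_comp_transpose[OF perm ab(1,2)] .
  have "b \<in> orbit \<pi> a" using eq mem_orbit_self[OF fin perm] by blast
  then have ex: "\<exists>n. 0 < n \<and> (\<pi> ^^ n) a = b" by (auto simp: orbit_altdef)
  define k where "k = (LEAST n. 0 < n \<and> (\<pi> ^^ n) a = b)"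
  have k: "0 < k" "(\<pi> ^^ k) a = b" using LeastI_ex[OF ex] by (auto simp: k_def)
  have least: "(\<pi> ^^ i) a \<noteq> b" if "0 < i" "i < k" for i
    using not_less_Least[of i] that unfolding k_def by blast
  have nota: "(\<pi> ^^ i) a \<noteq> a" if "0 < i" "i \<le> k" for i
  proof
    assume ia: "(\<pi> ^^ i) a = a"
    then have "i \<noteq> k" using k ab by auto
    then have "i < k" using that by simp
    have "(\<pi> ^^ k) a = (\<pi> ^^ (k - i)) ((\<pi> ^^ i) a)"
      using \<open>i < k\<close> by (metis comp_apply funpow_add less_imp_le_nat le_add_diff_inverse2)
    then have "(\<pi> ^^ (k - i)) a = b" using ia k by simp
    then show False using least[of "k - i"] \<open>i < k\<close> that by simp
  qed
  define S where "S = {(\<pi> ^^ i) a | i. 0 < i \<and> i \<le> k}"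
  have "orbit ?\<rho> b \<subseteq> S"
  proof (rule orbit_closed_subset)
    show "b \<in> S" using k by (auto simp: S_def)
    fix y assume "y \<in> S"
    then obtain i where i: "y = (\<pi> ^^ i) a" "0 < i" "i \<le> k" by (auto simp: S_def)
    show "?\<rho> y \<in> S"
    proof (cases "i = k")
      case True
      then have "?\<rho> y = (\<pi> ^^ 1) a" using i k by simp
      then show ?thesis using k unfolding S_def by (metis (mono_tags, lifting) One_nat_def Suc_leI lessI mem_Collect_eq)
    next
      case False
      then have "y \<noteq> b" "y \<noteq> a" using i least nota by auto
      then have "?\<rho> y = (\<pi> ^^ Suc i) a" using i by simp
      then show ?thesis using False i unfolding S_def by (metis (mono_tags, lifting) Suc_leI le_neq_implies_less mem_Collect_eq zero_less_Suc)
    qed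
  qed
  moreover have "a \<notin> S" using nota unfolding S_def mem_Collect_eq by metis
  ultimately show ?thesis using mem_orbit_self[OF fin perm'] by blast
qed

lemma comp_transpose_twice [simp]: "\<pi> \<circ> transpose a b \<circ> transpose a b = \<pi>"
  by (simp add: comp_assoc)

lemma orbit_split_cases:
  assumes fin: "finite I" and perm: "\<pi> permutes I" and ab: "a \<in> I" "b \<in> I" "a \<noteq> b"
    and eq: "orbit \<pi> a = orbit \<pi> b"
  shows "orbit \<pi> x = (if x \<in> orbit (\<pi> \<circ> transpose a b) a \<union> orbit (\<pi> \<circ> transpose a b) b
     then orbit (\<pi> \<circ> transpose a b) a \<union> orbit (\<pi> \<circ> transpose a b) b
     else orbit (\<pi> \<circ> transpose a b) x)"
  using orbit_join[OF fin permutes_comp_transpose[OF perm ab(1,2)] ab(1,2)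
      orbit_split[OF fin perm ab eq], of x] by simp

definition cycle_count :: "'a set \<Rightarrow> ('a \<Rightarrow> 'a) \<Rightarrow> nat" where
  "cycle_count I \<pi> = card (orbit_partition I \<pi>)"

lemma cycle_count_join:
  assumes fin: "finite I" and perm: "\<pi> permutes I" and ab: "a \<in> I" "b \<in> I"
    and ne: "orbit \<pi> a \<noteq> orbit \<pi> b"
  shows "cycle_count I \<pi> = Suc (cycle_count I (\<pi> \<circ> transpose a b))"
proof -
  let ?\<rho> = "\<pi> \<circ> transpose a b"
  let ?A = "orbit \<pi> a" and ?B = "orbit \<pi> b"
  let ?X = "orbit \<pi> ` (I - (?A \<union> ?B))"
  have sub: "?A \<subseteq> I" "?B \<subseteq> I" using permutes_orbit_subset[OF perm] ab by auto
  have self: "x \<in> orbit \<pi> x" for x by (rule mem_orbit_self[OF fin perm])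
  have "orbit \<pi> ` I = insert ?A (insert ?B ?X)"
  proof -
    have "I = (?A \<union> ?B) \<union> (I - (?A \<union> ?B))" using sub by blast
    moreover have "orbit \<pi> ` (?A \<union> ?B) = {?A, ?B}"
    proof
      show "orbit \<pi> ` (?A \<union> ?B) \<subseteq> {?A, ?B}"
        using orbit_eq_iff[OF fin perm] by blast
    qed (use self in auto)
    ultimately show ?thesis by (metis image_Un insert_is_Un Un_insert_left sup_bot_left)
  qed
  moreover have "orbit ?\<rho> ` I = insert (?A \<union> ?B) ?X"
  proof -
    have "I = (?A \<union> ?B) \<union> (I - (?A \<union> ?B))" using sub by blast
    moreover have "orbit ?\<rho> ` (?A \<union> ?B) = {?A \<union> ?B}"
      using self orbit_join[OF fin perm ab ne] by (auto simp: image_iff)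
    moreover have "orbit ?\<rho> ` (I - (?A \<union> ?B)) = ?X"
      using orbit_join[OF fin perm ab ne] by (intro image_cong) auto
    ultimately show ?thesis by (metis image_Un insert_is_Un)
  qed
  moreover have "?A \<notin> insert ?B ?X" "?B \<notin> ?X" "?A \<union> ?B \<notin> ?X"
    using self ne by blast+
  ultimately show ?thesis
    using fin by (simp add: cycle_count_def orbit_partition_def)
qed

lemma cycle_count_split:
  assumes "finite I" and "\<pi> permutes I" and "a \<in> I" "b \<in> I" "a \<noteq> b"
    and "orbit \<pi> a = orbit \<pi> b"
  shows "cycle_count I (\<pi> \<circ> transpose a b) = Suc (cycle_count I \<pi>)"
  using cycle_count_join[OF assms(1) permutes_comp_transpose[OF assms(2-4)] assms(3,4)
      orbit_split[OF assms]] by simp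

lemma cycle_count_step:
  assumes "finite I" and "\<pi> permutes I" and "a \<in> I" "b \<in> I"
  shows "cycle_count I (\<pi> \<circ> transpose a b) \<le> Suc (cycle_count I \<pi>)"
    and "cycle_count I \<pi> \<le> Suc (cycle_count I (\<pi> \<circ> transpose a b))"
proof -
  consider "a = b" | "orbit \<pi> a \<noteq> orbit \<pi> b" | "a \<noteq> b" "orbit \<pi> a = orbit \<pi> b" by blast
  then have "cycle_count I (\<pi> \<circ> transpose a b) \<le> Suc (cycle_count I \<pi>) \<and>
    cycle_count I \<pi> \<le> Suc (cycle_count I (\<pi> \<circ> transpose a b))"
    by cases (use cycle_count_join[OF assms] cycle_count_split[OF assms] in auto)
  then show "cycle_count I (\<pi> \<circ> transpose a b) \<le> Suc (cycle_count I \<pi>)"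
    and "cycle_count I \<pi> \<le> Suc (cycle_count I (\<pi> \<circ> transpose a b))" by auto
qed


section \<open>Products of transpositions\<close>

fun swaps :: "('a \<times> 'a) list \<Rightarrow> 'a \<Rightarrow> 'a" where
  "swaps [] = id"
| "swaps ((a, b) # ts) = transpose a b \<circ> swaps ts"

lemma swaps_append: "swaps (ts @ us) = swaps ts \<circ> swaps us"
  by (induct ts rule: swaps.induct) (auto simp: comp_assoc)

lemma swaps_permutes: "set ts \<subseteq> I \<times> I \<Longrightarrow> swaps ts permutes I"
  by (induct ts rule: swaps.induct) (auto simp: permutes_id intro!: permutes_compose permutes_swap_id)

lemma swaps_conj:
  assumes "inj h"
  shows "h \<circ> swaps ts = swaps (map (map_prod h h) ts) \<circ> h"
proof (induct ts rule: swaps.induct)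
  case (2 a b ts)
  have "h \<circ> transpose a b = transpose (h a) (h b) \<circ> h"
    using assms by (auto simp: fun_eq_iff transpose_def inj_eq)
  then show ?case using 2 by (auto simp: fun_eq_iff)
qed simp

lemma cycle_count_swaps:
  assumes fin: "finite I" and perm: "\<pi> permutes I" and ts: "set ts \<subseteq> I \<times> I"
  shows "cycle_count I (\<pi> \<circ> swaps ts) \<le> cycle_count I \<pi> + length ts"
    and "cycle_count I \<pi> \<le> cycle_count I (\<pi> \<circ> swaps ts) + length ts"
proof -
  have "cycle_count I (\<pi> \<circ> swaps ts) \<le> cycle_count I \<pi> + length ts \<and>
    cycle_count I \<pi> \<le> cycle_count I (\<pi> \<circ> swaps ts) + length ts"
    using perm ts
  proof (induct ts arbitrary: \<pi> rule: swaps.induct)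
    case (2 a b ts)
    have ab: "a \<in> I" "b \<in> I" and ts: "set ts \<subseteq> I \<times> I" using 2(3) by auto
    have p: "\<pi> \<circ> transpose a b permutes I" using 2(2) ab by (rule permutes_comp_transpose)
    have e: "\<pi> \<circ> swaps ((a, b) # ts) = \<pi> \<circ> transpose a b \<circ> swaps ts" by (simp add: comp_assoc)
    show ?case
      using 2(1)[OF p ts] cycle_count_step[OF fin 2(2) ab] unfolding e list.size
      by (intro conjI; linarith)
  qed auto
  then show "cycle_count I (\<pi> \<circ> swaps ts) \<le> cycle_count I \<pi> + length ts"
    and "cycle_count I \<pi> \<le> cycle_count I (\<pi> \<circ> swaps ts) + length ts" by auto
qed

lemma cycle_count_id: "cycle_count I id = card I"
proof -
  have "orbit_partition I id = (\<lambda>x. {x}) ` I"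
    unfolding orbit_partition_def by (intro image_cong) (simp_all add: orbit_eq_singleton_iff)
  then show ?thesis by (simp add: cycle_count_def card_image)
qed

lemma cycle_count_le: "finite I \<Longrightarrow> cycle_count I \<pi> \<le> card I"
  by (simp add: cycle_count_def orbit_partition_def card_image_le)

text \<open>
  While \<open>g\<close> moves a point \<open>x\<close>, the transposition of \<open>x\<close> and \<open>g x\<close> splits off a fixed point; the
  process ends at the identity, which has \<open>card I\<close> cycles.
\<close>

lemma permutes_swaps_exist:
  assumes fin: "finite I" and perm: "g permutes I"
  shows "\<exists>ts. set ts \<subseteq> I \<times> I \<and> swaps ts = g \<and> length ts + cycle_count I g = card I"
  using perm
proof (induct "card I - cycle_count I g" arbitrary: g rule: less_induct)
  case less
  show ?case
  proof (cases "g = id")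
    case True
    then show ?thesis by (intro exI[of _ "[]"]) (simp add: cycle_count_id)
  next
    case False
    then obtain x where x: "g x \<noteq> x" by (auto simp: fun_eq_iff)
    then have xI: "x \<in> I" "g x \<in> I" using less.prems by (metis permutes_def permutes_in_image)+
    let ?h = "g \<circ> transpose x (g x)"
    have "orbit g x = orbit g (g x)"
      by (metis fin less.prems permutation_orbit_step permutation_permutes)
    then have c: "cycle_count I ?h = Suc (cycle_count I g)"
      using cycle_count_split[OF fin less.prems xI] x by metis
    have h: "?h permutes I" using permutes_comp_transpose[OF less.prems xI] .
    have "card I - cycle_count I ?h < card I - cycle_count I g"
      using c cycle_count_le[OF fin, of ?h] by simp
    then obtain ts where ts: "set ts \<subseteq> I \<times> I" "swaps ts = ?h"
        "length ts + cycle_count I ?h = card I"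
      using less.hyps[OF _ h] by auto
    have "swaps (ts @ [(x, g x)]) = g" using ts(2) by (simp add: swaps_append)
    then show ?thesis using ts c xI by (intro exI[of _ "ts @ [(x, g x)]"]) auto
  qed
qed

section \<open>Connected components of a pair of labellings\<close>

definition links :: "'a set \<Rightarrow> ('a \<Rightarrow> 'b) \<Rightarrow> ('a \<Rightarrow> 'c) \<Rightarrow> ('a \<times> 'a) set" where
  "links I a b = {(x, y). x \<in> I \<and> y \<in> I \<and> (a x = a y \<or> b x = b y)}"

definition component :: "'a set \<Rightarrow> ('a \<Rightarrow> 'b) \<Rightarrow> ('a \<Rightarrow> 'c) \<Rightarrow> 'a \<Rightarrow> 'a set" where
  "component I a b x = {y. (x, y) \<in> (links I a b)\<^sup>*}"

definition component_count :: "'a set \<Rightarrow> ('a \<Rightarrow> 'b) \<Rightarrow> ('a \<Rightarrow> 'c) \<Rightarrow> nat" where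
  "component_count I a b = card (component I a b ` I)"

lemma component_eq_iff: "component I a b x = component I a b y \<longleftrightarrow> (x, y) \<in> (links I a b)\<^sup>*"
proof -
  have "sym ((links I a b)\<^sup>*)" by (intro sym_rtrancl) (auto simp: links_def sym_def)
  then show ?thesis
    unfolding component_def set_eq_iff mem_Collect_eq by (metis rtrancl.rtrancl_refl rtrancl_trans symD)
qed

lemma mem_component_iff: "y \<in> component I a b x \<longleftrightarrow> component I a b x = component I a b y"
  unfolding component_eq_iff by (simp add: component_def)

lemma component_eqI:
  "x \<in> I \<Longrightarrow> y \<in> I \<Longrightarrow> a x = a y \<or> b x = b y \<Longrightarrow> component I a b x = component I a b y"
  unfolding component_eq_iff by (rule r_into_rtrancl) (simp add: links_def)

lemma component_constant:
  assumes "component I a b x = component I a b y"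
    and "\<And>u v. u \<in> I \<Longrightarrow> v \<in> I \<Longrightarrow> a u = a v \<or> b u = b v \<Longrightarrow> h u = h v"
  shows "h x = h y"
proof -
  have "(x, y) \<in> (links I a b)\<^sup>*" using assms(1) component_eq_iff by metis
  then show ?thesis by induct (use assms(2) in \<open>auto simp: links_def\<close>)
qed

lemma card_image_kernel_le:
  assumes "finite I" and "\<And>x y. x \<in> I \<Longrightarrow> y \<in> I \<Longrightarrow> f x = f y \<Longrightarrow> g x = g y"
  shows "card (g ` I) \<le> card (f ` I)"
proof -
  have inv: "inv_into I f (f x) \<in> I" "f (inv_into I f (f x)) = f x" if "x \<in> I" for x
    using that by (auto intro: inv_into_into f_inv_into_f)
  have "g ` I = (g \<circ> inv_into I f) ` f ` I"
    unfolding image_image comp_def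
    by (rule image_cong[OF refl], rule assms(2)) (simp_all add: inv)
  then show ?thesis using assms(1) by (simp add: card_image_le del: image_comp)
qed

lemma card_image_kernel_eq:
  assumes "finite I" and "\<And>x y. x \<in> I \<Longrightarrow> y \<in> I \<Longrightarrow> f x = f y \<longleftrightarrow> g x = g y"
  shows "card (g ` I) = card (f ` I)"
  using card_image_kernel_le[OF assms(1), of f g] card_image_kernel_le[OF assms(1), of g f] assms(2)
  by (meson antisym)

lemma component_count_refined:
  assumes "finite I"
    and refines: "\<And>x y. x \<in> I \<Longrightarrow> y \<in> I \<Longrightarrow> a x = a y \<Longrightarrow> b x = b y"
  shows "component_count I a b = card (b ` I)"
  unfolding component_count_def
proof (rule card_image_kernel_eq[OF assms(1)])
  fix x y assume xy: "x \<in> I" "y \<in> I"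
  show "b x = b y \<longleftrightarrow> component I a b x = component I a b y"
  proof
    assume "b x = b y"
    then show "component I a b x = component I a b y" using xy by (intro component_eqI) auto
  next
    assume "component I a b x = component I a b y"
    then show "b x = b y" by (rule component_constant) (use refines in blast)
  qed
qed

lemma component_count_mono:
  assumes "finite I"
    and "\<And>x y. x \<in> I \<Longrightarrow> y \<in> I \<Longrightarrow> a x = a y \<or> b x = b y \<Longrightarrow> a' x = a' y \<or> b' x = b' y"
  shows "component_count I a' b' \<le> component_count I a b"
  unfolding component_count_def
proof (rule card_image_kernel_le[OF assms(1)])
  fix x y assume "component I a b x = component I a b y"
  then show "component I a' b' x = component I a' b' y"
  proof (rule component_constant)
    fix u v assume "u \<in> I" "v \<in> I" "a u = a v \<or> b u = b v"
    then show "component I a' b' u = component I a' b' v"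
      using assms(2) by (intro component_eqI) auto
  qed
qed


section \<open>The order on permutations and the genus inequality\<close>

lemma cycle_count_eq_card: "cycle_count I \<pi> = card (orbit \<pi> ` I)"
  by (simp add: cycle_count_def orbit_partition_def)

lemma joins_cyclesI:
  "a \<in> I \<Longrightarrow> b \<in> I \<Longrightarrow> orbit \<pi> a \<noteq> orbit \<pi> b \<Longrightarrow> joins_cycles I \<pi> (\<pi> \<circ> transpose a b)"
  by (auto simp: joins_cycles_def)

lemma joins_cycles_permutes: "joins_cycles I \<pi> \<rho> \<Longrightarrow> \<pi> permutes I \<Longrightarrow> \<rho> permutes I"
  by (auto simp: joins_cycles_def intro: permutes_comp_transpose)

lemma perm_le_refl: "perm_le I \<pi> \<pi>"
  by (simp add: perm_le_def)

lemma perm_le_trans: "perm_le I \<pi> \<rho> \<Longrightarrow> perm_le I \<rho> \<sigma> \<Longrightarrow> perm_le I \<pi> \<sigma>"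
  by (simp add: perm_le_def)

lemma joins_cycles_perm_le: "joins_cycles I \<pi> \<rho> \<Longrightarrow> perm_le I \<pi> \<rho>"
  by (simp add: perm_le_def)

lemma perm_le_permutes: "perm_le I \<pi> \<rho> \<Longrightarrow> \<pi> permutes I \<Longrightarrow> \<rho> permutes I"
  unfolding perm_le_def by (induct rule: rtranclp_induct) (auto intro: joins_cycles_permutes)

text \<open>
  A factor changes the number of cycles by at most one, so when the number of factors equals the
  loss in the number of cycles from \<open>\<rho>\<close> to \<open>\<tau>\<close>, every factor splits a cycle.
\<close>

lemma perm_le_of_swaps:
  assumes fin: "finite I" and perm: "\<tau> permutes I" and ts: "set ts \<subseteq> I \<times> I"
    and len: "cycle_count I \<tau> + length ts \<le> cycle_count I (\<tau> \<circ> swaps ts)"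
  shows "perm_le I (\<tau> \<circ> swaps ts) \<tau>"
  using ts len
proof (induct ts rule: rev_induct)
  case Nil
  show ?case by (simp add: perm_le_refl)
next
  case (snoc t ts)
  obtain a b where t: "t = (a, b)" by (cases t)
  have ab: "a \<in> I" "b \<in> I" and ts: "set ts \<subseteq> I \<times> I" using snoc(2) t by auto
  let ?\<sigma> = "\<tau> \<circ> swaps ts"
  let ?\<rho> = "?\<sigma> \<circ> transpose a b"
  have \<rho>: "\<tau> \<circ> swaps (ts @ [t]) = ?\<rho>" by (simp add: t swaps_append comp_assoc)
  have ps: "?\<sigma> permutes I" by (intro permutes_compose swaps_permutes ts perm)
  have pr: "?\<rho> permutes I" using ps ab by (rule permutes_comp_transpose)
  have len: "cycle_count I \<tau> + Suc (length ts) \<le> cycle_count I ?\<rho>"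
    using snoc(3) unfolding \<rho> length_append_singleton .
  have bound: "cycle_count I ?\<sigma> \<le> cycle_count I \<tau> + length ts"
    using cycle_count_swaps(1)[OF fin perm ts] .
  have step: "cycle_count I ?\<rho> \<le> Suc (cycle_count I ?\<sigma>)"
    using cycle_count_step(1)[OF fin ps ab] .
  have le: "perm_le I ?\<sigma> \<tau>"
    by (rule snoc(1)[OF ts]) (use len step in linarith)
  have "orbit ?\<rho> a \<noteq> orbit ?\<rho> b"
  proof
    assume eq: "orbit ?\<rho> a = orbit ?\<rho> b"
    have "cycle_count I ?\<rho> \<le> cycle_count I ?\<sigma>"
    proof (cases "a = b")
      case False
      show ?thesis using cycle_count_split[OF fin pr ab False eq] by simp
    qed simp
    then show False using len bound by linarith
  qed
  then have "joins_cycles I ?\<rho> ?\<sigma>" using joins_cyclesI[OF ab, of ?\<rho>] by simp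
  then show ?case unfolding \<rho> using le by (meson joins_cycles_perm_le perm_le_trans)
qed

text \<open>
  If some factor joins two cycles of \<open>\<tau>\<close>, it can be moved to the front (conjugating the factors
  before it) and applied first; this lowers the number of cycles of \<open>\<tau>\<close> without creating
  components. If no factor does, every cycle of \<open>\<rho>\<close> lies inside one of \<open>\<tau>\<close>, so the
  components are the cycles of \<open>\<tau>\<close>. In the extremal case the joined permutation reached
  in this way is an upper bound of \<open>\<tau>\<close> and \<open>\<rho>\<close>.
\<close>

lemma genus_inequality:
  assumes fin: "finite I" and perm: "\<tau> permutes I" and ts: "set ts \<subseteq> I \<times> I"
    and \<rho>: "\<rho> = \<tau> \<circ> swaps ts"
  shows "cycle_count I \<rho> + cycle_count I \<tau>
      \<le> 2 * component_count I (orbit \<rho>) (orbit \<tau>) + length ts \<and>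
    (2 * component_count I (orbit \<rho>) (orbit \<tau>) + length ts
        \<le> cycle_count I \<rho> + cycle_count I \<tau> \<longrightarrow>
      (\<exists>\<sigma>. perm_le I \<rho> \<sigma> \<and> perm_le I \<tau> \<sigma>))"
  using perm ts \<rho>
proof (induct "length ts" arbitrary: ts \<tau>)
  case (0 ts \<tau>)
  then have "\<rho> = \<tau>" by simp
  have "component_count I (orbit \<tau>) (orbit \<tau>) = card (orbit \<tau> ` I)"
    by (rule component_count_refined[OF fin])
  then show ?case using \<open>\<rho> = \<tau>\<close> 0 perm_le_refl by (auto simp: cycle_count_eq_card)
next
  case (Suc n ts \<tau>)
  note perm = \<open>\<tau> permutes I\<close> and ts = \<open>set ts \<subseteq> I \<times> I\<close> and \<rho> = \<open>\<rho> = \<tau> \<circ> swaps ts\<close>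
  have perm_\<rho>: "\<rho> permutes I" unfolding \<rho> by (intro permutes_compose swaps_permutes ts perm)
  show ?case
  proof (cases "\<exists>a b. (a, b) \<in> set ts \<and> orbit \<tau> a \<noteq> orbit \<tau> b")
    case True
    then obtain a b us vs where ts_eq: "ts = us @ (a, b) # vs" and ne: "orbit \<tau> a \<noteq> orbit \<tau> b"
      by (meson split_list)
    have ab: "a \<in> I" "b \<in> I" using ts ts_eq by auto
    let ?h = "transpose a b"
    let ?us = "map (map_prod ?h ?h) us"
    have h: "?h permutes I" using ab by (rule permutes_swap_id)
    have "?h \<circ> swaps us = swaps ?us \<circ> ?h" by (rule swaps_conj) simp
    then have conj: "swaps us \<circ> ?h = ?h \<circ> swaps ?us"
      by (metis comp_assoc comp_id transpose_comp_involutory id_comp)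
    let ?\<tau> = "\<tau> \<circ> ?h"
    have \<rho>': "\<rho> = ?\<tau> \<circ> swaps (?us @ vs)"
      unfolding \<rho> ts_eq swaps_append swaps.simps using conj by (metis comp_assoc)
    have perm': "?\<tau> permutes I" using perm ab by (rule permutes_comp_transpose)
    have ts': "set (?us @ vs) \<subseteq> I \<times> I"
      using ts ts_eq permutes_in_image[OF h] by (auto simp: map_prod_def)
    have n: "n = length (?us @ vs)" using Suc(2) ts_eq by simp
    have comp: "component_count I (orbit \<rho>) (orbit ?\<tau>) \<le> component_count I (orbit \<rho>) (orbit \<tau>)"
    proof (rule component_count_mono[OF fin])
      fix x y
      assume "orbit \<rho> x = orbit \<rho> y \<or> orbit \<tau> x = orbit \<tau> y"
      moreover have "orbit ?\<tau> x = orbit ?\<tau> y" if "orbit \<tau> x = orbit \<tau> y"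
        using that orbit_join[OF fin perm ab ne, of x] orbit_join[OF fin perm ab ne, of y]
          orbit_eq_iff[OF fin perm] by (metis UnCI UnE)
      ultimately show "orbit \<rho> x = orbit \<rho> y \<or> orbit ?\<tau> x = orbit ?\<tau> y" by blast
    qed
    have count: "cycle_count I \<tau> = Suc (cycle_count I ?\<tau>)"
      by (rule cycle_count_join[OF fin perm ab ne])
    have "joins_cycles I \<tau> ?\<tau>" using ab ne by (rule joins_cyclesI)
    then have le: "perm_le I \<tau> \<sigma>" if "perm_le I ?\<tau> \<sigma>" for \<sigma>
      using that by (meson joins_cycles_perm_le perm_le_trans)
    have len: "length ts = Suc n" using Suc(2) by simp
    show ?thesis
      using Suc(1)[OF n perm' ts' \<rho>'] comp count le unfolding len n[symmetric] by fastforce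
  next
    case False
    have pres: "orbit \<tau> (swaps us x) = orbit \<tau> x" if "set us \<subseteq> set ts" for us x
      using that
    proof (induct us rule: swaps.induct)
      case (2 a b us)
      then have "orbit \<tau> a = orbit \<tau> b" using False by auto
      then have "orbit \<tau> (transpose a b z) = orbit \<tau> z" for z
        by (auto simp: transpose_def)
      then show ?case using 2 by simp
    qed simp
    have "orbit \<tau> (\<rho> x) = orbit \<tau> x" for x
      unfolding \<rho> using pres[of ts x] fin perm
      by (metis comp_apply permutation_orbit_step permutation_permutes subset_refl)
    then have "orbit \<rho> x \<subseteq> {y. orbit \<tau> y = orbit \<tau> x}" for x
      by (intro orbit_closed_subset) auto
    then have refine: "orbit \<tau> x = orbit \<tau> y" if "orbit \<rho> x = orbit \<rho> y" for x y
      using that mem_orbit_self[OF fin perm_\<rho>] by blast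
    have comp: "component_count I (orbit \<rho>) (orbit \<tau>) = cycle_count I \<tau>"
      unfolding cycle_count_eq_card by (rule component_count_refined[OF fin]) (rule refine)
    have "cycle_count I \<rho> \<le> cycle_count I \<tau> + length ts"
      unfolding \<rho> by (rule cycle_count_swaps(1)[OF fin perm ts])
    moreover have "perm_le I \<rho> \<tau>" if "cycle_count I \<tau> + length ts \<le> cycle_count I \<rho>"
      using perm_le_of_swaps[OF fin perm ts] that unfolding \<rho> by blast
    ultimately show ?thesis
      using perm_le_refl[of I \<tau>] unfolding comp by auto
  qed
qed

section \<open>Forests\<close>

text \<open>
  A bipartite graph, given by its set of edges, that can be built by adding edges one by one,
  each with at least one new end. Vertices are not represented separately, so isolated
  vertices do not occur.
\<close>

inductive forest :: "('b \<times> 'c) set \<Rightarrow> bool" where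
  empty: "forest {}"
| insert: "forest E \<Longrightarrow> a \<notin> Domain E \<or> b \<notin> Range E \<Longrightarrow> forest (insert (a, b) E)"

text \<open>Skipping the edges outside \<open>F\<close> in the construction of \<open>E\<close> keeps new ends new.\<close>

lemma forest_subset: "forest E \<Longrightarrow> F \<subseteq> E \<Longrightarrow> forest F"
proof (induct arbitrary: F rule: forest.induct)
  case empty
  then show ?case by (simp add: forest.empty)
next
  case (insert E a b)
  have F: "forest (F - {(a, b)})" by (rule insert(2)) (use insert(4) in auto)
  show ?case
  proof (cases "(a, b) \<in> F")
    case True
    have "a \<notin> Domain (F - {(a, b)}) \<or> b \<notin> Range (F - {(a, b)})"
      using insert(3,4) by blast
    from forest.insert[OF F this] show ?thesis using True by (simp add: insert_absorb)
  next
    case False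
    then show ?thesis using F by simp
  qed
qed

lemma forest_union:
  assumes "forest E" and "forest F" and "Domain E \<inter> Domain F = {}" and "Range E \<inter> Range F = {}"
  shows "forest (E \<union> F)"
  using assms
proof (induct rule: forest.induct)
  case (insert E a b)
  have "forest (insert (a, b) (E \<union> F))"
    by (rule forest.insert) (use insert in auto)
  then show ?case by simp
qed simp

lemma forest_image:
  assumes "forest E" and "inj_on f (Domain E)" and "inj_on g (Range E)"
  shows "forest (map_prod f g ` E)"
  using assms
proof (induct rule: forest.induct)
  case empty
  then show ?case by (simp add: forest.empty)
next
  case (insert E a b)
  have IH: "forest (map_prod f g ` E)"
    by (rule insert(2)) (use insert(4,5) in \<open>auto intro: inj_on_subset\<close>)
  have "f a \<notin> Domain (map_prod f g ` E) \<or> g b \<notin> Range (map_prod f g ` E)"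
    using insert(3)
  proof
    assume a: "a \<notin> Domain E"
    have "f a' \<noteq> f a" if "(a', b') \<in> E" for a' b'
      using that a inj_onD[OF insert(4), of a' a] by auto
    then show ?thesis by fastforce
  next
    assume b: "b \<notin> Range E"
    have "g b' \<noteq> g b" if "(a', b') \<in> E" for a' b'
      using that b inj_onD[OF insert(5), of b' b] by auto
    then show ?thesis by fastforce
  qed
  then show ?case using forest.insert[OF IH] by simp
qed

definition pendant :: "('b \<times> 'c) set \<Rightarrow> 'b \<times> 'c \<Rightarrow> bool" where
  "pendant E e \<longleftrightarrow> fst e \<notin> Domain (E - {e}) \<or> snd e \<notin> Range (E - {e})"

lemma forest_pendant:
  assumes "forest E" and "E \<noteq> {}"
  shows "\<exists>e\<in>E. pendant E e"
  using assms
proof cases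
  case (insert F a b)
  then have "pendant E (a, b)" by (auto simp: pendant_def)
  then show ?thesis using insert by blast
qed simp

text \<open>
  An edge added last is pendant, so in the induction only the case matters in which this edge
  is \<open>e\<^sub>0\<close>. It meets the rest in at most one vertex, and if it does,
  the induction hypothesis is applied to the rest with an edge \<open>e\<^sub>1\<close> at this vertex in place
  of \<open>e\<^sub>0\<close>.
\<close>

lemma forest_pendant_other:
  assumes "forest E" and "e\<^sub>0 \<in> E" and "E \<noteq> {e\<^sub>0}"
  shows "\<exists>e\<in>E. e \<noteq> e\<^sub>0 \<and> pendant E e"
  using assms
proof (induct arbitrary: e\<^sub>0 rule: forest.induct)
  case (insert E a b)
  show ?case
  proof (cases "(a, b) = e\<^sub>0")
    case False
    have "pendant (insert (a, b) E) (a, b)" using insert(3) by (auto simp: pendant_def)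
    then show ?thesis using False by blast
  next
    case True
    have E: "E \<noteq> {}" using insert(5) True by auto
    have notin: "(a, b) \<notin> E" using insert(3) by blast
    show ?thesis
    proof (cases "\<exists>e\<^sub>1\<in>E. fst e\<^sub>1 = a \<or> snd e\<^sub>1 = b")
      case False
      obtain e where e: "e \<in> E" "pendant E e" using forest_pendant[OF insert(1) E] by blast
      have "pendant (insert (a, b) E) e"
        using e False unfolding pendant_def by fastforce
      then show ?thesis using e(1) notin True by (metis insertCI)
    next
      case True
      then obtain e\<^sub>1 where e1: "e\<^sub>1 \<in> E" "fst e\<^sub>1 = a \<or> snd e\<^sub>1 = b" by blast
      show ?thesis
      proof (cases "E = {e\<^sub>1}")
        case True
        have "pendant (insert (a, b) E) e\<^sub>1"
          using insert(3) True unfolding pendant_def by (cases e\<^sub>1) auto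
        then show ?thesis using e1(1) notin \<open>(a, b) = e\<^sub>0\<close> by (metis insertCI)
      next
        case False
        obtain e where e: "e \<in> E" "e \<noteq> e\<^sub>1" "pendant E e"
          using insert(2)[OF e1(1) False] by blast
        obtain c d c\<^sub>1 d\<^sub>1 where [simp]: "e = (c, d)" "e\<^sub>1 = (c\<^sub>1, d\<^sub>1)" by (cases e, cases e\<^sub>1)
        \<comment> \<open>the end of \<open>e\<close> that makes it pendant is not an end of \<open>(a, b)\<close>: the end that
          \<open>(a, b)\<close> shares with \<open>E\<close> also belongs to \<open>e\<^sub>1\<close>\<close>
        have "pendant (insert (a, b) E) e"
          using e e1 insert(3) unfolding pendant_def by auto
        then show ?thesis using e(1) notin \<open>(a, b) = e\<^sub>0\<close> by (metis insertCI)
      qed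
    qed
  qed
qed simp


section \<open>The numerical condition characterizes forests\<close>

definition edges :: "'a set \<Rightarrow> ('a \<Rightarrow> 'b) \<Rightarrow> ('a \<Rightarrow> 'c) \<Rightarrow> ('b \<times> 'c) set" where
  "edges I a b = (\<lambda>x. (a x, b x)) ` I"

lemma image_remove_double:
  assumes "y \<in> I" and "y \<noteq> x" and "f x = f y"
  shows "f ` I = f ` (I - {x})"
proof
  show "f ` I \<subseteq> f ` (I - {x})"
  proof (rule image_subsetI)
    fix z assume "z \<in> I"
    then show "f z \<in> f ` (I - {x})" using assms by (cases "z = x") auto
  qed
qed auto

text \<open>
  Here \<open>x\<close> is a second copy of the edge \<open>y\<close>, or an edge that hangs on \<open>y\<close> and has its other end
  for itself. Moving \<open>x\<close> to \<open>y\<close> preserves links, so a path through \<open>x\<close> can avoid it.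
\<close>

lemma component_count_attached:
  assumes fin: "finite I" and x: "x \<in> I" and y: "y \<in> I" "y \<noteq> x" "b x = b y"
    and ax: "a x = a y \<or> a x \<notin> a ` (I - {x})"
  shows "component_count I a b = component_count (I - {x}) a b"
proof -
  let ?I = "I - {x}"
  have "component I a b x = component I a b y" using x y by (intro component_eqI) auto
  then have "component I a b ` I = component I a b ` ?I"
    by (rule image_remove_double[OF y(1,2)])
  moreover have "card (component I a b ` ?I) = card (component ?I a b ` ?I)"
  proof (rule card_image_kernel_eq)
    show "finite ?I" using fin by simp
    fix z w assume zw: "z \<in> ?I" "w \<in> ?I"
    show "component ?I a b z = component ?I a b w \<longleftrightarrow> component I a b z = component I a b w"
    proof
      assume "component ?I a b z = component ?I a b w"
      then show "component I a b z = component I a b w"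
        by (rule component_constant) (intro component_eqI; simp)
    next
      let ?h = "\<lambda>u. component ?I a b (if u = x then y else u)"
      assume "component I a b z = component I a b w"
      then have "?h z = ?h w"
      proof (rule component_constant)
        fix u v assume uv: "u \<in> I" "v \<in> I" "a u = a v \<or> b u = b v"
        have yI: "y \<in> ?I" using y by simp
        have key: "component ?I a b y = component ?I a b v" if "v \<in> I" "v \<noteq> x" "a x = a v \<or> b x = b v" for v
        proof (rule component_eqI[OF yI])
          show "v \<in> ?I" using that by simp
          show "a y = a v \<or> b y = b v" using that ax y by force
        qed
        show "?h u = ?h v"
        proof (cases "u = x"; cases "v = x")
          assume "u \<noteq> x" "v \<noteq> x"
          then show ?thesis using uv by (simp, intro component_eqI) auto
        qed (use key uv in \<open>auto simp: eq_commute\<close>)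
      qed
      then show "component ?I a b z = component ?I a b w" using zw by simp
    qed
  qed
  ultimately show ?thesis by (simp add: component_count_def)
qed

lemma component_count_isolated:
  assumes fin: "finite I" and x: "x \<in> I"
    and iso: "a x \<notin> a ` (I - {x})" "b x \<notin> b ` (I - {x})"
  shows "component_count I a b = Suc (component_count (I - {x}) a b)"
proof -
  let ?I = "I - {x}"
  have linked: "u = x \<longleftrightarrow> v = x" if "u \<in> I" "v \<in> I" "a u = a v \<or> b u = b v" for u v
  proof -
    have "a w \<noteq> a x \<and> b w \<noteq> b x" if "w \<in> I" "w \<noteq> x" for w
    proof -
      have "a w \<in> a ` ?I" "b w \<in> b ` ?I" using that by simp_all
      then show ?thesis using iso by metis
    qed
    then show ?thesis using that by metis
  qed
  have "component I a b x \<notin> component I a b ` ?I"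
  proof
    assume "component I a b x \<in> component I a b ` ?I"
    then obtain z where z: "z \<in> ?I" "component I a b x = component I a b z" by blast
    have "(\<lambda>u. u = x) x = (\<lambda>u. u = x) z"
      by (rule component_constant[OF z(2), of "\<lambda>u. u = x"]) (use linked in blast)
    then show False using z by simp
  qed
  moreover have "component I a b ` I = insert (component I a b x) (component I a b ` ?I)"
    using x by blast
  moreover have "card (component I a b ` ?I) = card (component ?I a b ` ?I)"
  proof (rule card_image_kernel_eq)
    show "finite ?I" using fin by simp
    fix z w assume zw: "z \<in> ?I" "w \<in> ?I"
    show "component ?I a b z = component ?I a b w \<longleftrightarrow> component I a b z = component I a b w"
    proof
      assume "component ?I a b z = component ?I a b w"
      then show "component I a b z = component I a b w"
        by (rule component_constant) (intro component_eqI; simp)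
    next
      let ?h = "\<lambda>u. if u = x then {} else component ?I a b u"
      assume "component I a b z = component I a b w"
      then have "?h z = ?h w"
      proof (rule component_constant)
        fix u v assume uv: "u \<in> I" "v \<in> I" "a u = a v \<or> b u = b v"
        show "?h u = ?h v"
        proof (cases "u = x")
          case True
          then show ?thesis using linked[OF uv] by simp
        next
          case False
          then have "component ?I a b u = component ?I a b v"
            using uv linked[OF uv] by (intro component_eqI) auto
          then show ?thesis using False linked[OF uv] by simp
        qed
      qed
      then show "component ?I a b z = component ?I a b w" using zw by simp
    qed
  qed
  ultimately show ?thesis using fin by (simp add: component_count_def)
qed

text \<open>
  Read labels as vertices and points as edges of a bipartite graph: then this says that the
  number of vertices equals the number of (distinct) edges plus the number of components.
\<close>

definition euler_forest :: "'a set \<Rightarrow> ('a \<Rightarrow> 'b) \<Rightarrow> ('a \<Rightarrow> 'c) \<Rightarrow> bool" where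
  "euler_forest I a b \<longleftrightarrow>
     card (a ` I) + card (b ` I) = card (edges I a b) + component_count I a b"

lemma euler_forest_swap: "euler_forest I a b \<longleftrightarrow> euler_forest I b a"
proof -
  have "edges I b a = (edges I a b)\<inverse>" by (auto simp: edges_def)
  then have "card (edges I b a) = card (edges I a b)" by simp
  moreover have "component_count I b a = component_count I a b"
    unfolding component_count_def component_def links_def by (simp add: disj_commute)
  ultimately show ?thesis by (auto simp: euler_forest_def)
qed

lemma euler_forest_pendant:
  assumes fin: "finite I" and x: "x \<in> I" and ax: "a x \<notin> a ` (I - {x})"
  shows "euler_forest I a b \<longleftrightarrow> euler_forest (I - {x}) a b"
proof -
  let ?I = "I - {x}"
  have I: "I = insert x ?I" using x by blast
  have fin': "finite ?I" using fin by simp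
  have "a ` I = insert (a x) (a ` ?I)" "edges I a b = insert (a x, b x) (edges ?I a b)"
    unfolding edges_def using x by blast+
  moreover have "(a x, b x) \<notin> edges ?I a b" using ax by (auto simp: edges_def)
  ultimately have A: "card (a ` I) = Suc (card (a ` ?I))"
    and E: "card (edges I a b) = Suc (card (edges ?I a b))"
    using ax fin' by (simp_all add: edges_def)
  show ?thesis
  proof (cases "b x \<in> b ` ?I")
    case True
    then obtain y where y: "y \<in> I" "y \<noteq> x" "b x = b y" by blast
    have "b ` I = b ` ?I" using True x by blast
    then show ?thesis
      using A E component_count_attached[where a = a and b = b, OF fin x y] ax
      by (simp add: euler_forest_def)
  next
    case False
    have "b ` I = insert (b x) (b ` ?I)" using x by blast
    then have "card (b ` I) = Suc (card (b ` ?I))" using False fin' by simp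
    then show ?thesis
      using A E component_count_isolated[OF fin x ax False] by (simp add: euler_forest_def)
  qed
qed

lemma card_fibres_ge_two:
  assumes "finite I" and "\<And>x. x \<in> I \<Longrightarrow> a x \<in> a ` (I - {x})"
  shows "2 * card (a ` I) \<le> card I"
proof -
  have "card I = (\<Sum>z\<in>a ` I. card {x \<in> I. a x = z})"
    using sum.image_gen[OF assms(1), of "\<lambda>_. 1::nat" a] by simp
  also have "\<dots> \<ge> (\<Sum>z\<in>a ` I. 2)"
  proof (rule sum_mono)
    fix z assume "z \<in> a ` I"
    then obtain x where x: "x \<in> I" "a x = z" by blast
    then obtain y where "y \<in> I" "y \<noteq> x" "a y = z" using assms(2)[OF x(1)] by force
    then have "{x, y} \<subseteq> {x \<in> I. a x = z}" "card {x, y} = 2" using x by auto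
    then show "2 \<le> card {x \<in> I. a x = z}"
      using assms(1) card_mono[of "{x \<in> I. a x = z}" "{x, y}"] by simp
  qed
  finally show ?thesis by simp
qed

text \<open>
  Both sides are unaffected by removing a point whose edge occurs twice, or a pendant edge.
  When neither exists, all vertices have degree at least two, so there are at least as many
  edges as vertices, and both sides fail unless the graph is empty.
\<close>

lemma euler_forest_iff:
  assumes "finite I"
  shows "euler_forest I a b \<longleftrightarrow> forest (edges I a b)"
  using assms
proof (induct "card I" arbitrary: I rule: less_induct)
  case less
  note fin = \<open>finite I\<close>
  consider (empty) "I = {}" | (double) x y where "x \<in> I" "y \<in> I" "y \<noteq> x" "a x = a y" "b x = b y"
    | (a) x where "x \<in> I" "a x \<notin> a ` (I - {x})"
    | (b) x where "x \<in> I" "b x \<notin> b ` (I - {x})"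
    | (none) "I \<noteq> {}" "inj_on (\<lambda>x. (a x, b x)) I" "\<And>x. x \<in> I \<Longrightarrow> a x \<in> a ` (I - {x})"
        "\<And>x. x \<in> I \<Longrightarrow> b x \<in> b ` (I - {x})"
    unfolding inj_on_def by blast
  then show ?case
  proof cases
    case empty
    then show ?thesis
      by (simp add: euler_forest_def edges_def component_count_def forest.empty)
  next
    case (double x y)
    have "edges I a b = edges (I - {x}) a b"
      unfolding edges_def
      by (rule image_remove_double[OF double(2,3)]) (simp only: double(4,5))
    moreover have "a ` I = a ` (I - {x})" "b ` I = b ` (I - {x})"
      by (rule image_remove_double[OF double(2,3)], rule double)+
    moreover have "card (I - {x}) < card I" using fin double(1) by (rule card_Diff1_less)
    ultimately show ?thesis
      using less(1)[of "I - {x}"] fin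
        component_count_attached[where a = a and b = b, OF fin double(1-3,5)] double(4)
      by (simp add: euler_forest_def)
  next
    case (a x)
    have c: "card (I - {x}) < card I" using fin a(1) by (rule card_Diff1_less)
    have e: "edges I a b = insert (a x, b x) (edges (I - {x}) a b)"
      using a(1) by (auto simp: edges_def)
    have "a x \<notin> Domain (edges (I - {x}) a b)" using a(2) by (auto simp: edges_def)
    then have "forest (edges I a b) \<longleftrightarrow> forest (edges (I - {x}) a b)"
      unfolding e by (meson forest.insert forest_subset subset_insertI)
    then show ?thesis using less(1)[OF c] fin euler_forest_pendant[OF fin a, of b] by simp
  next
    case (b x)
    have c: "card (I - {x}) < card I" using fin b(1) by (rule card_Diff1_less)
    have e: "edges I a b = insert (a x, b x) (edges (I - {x}) a b)"
      using b(1) by (auto simp: edges_def)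
    have "b x \<notin> Range (edges (I - {x}) a b)" using b(2) by (auto simp: edges_def)
    then have "forest (edges I a b) \<longleftrightarrow> forest (edges (I - {x}) a b)"
      unfolding e by (meson forest.insert forest_subset subset_insertI)
    then show ?thesis
      using less(1)[OF c] fin euler_forest_pendant[OF fin b, of a]
        euler_forest_swap[of I a b] euler_forest_swap[of "I - {x}" a b] by simp
  next
    case none
    have "component_count I a b > 0"
      using none(1) fin by (simp add: component_count_def card_gt_0_iff)
    moreover have "card (edges I a b) = card I"
      unfolding edges_def by (rule card_image[OF none(2)])
    ultimately have "\<not> euler_forest I a b"
      using card_fibres_ge_two[OF fin none(3)] card_fibres_ge_two[OF fin none(4)]
      unfolding euler_forest_def by linarith
    moreover have "\<not> forest (edges I a b)"
    proof
      assume "forest (edges I a b)"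
      then obtain x where x: "x \<in> I" "pendant (edges I a b) (a x, b x)"
        using forest_pendant[of "edges I a b"] none(1) by (auto simp: edges_def)
      have "edges (I - {x}) a b \<subseteq> edges I a b - {(a x, b x)}"
        using none(2) x(1) by (auto simp: edges_def inj_on_def)
      then have "a x \<notin> a ` (I - {x}) \<or> b x \<notin> b ` (I - {x})"
        using x(2) unfolding pendant_def edges_def by (fastforce simp: image_iff)
      then show False using none(3,4) x(1) by blast
    qed
    ultimately show ?thesis by blast
  qed
qed

lemma partition_on_kernel:
  assumes "\<And>x. x \<in> I \<Longrightarrow> x \<in> f x \<and> f x \<subseteq> I"
    and "\<And>x y. x \<in> I \<Longrightarrow> y \<in> f x \<Longrightarrow> f y = f x"
  shows "partition_on I (f ` I)"
proof (rule partition_onI)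
  show "\<Union>(f ` I) = I" using assms(1) by blast
  show "disjnt p q" if "p \<in> f ` I" "q \<in> f ` I" "p \<noteq> q" for p q
    using that assms(2) unfolding disjnt_def by blast
  show "{} \<notin> f ` I" using assms(1) by blast
qed

lemma partition_on_orbit_partition:
  assumes "finite I" and "\<pi> permutes I"
  shows "partition_on I (orbit_partition I \<pi>)"
  unfolding orbit_partition_def
proof (rule partition_on_kernel)
  show "x \<in> orbit \<pi> x \<and> orbit \<pi> x \<subseteq> I" if "x \<in> I" for x
    using that mem_orbit_self[OF assms] permutes_orbit_subset[OF assms(2)] by blast
  show "orbit \<pi> y = orbit \<pi> x" if "y \<in> orbit \<pi> x" for x y
    using that orbit_eq_iff[OF assms] by blast
qed

lemma partition_meet_orbits:
  assumes fin: "finite I" and perms: "\<phi> permutes I" "\<psi> permutes I"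
  shows "partition_meet (orbit_partition I \<phi>) (orbit_partition I \<psi>)
    = (\<lambda>x. orbit \<phi> x \<inter> orbit \<psi> x) ` I"
proof -
  let ?P = "orbit_partition I \<phi>" and ?Q = "orbit_partition I \<psi>"
  let ?C = "(\<lambda>x. orbit \<phi> x \<inter> orbit \<psi> x) ` I"
  have P: "partition_on I R" if "R \<in> {?P, ?Q}" for R
    using that partition_on_orbit_partition[OF fin] perms by blast
  have sub: "orbit \<phi> x \<subseteq> I" "x \<in> orbit \<phi> x" "x \<in> orbit \<psi> x" if "x \<in> I" for x
    using that mem_orbit_self[OF fin] permutes_orbit_subset perms by metis+
  have C: "partition_on I ?C"
  proof (rule partition_on_kernel)
    show "x \<in> orbit \<phi> x \<inter> orbit \<psi> x \<and> orbit \<phi> x \<inter> orbit \<psi> x \<subseteq> I" if "x \<in> I" for x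
      using that sub by blast
    show "orbit \<phi> y \<inter> orbit \<psi> y = orbit \<phi> x \<inter> orbit \<psi> x" if "y \<in> orbit \<phi> x \<inter> orbit \<psi> x" for x y
      using that orbit_eq_iff[OF fin] perms by (metis IntE)
  qed
  have M: "partition_on I (common_refinement {?P, ?Q})"
    by (rule partition_on_common_refinement[OF P]) auto
  have "refines I ?C (common_refinement {?P, ?Q})"
  proof (rule common_refinement_coarsest[OF P C])
    show "refines I ?C R" if "R \<in> {?P, ?Q}" for R
      using that C P[OF that] by (auto simp: refines_def orbit_partition_def)
  qed auto
  moreover have "refines I (common_refinement {?P, ?Q}) ?C"
    unfolding refines_def
  proof (intro conjI ballI M C)
    fix X assume X: "X \<in> common_refinement {?P, ?Q}"
    then obtain A B where AB: "A \<in> ?P" "X \<subseteq> A" "B \<in> ?Q" "X \<subseteq> B"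
      using common_refinement_exists[of X "{?P, ?Q}"] by (meson insertCI)
    have "X \<noteq> {}" "X \<subseteq> I" using X M by (auto dest: partition_onD3 partition_onD1)
    then obtain x where x: "x \<in> X" "x \<in> I" by blast
    then have "A = orbit \<phi> x" "B = orbit \<psi> x"
      using AB orbit_eq_iff[OF fin] perms unfolding orbit_partition_def by blast+
    then show "\<exists>Y\<in>?C. X \<subseteq> Y" using AB x by blast
  qed
  ultimately show ?thesis unfolding partition_meet_def by (rule refines_asym[symmetric])
qed

lemma partition_join_orbits:
  assumes fin: "finite I" and perms: "\<phi> permutes I" "\<psi> permutes I"
  shows "partition_join I (orbit_partition I \<phi>) (orbit_partition I \<psi>)
    = component I (orbit \<phi>) (orbit \<psi>) ` I"
proof -
  let ?P = "orbit_partition I \<phi>" and ?Q = "orbit_partition I \<psi>"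
  let ?c = "component I (orbit \<phi>) (orbit \<psi>)"
  let ?J = "partition_join I ?P ?Q"
  have P: "partition_on I ?P" "partition_on I ?Q"
    using partition_on_orbit_partition[OF fin] perms by blast+
  have C: "partition_on I (?c ` I)"
  proof (rule partition_on_kernel)
    fix x assume x: "x \<in> I"
    have "(x \<in> I) = (y \<in> I)" if "y \<in> ?c x" for y
      by (rule component_constant[of I "orbit \<phi>" "orbit \<psi>" x y "\<lambda>u. u \<in> I"])
        (use that in \<open>auto simp: mem_component_iff\<close>)
    then show "x \<in> ?c x \<and> ?c x \<subseteq> I" using x by (auto simp: mem_component_iff)
    show "?c y = ?c x" if "y \<in> ?c x" for y
      using that by (simp add: mem_component_iff)
  qed
  have orb: "orbit \<phi> x \<subseteq> ?c x" "orbit \<psi> x \<subseteq> ?c x" if "x \<in> I" for x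
  proof -
    have mem: "y \<in> ?c x" if "y \<in> I" "orbit \<phi> x = orbit \<phi> y \<or> orbit \<psi> x = orbit \<psi> y" for y
      unfolding mem_component_iff by (rule component_eqI[OF \<open>x \<in> I\<close> that])
    show "orbit \<phi> x \<subseteq> ?c x"
      using mem orbit_eq_iff[OF fin perms(1)] permutes_orbit_subset[OF perms(1) that] by blast
    show "orbit \<psi> x \<subseteq> ?c x"
      using mem orbit_eq_iff[OF fin perms(2)] permutes_orbit_subset[OF perms(2) that] by blast
  qed
  have up: "refines I ?P ?J" "refines I ?Q ?J" by (rule partition_join_upper[OF P])+
  have J: "partition_on I ?J" using up by (simp add: refines_def)
  have "refines I ?J (?c ` I)"
  proof (rule partition_join_least)
    show "refines I ?P (?c ` I)" "refines I ?Q (?c ` I)"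
      unfolding refines_def using P C orb unfolding orbit_partition_def by simp_all blast+
  qed
  moreover have "refines I (?c ` I) ?J"
    unfolding refines_def
  proof (intro conjI ballI C J)
    fix X assume "X \<in> ?c ` I"
    then obtain x where x: "x \<in> I" "X = ?c x" by blast
    define h where "h u = {Y \<in> ?J. u \<in> Y}" for u
    have h: "h u = {Y}" if "u \<in> Y" "Y \<in> ?J" for u Y
      using that partition_onD2[OF J] unfolding h_def disjoint_def by blast
    have same: "h u = h v" if "u \<in> I" "v \<in> I" "orbit \<phi> u = orbit \<phi> v \<or> orbit \<psi> u = orbit \<psi> v" for u v
    proof -
      have "v \<in> orbit \<phi> u \<or> v \<in> orbit \<psi> u"
        using that(3) by (simp add: orbit_eq_iff[OF fin perms(1)] orbit_eq_iff[OF fin perms(2)])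
      moreover have "u \<in> orbit \<phi> u" "u \<in> orbit \<psi> u"
        using mem_orbit_self[OF fin] perms by blast+
      moreover have "orbit \<phi> u \<in> ?P" "orbit \<psi> u \<in> ?Q"
        using that(1) by (auto simp: orbit_partition_def)
      ultimately obtain Z where "Z \<in> ?P \<union> ?Q" "u \<in> Z" "v \<in> Z" by blast
      then obtain Y where "Y \<in> ?J" "Z \<subseteq> Y" using up unfolding refines_def by blast
      then show ?thesis using h \<open>u \<in> Z\<close> \<open>v \<in> Z\<close> by (metis subsetD)
    qed
    obtain Y where Y: "Y \<in> ?J" "x \<in> Y" using J x(1) by (auto dest: partition_onD1)
    have "X \<subseteq> Y"
    proof
      fix y assume "y \<in> X"
      then have "?c x = ?c y" using x by (simp add: mem_component_iff)
      then have "h x = h y" by (rule component_constant) (rule same)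
      then show "y \<in> Y" using Y h unfolding h_def by blast
    qed
    then show "\<exists>Y\<in>?J. X \<subseteq> Y" using Y by blast
  qed
  ultimately show ?thesis by (rule refines_asym)
qed

lemma card_partition_join:
  assumes "finite I" and "\<phi> permutes I" "\<psi> permutes I"
  shows "card (partition_join I (orbit_partition I \<phi>) (orbit_partition I \<psi>))
    = component_count I (orbit \<phi>) (orbit \<psi>)"
  by (simp add: partition_join_orbits[OF assms] component_count_def)

lemma star_eq_iff_forest:
  assumes fin: "finite I" and perms: "\<phi> permutes I" "\<psi> permutes I"
  shows "star_eq I \<phi> \<psi> \<longleftrightarrow> forest (edges I (orbit \<phi>) (orbit \<psi>))"
proof -
  have "card (partition_meet (orbit_partition I \<phi>) (orbit_partition I \<psi>))
      = card (edges I (orbit \<phi>) (orbit \<psi>))"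
    unfolding partition_meet_orbits[OF assms] edges_def
  proof (rule card_image_kernel_eq[OF fin])
    fix x y
    show "(orbit \<phi> x, orbit \<psi> x) = (orbit \<phi> y, orbit \<psi> y) \<longleftrightarrow>
      orbit \<phi> x \<inter> orbit \<psi> x = orbit \<phi> y \<inter> orbit \<psi> y"
      using mem_orbit_self[OF fin] orbit_eq_iff[OF fin] perms by (metis IntD1 IntD2 IntI prod.inject)
  qed
  then have "star_eq I \<phi> \<psi> \<longleftrightarrow> euler_forest I (orbit \<phi>) (orbit \<psi>)"
    unfolding star_eq_def Let_def euler_forest_def card_partition_join[OF assms]
    by (auto simp: orbit_partition_def)
  then show ?thesis using euler_forest_iff[OF fin] by blast
qed

section \<open>Noncrossing permutations\<close>

text \<open>
  The first part says that every cycle runs through its elements in increasing order of \<open>pos\<close>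
  and then, because \<open>\<pi>\<close> is injective, returns from the last element to the first; the second part
  says that no two cycles cross. Only the order of the values of \<open>pos\<close> matters, so the
  same function serves after points have been removed from \<open>I\<close>.
\<close>

definition noncrossing :: "('a \<Rightarrow> nat) \<Rightarrow> 'a set \<Rightarrow> ('a \<Rightarrow> 'a) \<Rightarrow> bool" where
  "noncrossing pos I \<pi> \<longleftrightarrow>
     (\<forall>x\<in>I. \<forall>z\<in>orbit \<pi> x. pos x < pos z \<longrightarrow> pos x < pos (\<pi> x) \<and> pos (\<pi> x) \<le> pos z) \<and>
     (\<forall>x\<in>I. \<forall>z\<in>I. \<forall>y\<in>orbit \<pi> x. \<forall>w\<in>orbit \<pi> z.
        pos x < pos z \<and> pos z < pos y \<and> pos y < pos w \<longrightarrow> z \<in> orbit \<pi> x)"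

lemma noncrossing_next:
  assumes "noncrossing pos I \<pi>" and "x \<in> I" "z \<in> orbit \<pi> x" "pos x < pos z"
  shows "pos x < pos (\<pi> x)" and "pos (\<pi> x) \<le> pos z"
  using assms unfolding noncrossing_def by blast+

lemma noncrossing_uncrossed:
  assumes "noncrossing pos I \<pi>" and "x \<in> I" "z \<in> I" "y \<in> orbit \<pi> x" "w \<in> orbit \<pi> z"
    and "pos x < pos z" "pos z < pos y" "pos y < pos w"
  shows "z \<in> orbit \<pi> x"
  using assms unfolding noncrossing_def by blast

text \<open>
  A cycle that visits the gap between two elements of another cycle cannot leave this gap
  without crossing the other cycle.
\<close>

lemma noncrossing_between:
  assumes fin: "finite I" and perm: "\<pi> permutes I" and inj: "inj_on pos I"
    and nc: "noncrossing pos I \<pi>"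
    and I: "x \<in> I" "z \<in> I" and y: "y \<in> orbit \<pi> x" and z: "z \<notin> orbit \<pi> x"
    and less: "pos x < pos z" "pos z < pos y" and w: "w \<in> orbit \<pi> z"
  shows "pos x < pos w \<and> pos w < pos y"
proof -
  have "w \<in> I" "y \<in> I" using permutes_orbit_subset[OF perm] I w y by blast+
  have orb: "orbit \<pi> w = orbit \<pi> z" "orbit \<pi> y = orbit \<pi> x"
    using w y orbit_eq_iff[OF fin perm] by blast+
  then have "w \<notin> orbit \<pi> x" using z orbit_eq_iff[OF fin perm] mem_orbit_self[OF fin perm] by metis
  then have "w \<noteq> x" "w \<noteq> y" using y mem_orbit_self[OF fin perm] by auto
  then have ne: "pos w \<noteq> pos x" "pos w \<noteq> pos y"
    using inj \<open>w \<in> I\<close> \<open>y \<in> I\<close> I(1) by (auto dest: inj_onD)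
  have "\<not> pos y < pos w"
    using noncrossing_uncrossed[OF nc I y w less] z by blast
  moreover have "\<not> pos w < pos x"
  proof
    assume "pos w < pos x"
    moreover have "z \<in> orbit \<pi> w" using orb mem_orbit_self[OF fin perm] by metis
    ultimately have "x \<in> orbit \<pi> w"
      using noncrossing_uncrossed[OF nc \<open>w \<in> I\<close> I(1) _ y, of z] less by blast
    then show False using \<open>w \<notin> orbit \<pi> x\<close> orbit_eq_iff[OF fin perm] mem_orbit_self[OF fin perm]
      by metis
  qed
  ultimately show ?thesis using ne by linarith
qed

text \<open>The position of a point is its distance from \<open>p\<close> along the cycle.\<close>

lemma noncrossing_full_cycle:
  assumes fin: "finite I" and perm: "\<pi> permutes I" and full: "orbit \<pi> p = I"
  shows "\<exists>pos. inj_on pos I \<and> noncrossing pos I \<pi> \<and> (\<forall>x\<in>I. x \<noteq> p \<longrightarrow> pos p < pos x)"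
proof -
  have ex: "\<exists>n. (\<pi> ^^ n) p = x" if "x \<in> I" for x
    using that unfolding full[symmetric] by (auto simp: orbit_altdef)
  define pos where "pos x = (LEAST n. (\<pi> ^^ n) p = x)" for x
  have pos: "(\<pi> ^^ pos x) p = x" if "x \<in> I" for x
    unfolding pos_def using ex[OF that] by (rule LeastI_ex)
  have least: "pos x \<le> n" if "(\<pi> ^^ n) p = x" for x n
    unfolding pos_def using that by (rule Least_le)
  have inj: "inj_on pos I" using pos by (metis inj_onI)
  have "pos p = 0" using least[of 0 p] by simp
  have p: "pos p < pos x" if "x \<in> I" "x \<noteq> p" for x
    using pos[OF that(1)] that(2) \<open>pos p = 0\<close> by (metis funpow_0 gr0I)
  have orb: "orbit \<pi> x = I" if "x \<in> I" for x
    using that full orbit_eq_iff[OF fin perm] by metis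
  have "pos x < pos (\<pi> x) \<and> pos (\<pi> x) \<le> pos z" if "x \<in> I" "z \<in> I" "pos x < pos z" for x z
  proof -
    have "(\<pi> ^^ Suc (pos x)) p = \<pi> x" using pos that by simp
    then have le: "pos (\<pi> x) \<le> Suc (pos x)" by (rule least)
    have "\<not> pos (\<pi> x) \<le> pos x"
    proof
      assume le_x: "pos (\<pi> x) \<le> pos x"
      \<comment> \<open>then the iterates up to \<open>pos x\<close> are closed under \<open>\<pi>\<close>, so they exhaust \<open>I\<close>\<close>
      have "orbit \<pi> p \<subseteq> {u \<in> I. pos u \<le> pos x}"
      proof (rule orbit_closed_subset)
        show "p \<in> {u \<in> I. pos u \<le> pos x}"
          using \<open>pos p = 0\<close> full mem_orbit_self[OF fin perm] by auto
        fix u assume u: "u \<in> {u \<in> I. pos u \<le> pos x}"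
        have "(\<pi> ^^ Suc (pos u)) p = \<pi> u" using pos u by simp
        then have "pos (\<pi> u) \<le> Suc (pos u)" by (rule least)
        moreover have "u = x" if "pos u = pos x" using that inj u \<open>x \<in> I\<close> by (auto dest: inj_onD)
        ultimately have "pos (\<pi> u) \<le> pos x" using u le_x by fastforce
        then show "\<pi> u \<in> {u \<in> I. pos u \<le> pos x}"
          using u permutes_in_image[OF perm] by simp
      qed
      then show False using full that(2,3) by force
    qed
    then show ?thesis using le that(3) by linarith
  qed
  then have "noncrossing pos I \<pi>" unfolding noncrossing_def using orb by blast
  then show ?thesis using inj p by blast
qed

text \<open>
  Splitting a cycle of \<open>\<rho>\<close> at \<open>a\<close> and \<open>b\<close>, where \<open>a\<close> comes first, cuts out exactly its elements
  in the half-open interval \<open>(a, b]\<close>.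
\<close>

lemma noncrossing_split_ordered:
  assumes fin: "finite I" and perm: "\<pi> permutes I" and ab: "a \<in> I" "b \<in> I"
    and ne: "orbit \<pi> a \<noteq> orbit \<pi> b" and inj: "inj_on pos I"
    and nc: "noncrossing pos I (\<pi> \<circ> transpose a b)" and less: "pos a < pos b"
  shows "noncrossing pos I \<pi>"
proof -
  let ?\<rho> = "\<pi> \<circ> transpose a b"
  let ?O = "orbit \<pi> a \<union> orbit \<pi> b"
  have perm': "?\<rho> permutes I" using perm ab by (rule permutes_comp_transpose)
  note join = orbit_join[OF fin perm ab ne]
  have self: "x \<in> orbit \<pi> x" for x by (rule mem_orbit_self[OF fin perm])
  have OI: "?O \<subseteq> I" using permutes_orbit_subset[OF perm] ab by blast
  have orbO: "orbit ?\<rho> x = ?O" if "x \<in> ?O" for x using join that by simp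
  have orbN: "orbit ?\<rho> x = orbit \<pi> x" if "x \<notin> ?O" for x using join that by simp
  define S where "S = {z \<in> ?O. pos a < pos z \<and> pos z \<le> pos b}"
  have aO: "a \<in> ?O" and bO: "b \<in> ?O" using self by blast+

  have stepO: "\<pi> y \<in> ?O" if "y \<in> ?O" for y using that by (auto intro: orbit.intros)
  have closed: "\<pi> y \<in> S" if y: "y \<in> S" for y
  proof -
    have yO: "y \<in> ?O" "y \<in> I" using y OI by (auto simp: S_def)
    have "pos a < pos (\<pi> y) \<and> pos (\<pi> y) \<le> pos b"
    proof (cases "y = b")
      case True
      then show ?thesis
        using noncrossing_next[OF nc ab(1), of b] orbO[OF aO] bO less by simp
    next
      case False
      have "y \<noteq> a" using y by (auto simp: S_def)
      have "pos y < pos b" using y False inj yO ab unfolding S_def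
        by (metis (no_types, lifting) inj_onD le_neq_implies_less mem_Collect_eq)
      then show ?thesis
        using noncrossing_next[OF nc yO(2), of b] orbO[OF yO(1)] bO \<open>y \<noteq> a\<close> False y
        by (auto simp: S_def)
    qed
    then show ?thesis using stepO[OF yO(1)] by (simp add: S_def)
  qed
  have bS: "orbit \<pi> b \<subseteq> S"
    by (rule orbit_closed_subset) (use closed bO less in \<open>auto simp: S_def\<close>)
  have "S \<subseteq> I" using OI by (auto simp: S_def)
  then have "finite S" using fin by (rule finite_subset)
  then have onto: "\<pi> ` S = S"
  proof (rule endo_inj_surj)
    show "\<pi> ` S \<subseteq> S" using closed by blast
    show "inj_on \<pi> S" using permutes_inj[OF perm] by (rule inj_on_subset) simp
  qed
  have "orbit \<pi> a \<subseteq> ?O - S"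
  proof (rule orbit_closed_subset)
    show "a \<in> ?O - S" using aO by (auto simp: S_def)
    fix y assume y: "y \<in> ?O - S"
    have "\<pi> y \<notin> S"
    proof
      assume "\<pi> y \<in> S"
      then obtain s where "s \<in> S" "\<pi> y = \<pi> s" using onto by (metis imageE)
      then show False using y permutes_inj[OF perm] by (metis DiffD2 injD)
    qed
    then show "\<pi> y \<in> ?O - S" using stepO y by blast
  qed
  moreover have "S \<subseteq> ?O" by (auto simp: S_def)
  ultimately have orbits: "orbit \<pi> b = S" "orbit \<pi> a = ?O - S" using bS by blast+
  have inS: "orbit \<pi> x = S" if "x \<in> S" for x
    using that orbits(1) orbit_eq_iff[OF fin perm] by metis
  have inT: "orbit \<pi> x = ?O - S" if "x \<in> ?O - S" for x
    using that orbits(2) orbit_eq_iff[OF fin perm] by metis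
  have coarser: "orbit \<pi> x \<subseteq> orbit ?\<rho> x" for x
  proof (cases "x \<in> ?O")
    case True
    have "orbit \<pi> x = orbit \<pi> a \<or> orbit \<pi> x = orbit \<pi> b"
      using True orbit_eq_iff[OF fin perm] by blast
    then show ?thesis using orbO[OF True] by blast
  qed (simp add: orbN)
  show ?thesis
    unfolding noncrossing_def
  proof (intro conjI ballI impI)
    fix x z assume x: "x \<in> I" and z: "z \<in> orbit \<pi> x" and xz: "pos x < pos z"
    have z': "z \<in> orbit ?\<rho> x" using z coarser by blast
    have succ: "pos x < pos (?\<rho> x)" "pos (?\<rho> x) \<le> pos z"
      using noncrossing_next[OF nc x z' xz] by auto
    show "pos x < pos (\<pi> x)" "pos (\<pi> x) \<le> pos z"
    proof -
      consider "x \<noteq> a" "x \<noteq> b" | "x = b" | "x = a" by blast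
      then have "pos x < pos (\<pi> x) \<and> pos (\<pi> x) \<le> pos z"
      proof cases
        case 1
        then show ?thesis using succ by simp
      next
        case 2
        then have "z \<in> S" using z orbits by simp
        then show ?thesis using 2 xz by (auto simp: S_def)
      next
        case 3
        then have zT: "z \<in> ?O" "z \<notin> S" using z orbits by auto
        then have "pos b < pos z" using 3 xz by (auto simp: S_def)
        moreover have "z \<in> orbit ?\<rho> b" using orbO[OF bO] zT by simp
        ultimately have "pos b < pos (?\<rho> b)" "pos (?\<rho> b) \<le> pos z"
          using noncrossing_next[OF nc ab(2)] by blast+
        then show ?thesis using 3 less by simp
      qed
      then show "pos x < pos (\<pi> x)" "pos (\<pi> x) \<le> pos z" by auto
    qed
  next
    fix x z y w
    assume xz: "x \<in> I" "z \<in> I" and y: "y \<in> orbit \<pi> x" and w: "w \<in> orbit \<pi> z"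
      and less: "pos x < pos z \<and> pos z < pos y \<and> pos y < pos w"
    have y': "y \<in> orbit ?\<rho> x" using y coarser by blast
    have w': "w \<in> orbit ?\<rho> z" using w coarser by blast
    have zx: "z \<in> orbit ?\<rho> x"
      using noncrossing_uncrossed[OF nc xz y' w'] less by blast
    show "z \<in> orbit \<pi> x"
    proof (cases "x \<in> ?O")
      case False
      then show ?thesis using zx orbN by simp
    next
      case xO: True
      then have z: "z \<in> ?O" using zx orbO by blast
      show ?thesis
      proof (cases "x \<in> S")
        case True
        then have "y \<in> S" using y inS by blast
        then have "z \<in> S" using True z less unfolding S_def by simp
        then show ?thesis using True inS by blast
      next
        case False
        then have xT: "x \<in> ?O - S" using xO by blast
        then have yT: "y \<in> ?O - S" using y inT[OF xT] by blast
        have "z \<notin> S"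
        proof
          assume "z \<in> S"
          then have "w \<in> S" using w inS by simp
          then show False using \<open>z \<in> S\<close> yT less by (auto simp: S_def)
        qed
        then have "z \<in> ?O - S" using z by blast
        then show ?thesis using inT[OF xT] by blast
      qed
    qed
  qed
qed

lemma noncrossing_split:
  assumes fin: "finite I" and perm: "\<pi> permutes I" and inj: "inj_on pos I"
    and join: "joins_cycles I \<pi> \<rho>" and nc: "noncrossing pos I \<rho>"
  shows "noncrossing pos I \<pi>"
proof -
  obtain a b where ab: "a \<in> I" "b \<in> I" and ne: "orbit \<pi> a \<noteq> orbit \<pi> b"
    and \<rho>: "\<rho> = \<pi> \<circ> transpose a b"
    using join unfolding joins_cycles_def by blast
  have "pos a \<noteq> pos b" using ne ab inj by (auto dest: inj_onD)
  then consider "pos a < pos b" | "pos b < pos a" by linarith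
  then show ?thesis
  proof cases
    case 1
    then show ?thesis using noncrossing_split_ordered[OF fin perm ab ne inj] nc \<rho> by simp
  next
    case 2
    then show ?thesis
      using noncrossing_split_ordered[OF fin perm ab(2,1) ne[symmetric] inj] nc \<rho>
      by (simp add: transpose_commute)
  qed
qed

lemma noncrossing_perm_le:
  assumes fin: "finite I" and inj: "inj_on pos I" and nc: "noncrossing pos I \<rho>"
    and le: "perm_le I \<pi> \<rho>" and perm: "\<pi> permutes I"
  shows "noncrossing pos I \<pi>"
  using le perm unfolding perm_le_def
proof (induct rule: converse_rtranclp_induct)
  case base
  show ?case by (rule nc)
next
  case (step \<pi> \<sigma>)
  then show ?case using noncrossing_split[OF fin _ inj] joins_cycles_permutes by blast
qed

lemma perm_le_full_cycle:
  assumes fin: "finite I" and perm: "\<rho> permutes I" and p: "p \<in> I"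
  shows "\<exists>\<sigma>. perm_le I \<rho> \<sigma> \<and> \<sigma> permutes I \<and> orbit \<sigma> p = I"
  using perm
proof (induct "cycle_count I \<rho>" arbitrary: \<rho> rule: less_induct)
  case less
  have sub: "orbit \<rho> p \<subseteq> I" by (rule permutes_orbit_subset[OF less(2) p])
  show ?case
  proof (cases "orbit \<rho> p = I")
    case True
    then show ?thesis using less(2) perm_le_refl by blast
  next
    case False
    then obtain x where x: "x \<in> I" "x \<notin> orbit \<rho> p" using sub by blast
    then have ne: "orbit \<rho> p \<noteq> orbit \<rho> x" using mem_orbit_self[OF fin less(2)] by blast
    let ?\<rho> = "\<rho> \<circ> transpose p x"
    have "perm_le I \<rho> ?\<rho>" by (intro joins_cycles_perm_le joins_cyclesI p x ne)
    moreover have "?\<rho> permutes I" using less(2) p x(1) by (rule permutes_comp_transpose)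
    moreover have "cycle_count I ?\<rho> < cycle_count I \<rho>"
      using cycle_count_join[OF fin less(2) p x(1) ne] by simp
    ultimately show ?thesis using less(1) perm_le_trans by meson
  qed
qed

lemma common_noncrossing_order:
  assumes fin: "finite I" and p: "p \<in> I" and \<phi>: "\<phi> permutes I" and \<psi>: "\<psi> permutes I"
    and "perm_le I \<phi> \<rho>" "perm_le I \<psi> \<rho>"
  shows "\<exists>pos. inj_on pos I \<and> (\<forall>x\<in>I. x \<noteq> p \<longrightarrow> pos p < pos x) \<and>
    noncrossing pos I \<phi> \<and> noncrossing pos I \<psi>"
proof -
  have "\<rho> permutes I" using assms perm_le_permutes by blast
  then obtain \<sigma> where \<sigma>: "perm_le I \<rho> \<sigma>" "\<sigma> permutes I" "orbit \<sigma> p = I"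
    using perm_le_full_cycle[OF fin _ p] by blast
  obtain pos where pos: "inj_on pos I" "noncrossing pos I \<sigma>" "\<forall>x\<in>I. x \<noteq> p \<longrightarrow> pos p < pos x"
    using noncrossing_full_cycle[OF fin \<sigma>(2,3)] by blast
  have "noncrossing pos I \<phi>" "noncrossing pos I \<psi>"
    using noncrossing_perm_le[OF fin pos(1,2)] perm_le_trans \<sigma>(1) assms by meson+
  then show ?thesis using pos by blast
qed


section \<open>Removing a point\<close>

text \<open>
  The point \<open>x\<close> becomes a fixed point, and its predecessor is sent to its successor. If \<open>x\<close> is
  a fixed point already, the transposition is trivial.
\<close>

definition remove_point :: "'a \<Rightarrow> ('a \<Rightarrow> 'a) \<Rightarrow> 'a \<Rightarrow> 'a" where
  "remove_point x \<pi> = \<pi> \<circ> transpose x (inv \<pi> x)"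

lemma remove_point_fixed: "\<pi> permutes I \<Longrightarrow> \<pi> x = x \<Longrightarrow> remove_point x \<pi> = \<pi>"
  by (metis comp_id permutes_inv_eq remove_point_def transpose_same)

lemma remove_point_apply:
  assumes "\<pi> permutes I"
  shows "remove_point x \<pi> x = x" and "z \<noteq> x \<Longrightarrow> \<pi> z = x \<Longrightarrow> remove_point x \<pi> z = \<pi> x"
    and "z \<noteq> x \<Longrightarrow> \<pi> z \<noteq> x \<Longrightarrow> remove_point x \<pi> z = \<pi> z"
  using assms by (auto simp: remove_point_def permutes_inverses permutes_inv_eq transpose_def)

lemma remove_point_permutes:
  assumes perm: "\<pi> permutes I" and x: "x \<in> I"
  shows "remove_point x \<pi> permutes I - {x}"
proof -
  have "remove_point x \<pi> permutes I"
    unfolding remove_point_def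
    by (rule permutes_comp_transpose[OF perm x])
      (simp add: permutes_in_image[OF permutes_inv[OF perm]] x)
  then show ?thesis
  proof (rule permutes_superset)
    fix z assume "z \<in> I - (I - {x})"
    then have "z = x" by blast
    then show "remove_point x \<pi> z = z" using remove_point_apply(1)[OF perm] by metis
  qed
qed

lemma orbit_remove_point:
  assumes fin: "finite I" and perm: "\<pi> permutes I" and x: "x \<in> I" and z: "z \<noteq> x"
  shows "orbit (remove_point x \<pi>) z = orbit \<pi> z - {x}"
proof (cases "\<pi> x = x")
  case True
  have "x \<notin> orbit \<pi> z"
  proof
    assume "x \<in> orbit \<pi> z"
    then have "orbit \<pi> z = {x}"
      using True orbit_eq_iff[OF fin perm, of z x] by (simp add: orbit_eq_singleton_iff)
    then show False using z mem_orbit_self[OF fin perm, of z] by simp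
  qed
  then show ?thesis using remove_point_fixed[OF perm True] by simp
next
  case False
  let ?y = "inv \<pi> x"
  let ?\<rho> = "\<pi> \<circ> transpose x ?y"
  have \<rho>: "remove_point x \<pi> = ?\<rho>" by (simp add: remove_point_def)
  have y: "?y \<in> I" "x \<noteq> ?y" "\<pi> ?y = x"
  proof -
    show "\<pi> ?y = x" by (rule permutes_inverses(1)[OF perm])
    then show "x \<noteq> ?y" using False by metis
    show "?y \<in> I" using permutes_in_image[OF permutes_inv[OF perm]] x by simp
  qed
  have perm': "?\<rho> permutes I" using perm x y(1) by (rule permutes_comp_transpose)
  have "x \<in> orbit \<pi> ?y" using y(3) by (metis orbit.base)
  then have eq: "orbit \<pi> x = orbit \<pi> ?y" using orbit_eq_iff[OF fin perm] by metis
  have fixed: "orbit ?\<rho> x = {x}"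
    using remove_point_apply(1)[OF perm, of x] unfolding \<rho> by (simp add: orbit_eq_singleton_iff)
  note cases = orbit_split_cases[OF fin perm x y(1,2) eq, of z, unfolded fixed]
  have "x \<notin> orbit ?\<rho> z"
    using z fixed orbit_eq_iff[OF fin perm'] mem_orbit_self[OF fin perm'] by (metis singletonD)
  moreover have "orbit ?\<rho> z = orbit ?\<rho> ?y" if "z \<in> orbit ?\<rho> ?y"
    using that orbit_eq_iff[OF fin perm'] by blast
  ultimately show ?thesis unfolding \<rho> using cases z by (auto split: if_splits)
qed

lemma noncrossing_remove_point:
  assumes fin: "finite I" and perm: "\<pi> permutes I" and x: "x \<in> I"
    and inj: "inj_on pos I" and nc: "noncrossing pos I \<pi>"
  shows "noncrossing pos (I - {x}) (remove_point x \<pi>)"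
  unfolding noncrossing_def
proof (intro conjI ballI impI)
  fix u z assume u: "u \<in> I - {x}" and z: "z \<in> orbit (remove_point x \<pi>) u" and less: "pos u < pos z"
  have uI: "u \<in> I" "u \<noteq> x" using u by auto
  have z': "z \<in> orbit \<pi> u" "z \<noteq> x" using z orbit_remove_point[OF fin perm x uI(2)] by auto
  have zI: "z \<in> I" using z'(1) permutes_orbit_subset[OF perm uI(1)] by blast
  note n = noncrossing_next[OF nc uI(1) z'(1) less]
  have "pos u < pos (remove_point x \<pi> u) \<and> pos (remove_point x \<pi> u) \<le> pos z"
  proof (cases "\<pi> u = x")
    case False
    then show ?thesis using n remove_point_apply(3)[OF perm uI(2)] by simp
  next
    case True
    have "pos x \<noteq> pos z" using inj x zI z'(2) by (auto dest: inj_onD)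
    then have "pos x < pos z" using n True by simp
    moreover have "z \<in> orbit \<pi> x"
      using z'(1) True orbit.base[of \<pi> u] orbit_eq_iff[OF fin perm] by metis
    ultimately have "pos x < pos (\<pi> x)" "pos (\<pi> x) \<le> pos z"
      using noncrossing_next[OF nc x] by blast+
    then show ?thesis using n True remove_point_apply(2)[OF perm uI(2) True] by simp
  qed
  then show "pos u < pos (remove_point x \<pi> u)" "pos (remove_point x \<pi> u) \<le> pos z" by auto
next
  fix u z y w
  assume u: "u \<in> I - {x}" and z: "z \<in> I - {x}" and y: "y \<in> orbit (remove_point x \<pi>) u"
    and w: "w \<in> orbit (remove_point x \<pi>) z"
    and less: "pos u < pos z \<and> pos z < pos y \<and> pos y < pos w"
  have orb: "orbit (remove_point x \<pi>) v = orbit \<pi> v - {x}" if "v \<in> I - {x}" for v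
    using that orbit_remove_point[OF fin perm x] by blast
  have "z \<in> orbit \<pi> u"
    using noncrossing_uncrossed[OF nc, of u z y w] u z y w less unfolding orb[OF u] orb[OF z] by blast
  then show "z \<in> orbit (remove_point x \<pi>) u" using orb[OF u] z by blast
qed


section \<open>A point that can be removed\<close>

text \<open>
  The vertices of the bipartite graph are named by arbitrary labels rather than by the cycles
  themselves: the cycles change when a point is removed, but the labels of the
  remaining points can be kept, and the graph just loses an edge.
\<close>

definition labels_cycles :: "'a set \<Rightarrow> ('a \<Rightarrow> 'b) \<Rightarrow> ('a \<Rightarrow> 'a) \<Rightarrow> bool" where
  "labels_cycles I a \<pi> \<longleftrightarrow> (\<forall>x\<in>I. \<forall>y\<in>I. y \<in> orbit \<pi> x \<longleftrightarrow> a y = a x)"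

lemma labels_cycles_fixed:
  assumes "labels_cycles I a \<pi>" and "\<pi> permutes I" and "x \<in> I"
    and "\<And>w. w \<in> I \<Longrightarrow> a w = a x \<Longrightarrow> w = x"
  shows "\<pi> x = x"
proof -
  have "\<pi> x \<in> I" "\<pi> x \<in> orbit \<pi> x"
    using assms(2,3) by (simp add: permutes_in_image, intro orbit.base)
  then show ?thesis using assms unfolding labels_cycles_def by blast
qed

lemma noncrossing_between_label:
  assumes "finite I" and "\<pi> permutes I" and "inj_on pos I" and "noncrossing pos I \<pi>"
    and c: "labels_cycles I c \<pi>" and I: "x \<in> I" "z \<in> I" and y: "y \<in> orbit \<pi> x" and ne: "c z \<noteq> c x"
    and less: "pos x < pos z" "pos z < pos y" and w: "w \<in> I" "c w = c z"
  shows "pos x < pos w \<and> pos w < pos y"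
proof (rule noncrossing_between[OF assms(1-4) I y _ less])
  show "z \<notin> orbit \<pi> x" using c I ne unfolding labels_cycles_def by blast
  show "w \<in> orbit \<pi> z" using c I w unfolding labels_cycles_def by blast
qed

lemma pendant_edges:
  assumes "pendant (edges G a b) (a z, b z)" and "inj_on (\<lambda>x. (a x, b x)) G" and "z \<in> G"
  shows "(\<forall>w\<in>G. a w = a z \<longrightarrow> w = z) \<or> (\<forall>w\<in>G. b w = b z \<longrightarrow> w = z)"
proof (rule ccontr)
  assume "\<not> ?thesis"
  then obtain w v where w: "w \<in> G" "a w = a z" "w \<noteq> z" and v: "v \<in> G" "b v = b z" "v \<noteq> z" by blast
  have "(a u, b u) \<in> edges G a b - {(a z, b z)}" if "u \<in> G" "u \<noteq> z" for u
    using inj_onD[OF assms(2), of u z] that assms(3) unfolding edges_def by blast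
  then have "(a w, b w) \<in> edges G a b - {(a z, b z)}" "(a v, b v) \<in> edges G a b - {(a z, b z)}"
    using w v by blast+
  then have "a z \<in> Domain (edges G a b - {(a z, b z)})" "b z \<in> Range (edges G a b - {(a z, b z)})"
    using w(2) v(2) by (metis Domain.DomainI, metis Range.RangeI)
  then show False using assms(1) by (simp add: pendant_def)
qed

text \<open>
  If no two points lie on the same edge of the graph, the free end of a pendant edge other than
  that of \<open>p\<close> is a cycle with a single element. Otherwise take \<open>x\<close> and \<open>y\<close> on the same edge with
  \<open>x\<close> before \<open>y\<close> and as close as possible, and let \<open>G\<close> be the set of points between them. If \<open>G\<close> is empty,
  both permutations send \<open>x\<close> to \<open>y\<close>. If not, the points of \<open>G\<close> lie on different edges by the choice of
  \<open>x\<close> and \<open>y\<close>, and the graph spanned by \<open>G\<close> and \<open>x\<close> has a pendant edge other than that of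
  \<open>x\<close>. Its free end is a cycle that does not contain \<open>x\<close>; being noncrossing, this cycle
  stays within \<open>G\<close>, and so it has a single element.
\<close>

lemma removable_point_exists:
  assumes fin: "finite I" and p: "p \<in> I" "I \<noteq> {p}" and \<phi>: "\<phi> permutes I" and \<psi>: "\<psi> permutes I"
    and a: "labels_cycles I a \<phi>" and b: "labels_cycles I b \<psi>" and forest: "forest (edges I a b)"
    and inj: "inj_on pos I" and first: "\<And>x. x \<in> I \<Longrightarrow> x \<noteq> p \<Longrightarrow> pos p < pos x"
    and nc: "noncrossing pos I \<phi>" "noncrossing pos I \<psi>"
  shows "\<exists>x\<in>I - {p}. \<phi> x = x \<or> \<psi> x = x \<or> (\<exists>y\<in>I - {x}. \<phi> y = x \<and> \<psi> y = x)"
proof (cases "inj_on (\<lambda>x. (a x, b x)) I")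
  case True
  have "edges I a b \<noteq> {(a p, b p)}"
  proof
    assume "edges I a b = {(a p, b p)}"
    then have "x = p" if "x \<in> I" for x
      using True p(1) that unfolding edges_def inj_on_def by blast
    then show False using p by blast
  qed
  then obtain x where x: "x \<in> I" "(a x, b x) \<noteq> (a p, b p)" "pendant (edges I a b) (a x, b x)"
    using forest_pendant_other[OF forest, of "(a p, b p)"] p(1) by (auto simp: edges_def)
  then have "\<phi> x = x \<or> \<psi> x = x"
    using pendant_edges[OF x(3) True x(1)] labels_cycles_fixed[OF a \<phi> x(1)]
      labels_cycles_fixed[OF b \<psi> x(1)] by blast
  then show ?thesis using x by blast
next
  case False
  define close where "close d \<longleftrightarrow> (\<exists>x\<in>I. \<exists>y\<in>I. a x = a y \<and> b x = b y \<and> pos x < pos y \<and> pos y - pos x = d)"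
    for d
  have dist: "close (pos y - pos x)" if "x \<in> I" "y \<in> I" "a x = a y" "b x = b y" "pos x < pos y" for x y
    using that unfolding close_def by blast
  have "\<exists>d. close d"
  proof -
    obtain x y where xy: "x \<in> I" "y \<in> I" "x \<noteq> y" "a x = a y" "b x = b y"
      using False unfolding inj_on_def by blast
    then have "pos x < pos y \<or> pos y < pos x" using inj by (meson inj_onD linorder_neqE_nat)
    then show ?thesis using dist[of x y] dist[of y x] xy by auto
  qed
  define d where "d = (LEAST d. close d)"
  have "close d" unfolding d_def using \<open>\<exists>d. close d\<close> by (rule LeastI_ex)
  then obtain x y where xy: "x \<in> I" "y \<in> I" "a x = a y" "b x = b y" "pos x < pos y"
    and d: "pos y - pos x = d"
    unfolding close_def by blast
  have least: "d \<le> e" if "close e" for e unfolding d_def using that by (rule Least_le)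
  define G where "G = {z \<in> I. pos x < pos z \<and> pos z < pos y}"
  have y_\<phi>: "y \<in> orbit \<phi> x" and y_\<psi>: "y \<in> orbit \<psi> x"
    using a b xy unfolding labels_cycles_def by auto
  have not_first: "z \<noteq> p" if "z \<in> I" "pos x < pos z" for z
    using first[OF xy(1)] that by (metis less_asym)
  show ?thesis
  proof (cases "G = {}")
    case True
    have "\<phi> x = y"
      using noncrossing_next[OF nc(1) xy(1) y_\<phi> xy(5)] True inj xy(1,2) permutes_in_image[OF \<phi>, of x]
      unfolding G_def by (metis (mono_tags, lifting) empty_iff inj_onD le_neq_implies_less mem_Collect_eq)
    moreover have "\<psi> x = y"
      using noncrossing_next[OF nc(2) xy(1) y_\<psi> xy(5)] True inj xy(1,2) permutes_in_image[OF \<psi>, of x]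
      unfolding G_def by (metis (mono_tags, lifting) empty_iff inj_onD le_neq_implies_less mem_Collect_eq)
    moreover have "y \<in> I - {p}" "x \<in> I - {y}" using xy not_first[OF xy(2,5)] by auto
    ultimately show ?thesis by (intro bexI[of _ y] disjI2 bexI[of _ x] conjI)
  next
    case nonempty: False
    let ?G = "insert x G"
    have GI: "?G \<subseteq> I" using xy by (auto simp: G_def)
    have inj_edge: "inj_on (\<lambda>x. (a x, b x)) ?G"
    proof (rule inj_onI, rule ccontr)
      fix u v assume u: "u \<in> ?G" and v: "v \<in> ?G" and eq: "(a u, b u) = (a v, b v)" and ne: "u \<noteq> v"
      have uv: "u \<in> I" "v \<in> I" using u v GI by auto
      have "pos u \<noteq> pos v" using ne uv inj by (meson inj_onD)
      then consider "pos u < pos v" | "pos v < pos u" by linarith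
      then show False
      proof cases
        case 1
        have "d \<le> pos v - pos u" by (intro least dist uv 1) (use eq in auto)
        then show False using 1 u v xy(5) unfolding G_def d[symmetric] by auto
      next
        case 2
        have "d \<le> pos u - pos v" by (intro least dist uv 2) (use eq in auto)
        then show False using 2 u v xy(5) unfolding G_def d[symmetric] by auto
      qed
    qed
    have xG: "x \<notin> G" by (simp add: G_def)
    have "forest (edges ?G a b)"
      using forest GI by (auto simp: edges_def intro!: forest_subset[OF forest])
    moreover have "(a x, b x) \<in> edges ?G a b" by (simp add: edges_def)
    moreover have "edges ?G a b \<noteq> {(a x, b x)}"
      using nonempty inj_edge xG unfolding edges_def inj_on_def by blast
    ultimately obtain z where z: "z \<in> ?G" "(a z, b z) \<noteq> (a x, b x)" "pendant (edges ?G a b) (a z, b z)"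
      using forest_pendant_other[of "edges ?G a b" "(a x, b x)"] by (auto simp: edges_def)
    then have zx: "z \<in> G" "z \<in> I" "pos x < pos z" "pos z < pos y" by (auto simp: G_def)
    consider "\<forall>w\<in>?G. a w = a z \<longrightarrow> w = z" | "\<forall>w\<in>?G. b w = b z \<longrightarrow> w = z"
      using pendant_edges[OF z(3) inj_edge z(1)] by blast
    then have "\<phi> z = z \<or> \<psi> z = z"
    proof cases
      case 1
      have ne: "a z \<noteq> a x" using 1 xG zx(1) by (metis insertI1)
      have "\<phi> z = z"
      proof (rule labels_cycles_fixed[OF a \<phi> zx(2)])
        fix w assume "w \<in> I" "a w = a z"
        moreover from this have "w \<in> G"
          using noncrossing_between_label[OF fin \<phi> inj nc(1) a xy(1) zx(2) y_\<phi> ne zx(3,4)]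
          unfolding G_def by blast
        ultimately show "w = z" using 1 by blast
      qed
      then show ?thesis ..
    next
      case 2
      have ne: "b z \<noteq> b x" using 2 xG zx(1) by (metis insertI1)
      have "\<psi> z = z"
      proof (rule labels_cycles_fixed[OF b \<psi> zx(2)])
        fix w assume "w \<in> I" "b w = b z"
        moreover from this have "w \<in> G"
          using noncrossing_between_label[OF fin \<psi> inj nc(2) b xy(1) zx(2) y_\<psi> ne zx(3,4)]
          unfolding G_def by blast
        ultimately show "w = z" using 2 by blast
      qed
      then show ?thesis ..
    qed
    then show ?thesis using zx not_first by blast
  qed
qed

section \<open>Inserting a symbol into a bracket diagram\<close>

lemma permutes_commute:
  assumes "f permutes A" and "g permutes B" and "A \<inter> B = {}"
  shows "f \<circ> g = g \<circ> f"
proof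
  fix x
  consider "x \<in> A" | "x \<in> B" | "x \<notin> A" "x \<notin> B" by blast
  then show "(f \<circ> g) x = (g \<circ> f) x"
  proof cases
    case 1
    then have "f x \<in> A" using permutes_in_image[OF assms(1)] by simp
    then show ?thesis using 1 assms by (metis comp_apply disjoint_iff permutes_not_in)
  next
    case 2
    then have "g x \<in> B" using permutes_in_image[OF assms(2)] by simp
    then show ?thesis using 2 assms by (metis comp_apply disjoint_iff permutes_not_in)
  next
    case 3
    then show ?thesis using assms by (simp add: permutes_not_in)
  qed
qed

lemma cycle_of_list_Cons: "L \<noteq> [] \<Longrightarrow> cycle_of_list (u # L) = transpose u (hd L) \<circ> cycle_of_list L"
  by (cases L) auto

lemma cycle_of_list_insert:
  assumes "distinct (xs @ y # x # zs)"
  shows "cycle_of_list (xs @ y # x # zs) = cycle_of_list (xs @ y # zs) \<circ> transpose x y"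
  using assms
proof (induct xs)
  case Nil
  let ?h = "transpose x y"
  have "?h \<circ> cycle_of_list (x # zs) \<circ> inv ?h = cycle_of_list (map ?h (x # zs))"
    by (rule conjugation_of_cycle) (use Nil in auto)
  moreover have "map ?h zs = zs"
  proof (rule map_idI)
    fix z assume "z \<in> set zs"
    then have "z \<noteq> x" "z \<noteq> y" using Nil by auto
    then show "?h z = z" by simp
  qed
  ultimately have "?h \<circ> cycle_of_list (x # zs) \<circ> ?h = cycle_of_list (y # zs)" by simp
  then have "?h \<circ> cycle_of_list (x # zs) = cycle_of_list (y # zs) \<circ> ?h"
    by (metis comp_transpose_twice)
  then show ?case by (simp add: transpose_commute)
next
  case (Cons u xs)
  have "hd (xs @ y # x # zs) = hd (xs @ y # zs)" by (cases xs) auto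
  then show ?case using Cons by (simp add: cycle_of_list_Cons comp_assoc)
qed

text \<open>The same fold as in the definition of \<open>diagram_perm\<close>, for an arbitrary list of levels.\<close>

definition cycles_perm :: "'a list list \<Rightarrow> 'a \<Rightarrow> 'a" where
  "cycles_perm Ls = foldr (\<lambda>c \<pi>. cycle_of_list c \<circ> \<pi>) Ls id"

lemma cycles_perm_simps [simp]:
  "cycles_perm [] = id" "cycles_perm (c # Ls) = cycle_of_list c \<circ> cycles_perm Ls"
  by (simp_all add: cycles_perm_def)

lemma cycles_perm_append: "cycles_perm (Ls @ Ms) = cycles_perm Ls \<circ> cycles_perm Ms"
  by (induct Ls) (auto simp: comp_assoc)

lemma cycles_perm_permutes: "cycles_perm Ls permutes set (concat Ls)"
proof (induct Ls)
  case (Cons c Ls)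
  have "cycle_of_list c permutes set c \<union> set (concat Ls)"
    by (rule permutes_subset[OF cycle_permutes]) simp
  moreover have "cycles_perm Ls permutes set c \<union> set (concat Ls)"
    by (rule permutes_subset[OF Cons]) simp
  ultimately have "cycle_of_list c \<circ> cycles_perm Ls permutes set c \<union> set (concat Ls)"
    by (rule permutes_compose[rotated])
  then show ?case unfolding cycles_perm_simps concat.simps set_append .
next
  case Nil
  show ?case unfolding cycles_perm_simps(1) by (rule permutes_id)
qed

text \<open>The list \<open>os\<close> holds the symbols of the outer level that have already been read.\<close>

definition level_perm :: "'a list \<Rightarrow> 'a diagram \<Rightarrow> 'a \<Rightarrow> 'a" where
  "level_perm os D = cycles_perm ((os @ outer_level D) # bracket_levels D)"

lemma label_perm_eq: "label_perm l p D = level_perm [p] (keep_brackets l D)"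
  by (simp add: label_perm_def diagram_perm_def level_perm_def cycles_perm_def)

lemma set_levels:
  "set (outer_level D) \<union> set (concat (bracket_levels D)) = set (symbols D)"
  by (induct D rule: symbols.induct) auto

lemma distinct_levels:
  "distinct (symbols D) \<Longrightarrow> distinct (outer_level D @ concat (bracket_levels D))"
proof (induct D rule: symbols.induct)
  case (2 k D)
  have "k \<notin> set (outer_level D) \<union> set (concat (bracket_levels D))"
    using 2 unfolding set_levels by simp
  then show ?case using 2 by simp
next
  case (3 l E D)
  have "(set (outer_level E) \<union> set (concat (bracket_levels E))) \<inter>
      (set (outer_level D) \<union> set (concat (bracket_levels D))) = {}"
    using 3 unfolding set_levels by simp
  then show ?case using 3 by (simp, blast)
qed simp

lemma level_perm_permutes: "level_perm os D permutes set os \<union> set (symbols D)"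
proof -
  have "set (concat ((os @ outer_level D) # bracket_levels D)) = set os \<union> set (symbols D)"
    using set_levels[of D] by auto
  then show ?thesis unfolding level_perm_def by (metis cycles_perm_permutes)
qed

lemma level_perm_Nil: "level_perm os [] = cycle_of_list os"
  by (simp add: level_perm_def)

lemma level_perm_Sym: "level_perm os (Sym k # D) = level_perm (os @ [k]) D"
  by (simp add: level_perm_def)

lemma level_perm_Bracket:
  assumes "set (symbols E) \<inter> (set os \<union> set (symbols D)) = {}"
  shows "level_perm os (Bracket l E # D) = level_perm [] E \<circ> level_perm os D"
proof -
  have "cycle_of_list (os @ outer_level D) permutes set os \<union> set (symbols D)"
    by (rule permutes_subset[OF cycle_permutes]) (use set_levels[of D] in auto)
  moreover have "level_perm [] E permutes set (symbols E)"
    using level_perm_permutes[of "[]" E] by simp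
  ultimately have "cycle_of_list (os @ outer_level D) \<circ> level_perm [] E
      = level_perm [] E \<circ> cycle_of_list (os @ outer_level D)"
    by (rule permutes_commute) (use assms in auto)
  moreover have "level_perm os (Bracket l E # D)
      = cycle_of_list (os @ outer_level D) \<circ> level_perm [] E \<circ> cycles_perm (bracket_levels D)"
    by (simp add: level_perm_def cycles_perm_append comp_assoc)
  ultimately show ?thesis by (simp add: level_perm_def comp_assoc)
qed

lemma level_perm_insert_outer:
  assumes "distinct (xs @ y # x # zs)" and "distinct (symbols D)"
    and "set (xs @ y # x # zs) \<inter> set (symbols D) = {}"
  shows "level_perm (xs @ y # x # zs) D = level_perm (xs @ y # zs) D \<circ> transpose x y"
proof -
  have sub: "set (outer_level D) \<subseteq> set (symbols D)" "set (concat (bracket_levels D)) \<subseteq> set (symbols D)"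
    using set_levels[of D] by blast+
  have d: "distinct (xs @ y # x # (zs @ outer_level D))"
    using assms distinct_levels[of D] sub(1) by auto
  have "transpose x y permutes {x, y}" by (intro permutes_swap_id) auto
  then have "transpose x y \<circ> cycles_perm (bracket_levels D) = cycles_perm (bracket_levels D) \<circ> transpose x y"
    by (rule permutes_commute[OF _ cycles_perm_permutes]) (use assms sub in auto)
  then show ?thesis
    using cycle_of_list_insert[OF d] by (simp add: level_perm_def comp_assoc)
qed

fun insert_after :: "'a \<Rightarrow> 'a diagram \<Rightarrow> 'a diagram \<Rightarrow> 'a diagram" where
  "insert_after y E [] = []"
| "insert_after y E (Sym k # D) = Sym k # (if k = y then E else []) @ insert_after y E D"
| "insert_after y E (Bracket l F # D) = Bracket l (insert_after y E F) # insert_after y E D"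

lemma insert_after_append: "insert_after y E (C @ D) = insert_after y E C @ insert_after y E D"
  by (induct C rule: symbols.induct) auto

lemma keep_brackets_append: "keep_brackets l (C @ D) = keep_brackets l C @ keep_brackets l D"
  by (induct C rule: symbols.induct) auto

lemma symbols_append: "symbols (C @ D) = symbols C @ symbols D"
  by (induct C rule: symbols.induct) auto

lemma symbols_keep_brackets [simp]: "symbols (keep_brackets l D) = symbols D"
  by (induct D rule: symbols.induct) (auto simp: symbols_append)

lemma keep_brackets_insert_after:
  "keep_brackets l (insert_after y E D) = insert_after y (keep_brackets l E) (keep_brackets l D)"
  by (induct D rule: symbols.induct) (auto simp: insert_after_append keep_brackets_append)

lemma insert_after_absent: "y \<notin> set (symbols D) \<Longrightarrow> insert_after y E D = D"
  by (induct D rule: symbols.induct) auto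

lemma set_symbols_insert_after:
  "y \<in> set (symbols D) \<Longrightarrow> set (symbols (insert_after y E D)) = set (symbols E) \<union> set (symbols D)"
proof (induct D rule: symbols.induct)
  case (2 k D)
  then show ?case
    by (cases "y \<in> set (symbols D)") (auto simp: symbols_append insert_after_absent)
next
  case (3 l F D)
  then show ?case
    by (cases "y \<in> set (symbols D)"; cases "y \<in> set (symbols F)")
      (auto simp: symbols_append insert_after_absent)
qed simp

lemma distinct_symbols_insert_after:
  assumes "distinct (symbols D)" and "distinct (symbols E)"
    and "set (symbols E) \<inter> set (symbols D) = {}" and "y \<in> set (symbols D)"
  shows "distinct (symbols (insert_after y E D))"
  using assms
proof (induct D rule: symbols.induct)
  case (2 k D)
  show ?case
  proof (cases "k = y")
    case True
    then show ?thesis using 2 by (auto simp: symbols_append insert_after_absent)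
  next
    case False
    then show ?thesis using 2 by (auto simp: set_symbols_insert_after)
  qed
next
  case (3 l F D)
  show ?case
  proof (cases "y \<in> set (symbols F)")
    case True
    then have "y \<notin> set (symbols D)" using 3 by auto
    then show ?thesis using 3 True by (auto simp: set_symbols_insert_after insert_after_absent)
  next
    case False
    then show ?thesis using 3 by (auto simp: set_symbols_insert_after insert_after_absent)
  qed
qed simp

text \<open>
  The symbol \<open>x\<close> joins the level of \<open>y\<close> directly behind \<open>y\<close>, whatever the brackets around them;
  this is the converse of \<open>remove_point\<close>.
\<close>

lemma level_perm_insert_after:
  assumes "distinct (os @ symbols D)" and "x \<notin> set (os @ symbols D)" and "y \<in> set (symbols D)"
  shows "level_perm os (insert_after y [Sym x] D) = level_perm os D \<circ> transpose x y"
  using assms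
proof (induct D arbitrary: os rule: symbols.induct)
  case (2 k D)
  show ?case
  proof (cases "k = y")
    case True
    then have "y \<notin> set (symbols D)" using 2 by auto
    then have "level_perm os (insert_after y [Sym x] (Sym k # D)) = level_perm (os @ y # x # []) D"
      using True by (simp add: insert_after_absent level_perm_Sym)
    also have "\<dots> = level_perm (os @ y # []) D \<circ> transpose x y"
      by (rule level_perm_insert_outer) (use 2 True in auto)
    finally show ?thesis using True by (simp add: level_perm_Sym)
  next
    case False
    then show ?thesis using 2(1)[of "os @ [k]"] 2(2-4) by (simp add: level_perm_Sym)
  qed
next
  case (3 l F D)
  have disj: "set (symbols F) \<inter> (set os \<union> set (symbols D)) = {}" using 3 by auto
  show ?case
  proof (cases "y \<in> set (symbols F)")
    case True
    then have y: "y \<notin> set os \<union> set (symbols D)" using disj by blast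
    have x: "x \<notin> set os \<union> set (symbols D)" using 3 by auto
    have "transpose x y permutes {x, y}" by (intro permutes_swap_id) auto
    then have commute: "transpose x y \<circ> level_perm os D = level_perm os D \<circ> transpose x y"
      by (rule permutes_commute[OF _ level_perm_permutes]) (use x y in auto)
    have "level_perm os (insert_after y [Sym x] (Bracket l F # D))
        = level_perm [] (insert_after y [Sym x] F) \<circ> level_perm os D"
      using y x disj True
      by (simp add: insert_after_absent level_perm_Bracket set_symbols_insert_after)
    also have "\<dots> = level_perm [] F \<circ> transpose x y \<circ> level_perm os D"
    proof -
      have "level_perm [] (insert_after y [Sym x] F) = level_perm [] F \<circ> transpose x y"
        by (rule 3(1)) (use 3(3,4) True in auto)
      then show ?thesis by (rule arg_cong[of _ _ "\<lambda>f. f \<circ> level_perm os D"])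
    qed
    finally show ?thesis using commute disj by (simp add: level_perm_Bracket comp_assoc)
  next
    case False
    then have y: "y \<in> set (symbols D)" using 3(5) by simp
    then have "set (symbols F) \<inter> (set os \<union> set (symbols (insert_after y [Sym x] D))) = {}"
      using disj 3(4) by (auto simp: set_symbols_insert_after)
    then have "level_perm os (insert_after y [Sym x] (Bracket l F # D))
        = level_perm [] F \<circ> level_perm os (insert_after y [Sym x] D)"
      using False by (simp add: insert_after_absent level_perm_Bracket)
    also have "\<dots> = level_perm [] F \<circ> (level_perm os D \<circ> transpose x y)"
    proof -
      have "level_perm os (insert_after y [Sym x] D) = level_perm os D \<circ> transpose x y"
        by (rule 3(2)) (use 3(3,4) y in auto)
      then show ?thesis by (rule arg_cong[of _ _ "\<lambda>f. level_perm [] F \<circ> f"])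
    qed
    finally show ?thesis using disj by (simp add: level_perm_Bracket comp_assoc)
  qed
qed simp

lemma level_perm_insert_single:
  "level_perm os (insert_after y [Bracket l [Sym x]] D) = level_perm os D"
proof -
  have "outer_level (insert_after y [Bracket l [Sym x]] D) = outer_level D \<and>
    cycles_perm (bracket_levels (insert_after y [Bracket l [Sym x]] D)) = cycles_perm (bracket_levels D)"
    by (induct D rule: symbols.induct) (auto simp: cycles_perm_append)
  then show ?thesis by (simp add: level_perm_def)
qed

text \<open>The point at infinity is not a symbol of the diagram, but precedes its first term.\<close>

definition place_after :: "'a \<Rightarrow> 'a \<Rightarrow> 'a diagram \<Rightarrow> 'a diagram \<Rightarrow> 'a diagram" where
  "place_after p y E D = (if y = p then E @ D else insert_after y E D)"

lemma label_perm_place_symbol: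
  assumes "distinct (p # symbols D)" and "x \<notin> set (p # symbols D)" and "y \<in> set (p # symbols D)"
    and E: "keep_brackets l E = [Sym x]"
  shows "label_perm l p (place_after p y E D) = label_perm l p D \<circ> transpose x y"
proof (cases "y = p")
  case True
  have "level_perm ([] @ p # x # []) (keep_brackets l D)
      = level_perm ([] @ p # []) (keep_brackets l D) \<circ> transpose x p"
    by (rule level_perm_insert_outer) (use assms in auto)
  then show ?thesis
    using True E by (simp add: label_perm_eq place_after_def keep_brackets_append level_perm_Sym)
next
  case False
  have "level_perm [p] (insert_after y [Sym x] (keep_brackets l D))
      = level_perm [p] (keep_brackets l D) \<circ> transpose x y"
    by (rule level_perm_insert_after) (use assms False in auto)
  then show ?thesis
    using False E by (simp add: label_perm_eq place_after_def keep_brackets_insert_after)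
qed

lemma label_perm_place_bracket:
  assumes "keep_brackets l E = [Bracket l [Sym x]]"
  shows "label_perm l p (place_after p y E D) = label_perm l p D"
proof (cases "y = p")
  case True
  then show ?thesis
    using assms by (simp add: label_perm_eq place_after_def keep_brackets_append level_perm_def)
next
  case False
  then show ?thesis
    using assms
    by (simp add: label_perm_eq place_after_def keep_brackets_insert_after level_perm_insert_single)
qed

lemma diagram_on_place_after:
  assumes D: "diagram_on (I - {x} - {p}) D" and x: "x \<in> I" "x \<noteq> p" and y: "y \<in> I - {x}"
    and E: "symbols E = [x]"
  shows "diagram_on (I - {p}) (place_after p y E D)"
proof (cases "y = p")
  case True
  then show ?thesis using D x E by (auto simp: diagram_on_def place_after_def symbols_append)
next
  case False
  then have "y \<in> set (symbols D)" using D y by (auto simp: diagram_on_def)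
  then show ?thesis
    using D x E False
    by (auto simp: diagram_on_def place_after_def set_symbols_insert_after distinct_symbols_insert_after)
qed


section \<open>Constructing a diagram\<close>

lemma labels_cycles_remove_point:
  assumes "finite I" and "\<pi> permutes I" and "x \<in> I" and "labels_cycles I a \<pi>"
  shows "labels_cycles (I - {x}) a (remove_point x \<pi>)"
  using assms orbit_remove_point[OF assms(1-3)] unfolding labels_cycles_def by simp

lemma remove_point_undo:
  assumes perm: "\<pi> permutes I" and "\<pi> y = x"
  shows "\<pi> = remove_point x \<pi> \<circ> transpose x y"
proof -
  have "inv \<pi> x = y" using assms by (metis permutes_inverses(2))
  then show ?thesis by (simp add: remove_point_def)
qed

lemma label_fixed_point:
  assumes "finite I" and "\<pi> permutes I" and "x \<in> I" and "labels_cycles I c \<pi>" and "\<pi> x = x"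
  shows "c x \<notin> c ` (I - {x})" and "card (c ` I) = Suc (card (c ` (I - {x})))"
proof -
  have "orbit \<pi> x = {x}" using assms(5) by (simp add: orbit_eq_singleton_iff)
  then have "w = x" if "w \<in> I" "c w = c x" for w
    using assms(3,4) that unfolding labels_cycles_def by blast
  then show new: "c x \<notin> c ` (I - {x})" by force
  have "c ` I = insert (c x) (c ` (I - {x}))" using assms(3) by blast
  then show "card (c ` I) = Suc (card (c ` (I - {x})))" using new assms(1) by simp
qed

lemma label_moved_point:
  assumes "x \<in> I" and "labels_cycles I c \<pi>" and "y \<in> I - {x}" and "\<pi> y = x"
  shows "c x = c y" and "c ` I = c ` (I - {x})"
proof -
  have "x \<in> orbit \<pi> y" using orbit.base[of \<pi> y] assms(4) by simp
  then show "c x = c y" using assms(1-3) unfolding labels_cycles_def by blast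
  then show "c ` I = c ` (I - {x})" using assms(3) by (intro image_remove_double[of y]) auto
qed

text \<open>
  Induction on the number of points. A point with a common predecessor \<open>y\<close> is put back directly
  behind \<open>y\<close>; a fixed point of one permutation is put back in a bracket of its own, behind its
  predecessor in the other; a common fixed point is put back in two nested brackets. The
  factorization of \<open>\<psi>\<^sup>-\<^sup>1 \<phi>\<close> gets longer only for a point fixed by exactly one permutation: such a point
  adds an edge and a vertex, whereas a common fixed point adds an edge and two vertices and a
  point with a common predecessor adds neither, so that the bound on the length persists.
\<close>

lemma diagram_exists:
  assumes fin: "finite I" and p: "p \<in> I" and \<phi>: "\<phi> permutes I" and \<psi>: "\<psi> permutes I"
    and a: "labels_cycles I a \<phi>" and b: "labels_cycles I b \<psi>" and forest: "forest (edges I a b)"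
    and inj: "inj_on pos I" and first: "\<And>x. x \<in> I \<Longrightarrow> x \<noteq> p \<Longrightarrow> pos p < pos x"
    and nc: "noncrossing pos I \<phi>" "noncrossing pos I \<psi>"
  shows "\<exists>D ts. diagram_on (I - {p}) D \<and> label_perm Re_label p D = \<phi> \<and> label_perm tr_label p D = \<psi> \<and>
    set ts \<subseteq> I \<times> I \<and> \<phi> = \<psi> \<circ> swaps ts \<and>
    length ts + card (a ` I) + card (b ` I) \<le> 2 * card (edges I a b)"
  using assms
proof (induct "card I" arbitrary: I \<phi> \<psi> rule: less_induct)
  case less
  note fin = less.prems(1) and p = less.prems(2) and \<phi> = less.prems(3) and \<psi> = less.prems(4)
    and a = less.prems(5) and b = less.prems(6) and forest = less.prems(7) and inj = less.prems(8)
    and first = less.prems(9) and nc = less.prems(10,11)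
  show ?case
  proof (cases "I = {p}")
    case True
    then have "\<phi> = id" "\<psi> = id" using \<phi> \<psi> by (simp_all add: permutes_sing)
    then show ?thesis
      using True
      by (intro exI[of _ "[]"]) (simp add: diagram_on_def label_perm_eq level_perm_Nil edges_def)
  next
    case False
    obtain x where x: "x \<in> I" "x \<noteq> p"
      and removable: "\<phi> x = x \<or> \<psi> x = x \<or> (\<exists>y\<in>I - {x}. \<phi> y = x \<and> \<psi> y = x)"
      using removable_point_exists[OF fin p False \<phi> \<psi> a b forest inj first nc] by blast
    let ?I = "I - {x}" and ?\<phi> = "remove_point x \<phi>" and ?\<psi> = "remove_point x \<psi>"
    have "edges ?I a b \<subseteq> edges I a b" by (auto simp: edges_def)
    then have "forest (edges ?I a b)" using forest forest_subset by blast
    moreover have "card ?I < card I" using fin x(1) by (rule card_Diff1_less)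
    ultimately have "\<exists>D ts. diagram_on (?I - {p}) D \<and> label_perm Re_label p D = ?\<phi> \<and>
        label_perm tr_label p D = ?\<psi> \<and> set ts \<subseteq> ?I \<times> ?I \<and> ?\<phi> = ?\<psi> \<circ> swaps ts \<and>
        length ts + card (a ` ?I) + card (b ` ?I) \<le> 2 * card (edges ?I a b)"
      using fin p x \<phi> \<psi> a b inj first nc
      by (intro less.hyps)
        (simp_all add: remove_point_permutes labels_cycles_remove_point
          noncrossing_remove_point inj_on_diff)
    then obtain D ts where D: "diagram_on (?I - {p}) D" "label_perm Re_label p D = ?\<phi>"
        "label_perm tr_label p D = ?\<psi>"
      and ts: "set ts \<subseteq> ?I \<times> ?I" "?\<phi> = ?\<psi> \<circ> swaps ts"
      and len: "length ts + card (a ` ?I) + card (b ` ?I) \<le> 2 * card (edges ?I a b)"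
      by blast
    have ts': "set ts \<subseteq> I \<times> I" using ts(1) by blast
    have dist: "distinct (p # symbols D)" and xnot: "x \<notin> set (p # symbols D)"
      using D(1) x by (auto simp: diagram_on_def)
    have ymem: "y \<in> set (p # symbols D)" if "y \<in> ?I" for y
      using that D(1) by (auto simp: diagram_on_def)
    have edge_new: "card (edges I a b) = Suc (card (edges ?I a b))" if "a x \<notin> a ` ?I \<or> b x \<notin> b ` ?I"
    proof -
      have "edges I a b = insert (a x, b x) (edges ?I a b)" using x(1) by (auto simp: edges_def)
      moreover have "(a x, b x) \<notin> edges ?I a b" using that by (auto simp: edges_def)
      ultimately show ?thesis using fin by (simp add: edges_def)
    qed
    have pred: "\<exists>y\<in>?I. \<pi> y = x" if "\<pi> permutes I" "\<pi> x \<noteq> x" for \<pi>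
    proof
      show "\<pi> (inv \<pi> x) = x" by (rule permutes_inverses(1)[OF that(1)])
      then have "inv \<pi> x \<noteq> x" using that(2) by metis
      then show "inv \<pi> x \<in> ?I"
        using permutes_in_image[OF permutes_inv[OF that(1)]] x(1) by simp
    qed
    consider (both) "\<phi> x = x" "\<psi> x = x" | (left) y where "\<phi> x = x" "y \<in> ?I" "\<psi> y = x"
      | (right) y where "\<psi> x = x" "y \<in> ?I" "\<phi> y = x" | (pair) y where "y \<in> ?I" "\<phi> y = x" "\<psi> y = x"
      using removable pred \<phi> \<psi> by metis
    then show ?thesis
    proof cases
      case both
      let ?E = "[Bracket Re_label [Bracket tr_label [Sym x]]]"
      have \<phi>\<psi>: "?\<phi> = \<phi>" "?\<psi> = \<psi>" using remove_point_fixed \<phi> \<psi> both by metis+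
      have "diagram_on (I - {p}) (?E @ D)"
        using diagram_on_place_after[OF D(1) x, of p ?E] p x by (simp add: place_after_def)
      moreover have "label_perm Re_label p (?E @ D) = \<phi>" "label_perm tr_label p (?E @ D) = \<psi>"
        using D(2,3) \<phi>\<psi> by (simp_all add: label_perm_eq level_perm_def)
      moreover have "length ts + card (a ` I) + card (b ` I) \<le> 2 * card (edges I a b)"
        using len edge_new label_fixed_point[OF fin \<phi> x(1) a both(1)]
          label_fixed_point[OF fin \<psi> x(1) b both(2)] by simp
      ultimately show ?thesis using ts(2) ts' \<phi>\<psi> by metis
    next
      case (left y)
      let ?E = "[Bracket Re_label [Sym x]]" and ?D = "place_after p y [Bracket Re_label [Sym x]] D"
      have \<phi>': "?\<phi> = \<phi>" using remove_point_fixed[OF \<phi> left(1)] .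
      have \<psi>': "\<psi> = ?\<psi> \<circ> transpose x y" by (rule remove_point_undo[OF \<psi> left(3)])
      have "diagram_on (I - {p}) ?D" by (rule diagram_on_place_after[OF D(1) x left(2)]) simp
      moreover have "label_perm Re_label p ?D = \<phi>"
        using label_perm_place_bracket[of Re_label ?E x p y D] D(2) \<phi>' by simp
      moreover have "label_perm tr_label p ?D = \<psi>"
        using label_perm_place_symbol[OF dist xnot ymem[OF left(2)], of tr_label ?E] D(3) \<psi>' by simp
      moreover have "set ((x, y) # ts) \<subseteq> I \<times> I" using ts' x left(2) by auto
      moreover have "\<phi> = \<psi> \<circ> swaps ((x, y) # ts)"
      proof -
        have "\<psi> \<circ> transpose x y = ?\<psi>" using \<psi>' by (metis comp_transpose_twice)
        then show ?thesis using ts(2) \<phi>' by (simp add: comp_assoc[symmetric])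
      qed
      moreover have "length ((x, y) # ts) + card (a ` I) + card (b ` I) \<le> 2 * card (edges I a b)"
        using len edge_new label_fixed_point[OF fin \<phi> x(1) a left(1)]
          label_moved_point[OF x(1) b left(2,3)] by simp
      ultimately show ?thesis by blast
    next
      case (right y)
      let ?E = "[Bracket tr_label [Sym x]]" and ?D = "place_after p y [Bracket tr_label [Sym x]] D"
      have \<psi>': "?\<psi> = \<psi>" using remove_point_fixed[OF \<psi> right(1)] .
      have \<phi>': "\<phi> = ?\<phi> \<circ> transpose x y" by (rule remove_point_undo[OF \<phi> right(3)])
      have "diagram_on (I - {p}) ?D" by (rule diagram_on_place_after[OF D(1) x right(2)]) simp
      moreover have "label_perm tr_label p ?D = \<psi>"
        using label_perm_place_bracket[of tr_label ?E x p y D] D(3) \<psi>' by simp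
      moreover have "label_perm Re_label p ?D = \<phi>"
        using label_perm_place_symbol[OF dist xnot ymem[OF right(2)], of Re_label ?E] D(2) \<phi>' by simp
      moreover have "set (ts @ [(x, y)]) \<subseteq> I \<times> I" using ts' x right(2) by auto
      moreover have "\<phi> = \<psi> \<circ> swaps (ts @ [(x, y)])"
        using ts(2) \<phi>' \<psi>' by (simp add: swaps_append comp_assoc)
      moreover have "length (ts @ [(x, y)]) + card (a ` I) + card (b ` I) \<le> 2 * card (edges I a b)"
        using len edge_new label_fixed_point[OF fin \<psi> x(1) b right(1)]
          label_moved_point[OF x(1) a right(2,3)] by simp
      ultimately show ?thesis by blast
    next
      case (pair y)
      let ?h = "transpose x y" and ?D = "place_after p y [Sym x] D"
      let ?ts = "map (map_prod ?h ?h) ts"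
      have \<phi>': "\<phi> = ?\<phi> \<circ> ?h" by (rule remove_point_undo[OF \<phi> pair(2)])
      have \<psi>': "\<psi> = ?\<psi> \<circ> ?h" by (rule remove_point_undo[OF \<psi> pair(3)])
      have h: "?h permutes I" using x pair(1) by (intro permutes_swap_id) auto
      have "diagram_on (I - {p}) ?D" by (rule diagram_on_place_after[OF D(1) x pair(1)]) simp
      moreover have "label_perm tr_label p ?D = \<psi>"
        using label_perm_place_symbol[OF dist xnot ymem[OF pair(1)], of tr_label "[Sym x]"] D(3) \<psi>' by simp
      moreover have "label_perm Re_label p ?D = \<phi>"
        using label_perm_place_symbol[OF dist xnot ymem[OF pair(1)], of Re_label "[Sym x]"] D(2) \<phi>' by simp
      moreover have "set ?ts \<subseteq> I \<times> I"
        using ts' permutes_in_image[OF h] by (auto simp: map_prod_def)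
      moreover have "\<phi> = \<psi> \<circ> swaps ?ts"
      proof -
        have "?h \<circ> swaps ts = swaps ?ts \<circ> ?h" by (rule swaps_conj) simp
        moreover have "?\<psi> = \<psi> \<circ> ?h" using \<psi>' by (metis comp_transpose_twice)
        ultimately have "?\<phi> = \<psi> \<circ> swaps ?ts \<circ> ?h" using ts(2) by (metis comp_assoc)
        then show ?thesis using \<phi>' by (metis comp_transpose_twice)
      qed
      moreover have "length ?ts + card (a ` I) + card (b ` I) \<le> 2 * card (edges I a b)"
      proof -
        have "edges I a b = edges ?I a b"
          unfolding edges_def
          by (rule image_remove_double[of y])
            (use pair label_moved_point[OF x(1) a pair(1,2)] label_moved_point[OF x(1) b pair(1,3)] in auto)
        then show ?thesis
          using len label_moved_point[OF x(1) a pair(1,2)] label_moved_point[OF x(1) b pair(1,3)] by simp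
      qed
      ultimately show ?thesis by blast
    qed
  qed
qed

section \<open>The permutations of a bracket diagram\<close>

lemma transpose_comp_eq: "bij g \<Longrightarrow> transpose u v \<circ> g = g \<circ> transpose (inv g u) (inv g v)"
  by (auto simp: fun_eq_iff transpose_def bij_inv_eq_iff bij_is_surj surj_f_inv_f)

lemma perm_le_comp:
  assumes fin: "finite I" and le: "perm_le S \<alpha> \<alpha>'" and \<alpha>: "\<alpha> permutes S" and \<beta>: "\<beta> permutes T"
    and disj: "S \<inter> T = {}" and sub: "S \<subseteq> I"
  shows "perm_le I (\<beta> \<circ> \<alpha>) (\<beta> \<circ> \<alpha>')"
  using le \<alpha> unfolding perm_le_def
proof (induct rule: converse_rtranclp_induct)
  case (step \<alpha> \<gamma>)
  obtain a b where ab: "a \<in> S" "b \<in> S" and ne: "orbit \<alpha> a \<noteq> orbit \<alpha> b"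
    and \<gamma>: "\<gamma> = \<alpha> \<circ> transpose a b"
    using step(1) unfolding joins_cycles_def by blast
  have orb: "orbit (\<beta> \<circ> \<alpha>) x = orbit \<alpha> x" if "x \<in> S" for x
  proof (rule orbit_cong)
    show "x \<in> orbit \<alpha> x" using mem_orbit_self[OF finite_subset[OF sub fin] step(4)] .
    fix s assume "s \<in> orbit \<alpha> x"
    then have "\<alpha> s \<in> S" using permutes_orbit_subset[OF step(4) that] permutes_in_image[OF step(4)] by blast
    then show "(\<beta> \<circ> \<alpha>) s = \<alpha> s" using \<beta> disj by (metis comp_apply disjoint_iff permutes_not_in)
  qed
  have "joins_cycles I (\<beta> \<circ> \<alpha>) (\<beta> \<circ> \<gamma>)"
    using joins_cyclesI[of a I b "\<beta> \<circ> \<alpha>"] ab sub ne orb by (auto simp: \<gamma> comp_assoc)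
  moreover have "\<gamma> permutes S" using joins_cycles_permutes[OF step(1,4)] .
  ultimately show ?case using step(3) by (meson converse_rtranclp_into_rtranclp)
qed simp

lemma cycle_of_list_insert_block:
  assumes "distinct (xs @ a # ys @ zs)"
  shows "cycle_of_list (xs @ a # ys @ zs) = cycle_of_list (xs @ a # zs) \<circ> cycle_of_list (a # ys)"
  using assms
proof (induct ys arbitrary: xs a)
  case (Cons y ys)
  have "cycle_of_list (xs @ a # (y # ys) @ zs) = cycle_of_list ((xs @ [a]) @ y # ys @ zs)" by simp
  also have "\<dots> = cycle_of_list ((xs @ [a]) @ y # zs) \<circ> cycle_of_list (y # ys)"
    by (rule Cons(1)) (use Cons(2) in simp)
  also have "cycle_of_list ((xs @ [a]) @ y # zs) = cycle_of_list (xs @ a # zs) \<circ> transpose y a"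
  proof -
    have "distinct (xs @ a # y # zs)" using Cons(2) by auto
    then show ?thesis using cycle_of_list_insert[of xs a y zs] by simp
  qed
  finally show ?case by (simp add: comp_assoc transpose_commute)
qed simp

text \<open>
  Opening the cycle \<open>ys\<close> behind \<open>a\<close> amounts to the transposition of \<open>a\<close> with the last element of
  \<open>ys\<close>, written below as the preimage of the first one.
\<close>

lemma perm_le_insert_block:
  assumes dist: "distinct (xs @ a # ys @ zs)"
  shows "perm_le (set (xs @ a # ys @ zs)) (cycle_of_list (xs @ a # zs) \<circ> cycle_of_list ys)
    (cycle_of_list (xs @ a # ys @ zs))"
proof (cases ys)
  case Nil
  then show ?thesis by (simp add: perm_le_refl)
next
  case (Cons y ys')
  let ?I = "set (xs @ a # ys @ zs)"
  let ?f = "cycle_of_list (xs @ a # zs)" and ?g = "cycle_of_list ys"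
  let ?b = "inv ?g y"
  have f: "?f permutes set (xs @ a # zs)" and g: "?g permutes set ys" by (rule cycle_permutes)+
  have ga: "inv ?g a = a"
    using permutes_inv[OF g] dist by (intro permutes_not_in[of _ "set ys"]) auto
  have b: "?b \<in> set ys" using permutes_in_image[OF permutes_inv[OF g], of y] Cons by simp
  have "cycle_of_list (a # ys) = transpose a y \<circ> ?g" using Cons by simp
  also have "\<dots> = ?g \<circ> transpose a ?b"
    using transpose_comp_eq[OF permutes_bij[OF g], of a y] ga by simp
  finally have eq: "cycle_of_list (xs @ a # ys @ zs) = (?f \<circ> ?g) \<circ> transpose a ?b"
    using cycle_of_list_insert_block[OF dist] by (simp add: comp_assoc)
  have "(?f \<circ> ?g) x \<notin> set ys" if "x \<notin> set ys" for x
  proof -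
    have "?g x = x" using that g by (simp add: permutes_not_in)
    moreover have "?f x \<notin> set ys"
    proof (cases "x \<in> set (xs @ a # zs)")
      case True
      then have "?f x \<in> set (xs @ a # zs)" using permutes_in_image[OF f] by blast
      then show ?thesis using dist by auto
    next
      case False
      then have "?f x = x" by (rule permutes_not_in[OF f])
      then show ?thesis using that by simp
    qed
    ultimately show ?thesis by simp
  qed
  then have "orbit (?f \<circ> ?g) a \<subseteq> - set ys"
    using dist by (intro orbit_closed_subset) auto
  moreover have "?b \<in> orbit (?f \<circ> ?g) ?b"
  proof (rule mem_orbit_self[of ?I])
    have "?f permutes ?I" by (rule permutes_subset[OF f]) auto
    moreover have "?g permutes ?I" by (rule permutes_subset[OF g]) auto
    ultimately show "?f \<circ> ?g permutes ?I" by (rule permutes_compose[rotated])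
  qed simp
  ultimately have "orbit (?f \<circ> ?g) a \<noteq> orbit (?f \<circ> ?g) ?b" using b by blast
  then have "joins_cycles ?I (?f \<circ> ?g) ((?f \<circ> ?g) \<circ> transpose a ?b)"
    using b by (intro joins_cyclesI) auto
  then show ?thesis unfolding eq by (rule joins_cycles_perm_le)
qed

lemma perm_le_merge_cycles:
  assumes dist: "distinct (xs @ ys @ zs)"
  shows "perm_le (set (xs @ ys @ zs)) (cycle_of_list ys \<circ> cycle_of_list (xs @ zs))
    (cycle_of_list (xs @ ys @ zs))"
proof (cases xs rule: rev_cases)
  case Nil
  show ?thesis
  proof (cases ys rule: rev_cases)
    case Nil
    then show ?thesis using \<open>xs = []\<close> by (simp add: perm_le_refl)
  next
    case (snoc ys' a)
    then show ?thesis using Nil perm_le_insert_block[of ys' a zs "[]"] dist by simp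
  qed
next
  case (snoc xs' a)
  have "cycle_of_list ys \<circ> cycle_of_list (xs @ zs) = cycle_of_list (xs @ zs) \<circ> cycle_of_list ys"
    by (rule permutes_commute[OF cycle_permutes cycle_permutes]) (use dist in auto)
  then show ?thesis using snoc perm_le_insert_block[of xs' a ys zs] dist by simp
qed

text \<open>
  The contents of a bracket are merged to one cycle first, then those around it, and then the two
  cycles are joined.
\<close>

lemma level_perm_le:
  assumes "distinct (os @ symbols D)"
  shows "perm_le (set (os @ symbols D)) (level_perm os D) (cycle_of_list (os @ symbols D))"
  using assms
proof (induct D arbitrary: os rule: symbols.induct)
  case 1
  show ?case by (simp add: level_perm_Nil perm_le_refl)
next
  case (2 k D)
  then show ?case using 2(1)[of "os @ [k]"] by (simp add: level_perm_Sym)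
next
  case (3 l E D)
  let ?I = "set (os @ symbols (Bracket l E # D))"
  let ?e = "cycle_of_list (symbols E)" and ?d = "cycle_of_list (os @ symbols D)"
  note dist = 3(3)
  have fin: "finite ?I" by simp
  have disj: "set (symbols E) \<inter> set (os @ symbols D) = {}" using 3(3) by auto
  have lE: "level_perm [] E permutes set (symbols E)"
    and lD: "level_perm os D permutes set (os @ symbols D)"
    using level_perm_permutes[of "[]" E] level_perm_permutes[of os D] by simp_all
  have E: "perm_le (set (symbols E)) (level_perm [] E) ?e" using 3(1)[of "[]"] 3(3) by simp
  have D: "perm_le (set (os @ symbols D)) (level_perm os D) ?d" by (rule 3(2)) (use 3(3) in auto)
  have e: "?e permutes set (symbols E)" by (rule cycle_permutes)
  have "level_perm os (Bracket l E # D) = level_perm [] E \<circ> level_perm os D"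
    by (rule level_perm_Bracket) (use disj in auto)
  also have "\<dots> = level_perm os D \<circ> level_perm [] E" by (rule permutes_commute[OF lE lD disj])
  finally have 1: "perm_le ?I (level_perm os (Bracket l E # D)) (level_perm os D \<circ> ?e)"
    by (simp only:) (rule perm_le_comp[OF fin E lE lD disj], auto)
  have 2: "level_perm os D \<circ> ?e = ?e \<circ> level_perm os D"
    by (rule permutes_commute[OF lD e]) (use disj in blast)
  have 3: "perm_le ?I (?e \<circ> level_perm os D) (?e \<circ> ?d)"
    by (rule perm_le_comp[OF fin D lD e]) (use disj in auto)
  have 4: "perm_le ?I (?e \<circ> ?d) (cycle_of_list (os @ symbols (Bracket l E # D)))"
    using perm_le_merge_cycles[of os "symbols E" "symbols D"] dist by simp
  show ?case by (rule perm_le_trans[OF 1[unfolded 2] perm_le_trans[OF 3 4]])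
qed

lemma label_perm_le:
  assumes "distinct (p # symbols D)"
  shows "perm_le (insert p (set (symbols D))) (label_perm l p D) (cycle_of_list (p # symbols D))"
  using level_perm_le[of "[p]" "keep_brackets l D"] assms by (simp add: label_perm_eq)

lemma label_perm_permutes: "label_perm l p D permutes insert p (set (symbols D))"
  using level_perm_permutes[of "[p]" "keep_brackets l D"] by (simp add: label_perm_eq)

lemma orbit_cycle_of_list:
  assumes dist: "distinct C" and x: "x \<in> set C"
  shows "orbit (cycle_of_list C) x = set C"
proof
  show "orbit (cycle_of_list C) x \<subseteq> set C" by (rule permutes_orbit_subset[OF cycle_permutes x])
  show "set C \<subseteq> orbit (cycle_of_list C) x"
  proof
    fix y assume "y \<in> set C"
    then obtain i j where i: "i < length C" "x = C ! i" and j: "j < length C" "y = C ! j"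
      using x by (metis in_set_conv_nth)
    let ?n = "j + length C - i"
    have "(cycle_of_list C ^^ ?n) x = rotate ?n C ! i"
      using cyclic_rotation[OF dist, of ?n] i by (metis nth_map)
    also have "\<dots> = y" using i j by (simp add: nth_rotate)
    finally have "y = (cycle_of_list C ^^ ?n) x" ..
    moreover have "0 < ?n" using i by simp
    ultimately show "y \<in> orbit (cycle_of_list C) x" unfolding orbit_altdef by blast
  qed
qed

lemma orbit_cycles_perm:
  assumes dist: "distinct (concat Ls)" and C: "C \<in> set Ls" and x: "x \<in> set C"
  shows "orbit (cycles_perm Ls) x = set C"
proof -
  obtain As Bs where Ls: "Ls = As @ C # Bs" using C by (meson split_list)
  have "cycles_perm Ls y = cycle_of_list C y" if y: "y \<in> set C" for y
  proof -
    have "y \<notin> set (concat Bs)" using dist y by (auto simp: Ls)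
    then have "cycles_perm Bs y = y" by (rule permutes_not_in[OF cycles_perm_permutes])
    moreover have "cycle_of_list C y \<in> set C" using y permutes_in_image[OF cycle_permutes] by metis
    then have "cycle_of_list C y \<notin> set (concat As)" using dist by (auto simp: Ls)
    then have "cycles_perm As (cycle_of_list C y) = cycle_of_list C y"
      by (rule permutes_not_in[OF cycles_perm_permutes])
    ultimately show ?thesis by (simp add: Ls cycles_perm_append)
  qed
  moreover have "distinct C" using dist by (simp add: Ls)
  ultimately have "orbit (cycles_perm Ls) x = orbit (cycle_of_list C) x"
    using orbit_cycle_of_list[OF \<open>distinct C\<close> x]
    by (intro orbit_cong) (use x in auto)
  then show ?thesis using orbit_cycle_of_list[OF \<open>distinct C\<close> x] by simp
qed


section \<open>The levels of a bracket diagram form a forest\<close>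

fun bracket_count :: "'a diagram \<Rightarrow> nat" where
  "bracket_count [] = 0"
| "bracket_count (Sym k # D) = bracket_count D"
| "bracket_count (Bracket l E # D) = Suc (bracket_count E + bracket_count D)"

text \<open>
  Number the brackets from left to right, starting from \<open>c\<close>. Then this is the number of the
  innermost \<open>l\<close>-bracket around \<open>x\<close>, or \<open>A\<close> if there is none.
\<close>

fun level_id :: "label \<Rightarrow> nat \<Rightarrow> nat \<Rightarrow> 'a diagram \<Rightarrow> 'a \<Rightarrow> nat" where
  "level_id l A c [] x = A"
| "level_id l A c (Sym k # D) x = level_id l A c D x"
| "level_id l A c (Bracket l' E # D) x =
     (if x \<in> set (symbols E) then level_id l (if l' = l then c else A) (Suc c) E x
      else level_id l A (Suc c + bracket_count E) D x)"

lemma level_id_outside: "x \<notin> set (symbols D) \<Longrightarrow> level_id l A c D x = A"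
  by (induct l A c D x rule: level_id.induct) auto

lemma level_id_range:
  "level_id l A c D x = A \<or> c \<le> level_id l A c D x \<and> level_id l A c D x < c + bracket_count D"
  by (induct l A c D x rule: level_id.induct) (auto split: if_splits)

lemma outer_level_append: "outer_level (C @ D) = outer_level C @ outer_level D"
  by (induct C rule: symbols.induct) auto

lemma bracket_levels_append: "bracket_levels (C @ D) = bracket_levels C @ bracket_levels D"
  by (induct C rule: symbols.induct) auto

text \<open>
  The intervals for \<open>i\<close> keep the numbers used inside a bracket, and behind it, apart. A level
  without symbols is matched by the number of its bracket, which no symbol has.
\<close>

lemma level_id_levels:
  assumes "distinct (symbols D)" and "A < c"
  shows "set (outer_level (keep_brackets l D)) = {x \<in> set (symbols D). level_id l A c D x = A} \<and>
    (\<forall>C\<in>set (bracket_levels (keep_brackets l D)). \<exists>i. c \<le> i \<and> i < c + bracket_count D \<and>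
      set C = {x \<in> set (symbols D). level_id l A c D x = i})"
  using assms
proof (induct D arbitrary: A c rule: symbols.induct)
  case (2 k D)
  then have k: "level_id l A c D k = A" by (intro level_id_outside) simp
  have IH: "set (outer_level (keep_brackets l D)) = {x \<in> set (symbols D). level_id l A c D x = A}"
      "\<And>C. C \<in> set (bracket_levels (keep_brackets l D)) \<Longrightarrow> \<exists>i. c \<le> i \<and> i < c + bracket_count D \<and>
        set C = {x \<in> set (symbols D). level_id l A c D x = i}"
    using 2(1)[of A c] 2(2,3) by auto
  have ext: "{x \<in> set (symbols (Sym k # D)). level_id l A c (Sym k # D) x = i}
      = (if i = A then {k} else {}) \<union> {x \<in> set (symbols D). level_id l A c D x = i}" for i
    using k by auto
  have outer: "set (outer_level (keep_brackets l (Sym k # D)))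
      = (if A = A then {k} else {}) \<union> {x \<in> set (symbols D). level_id l A c D x = A}"
    using IH(1) by simp
  have "\<exists>i. c \<le> i \<and> i < c + bracket_count (Sym k # D) \<and>
      set C = (if i = A then {k} else {}) \<union> {x \<in> set (symbols D). level_id l A c D x = i}"
    if "C \<in> set (bracket_levels (keep_brackets l (Sym k # D)))" for C
  proof -
    from that have "C \<in> set (bracket_levels (keep_brackets l D))" by simp
    then obtain i where "c \<le> i" "i < c + bracket_count D"
      "set C = {x \<in> set (symbols D). level_id l A c D x = i}" using IH(2) by blast
    then show ?thesis using 2(3) by (intro exI[of _ i]) simp
  qed
  then show ?case unfolding ext using outer by blast
next
  case (3 l' E D)
  let ?A = "if l' = l then c else A" and ?c = "Suc c + bracket_count E"
  let ?E = "\<lambda>i. {x \<in> set (symbols E). level_id l ?A (Suc c) E x = i}"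
  let ?D = "\<lambda>i. {x \<in> set (symbols D). level_id l A ?c D x = i}"
  let ?n = "bracket_count E + bracket_count D"
  have E: "set (outer_level (keep_brackets l E)) = ?E ?A"
      "\<And>C. C \<in> set (bracket_levels (keep_brackets l E)) \<Longrightarrow>
        \<exists>i. Suc c \<le> i \<and> i < Suc c + bracket_count E \<and> set C = ?E i"
    using 3(1)[of ?A "Suc c"] 3(3,4) by auto
  have D: "set (outer_level (keep_brackets l D)) = ?D A"
      "\<And>C. C \<in> set (bracket_levels (keep_brackets l D)) \<Longrightarrow>
        \<exists>i. ?c \<le> i \<and> i < ?c + bracket_count D \<and> set C = ?D i"
    using 3(2)[of A ?c] 3(3,4) by auto
  have disj: "x \<notin> set (symbols E)" if "x \<in> set (symbols D)" for x using that 3(3) by auto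
  have union: "{x \<in> set (symbols (Bracket l' E # D)). level_id l A c (Bracket l' E # D) x = i}
      = ?E i \<union> ?D i" for i
    using disj by auto
  have E_empty: "?E i = {}" if "i \<noteq> ?A" "i < Suc c \<or> ?c \<le> i" for i
  proof -
    have "level_id l ?A (Suc c) E x \<noteq> i" for x
      using level_id_range[of l ?A "Suc c" E x] that by linarith
    then show ?thesis by blast
  qed
  have D_empty: "?D i = {}" if "i \<noteq> A" "i < ?c" for i
  proof -
    have "level_id l A ?c D x \<noteq> i" for x
      using level_id_range[of l A ?c D x] that by linarith
    then show ?thesis by blast
  qed
  have E': "\<exists>i. c \<le> i \<and> i < c + bracket_count (Bracket l' E # D) \<and> set C = ?E i \<union> ?D i"
    if C: "C \<in> set (bracket_levels (keep_brackets l E))" for C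
  proof -
    obtain i where i: "Suc c \<le> i" "i < Suc c + bracket_count E" "set C = ?E i" using E(2)[OF C] by blast
    moreover have "?D i = {}" by (rule D_empty) (use i 3(4) in auto)
    ultimately show ?thesis by (intro exI[of _ i]) auto
  qed
  have D': "\<exists>i. c \<le> i \<and> i < c + bracket_count (Bracket l' E # D) \<and> set C = ?E i \<union> ?D i"
    if C: "C \<in> set (bracket_levels (keep_brackets l D))" for C
  proof -
    obtain i where i: "?c \<le> i" "i < ?c + bracket_count D" "set C = ?D i" using D(2)[OF C] by blast
    moreover have "?E i = {}" by (rule E_empty) (use i 3(4) in auto)
    ultimately show ?thesis by (intro exI[of _ i]) auto
  qed
  show ?case
  proof (cases "l' = l")
    case True
    have "?E A = {}" by (rule E_empty) (use True 3(4) in auto)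
    then have outer: "set (outer_level (keep_brackets l (Bracket l' E # D))) = ?E A \<union> ?D A"
      using True D(1) by (simp del: Collect_empty_eq)
    have "?D c = {}" by (rule D_empty) (use 3(4) in auto)
    then have "set (outer_level (keep_brackets l E)) = ?E c \<union> ?D c"
      using True E(1) by (simp del: Collect_empty_eq)
    then have new: "\<exists>i. c \<le> i \<and> i < c + bracket_count (Bracket l' E # D) \<and>
        set (outer_level (keep_brackets l E)) = ?E i \<union> ?D i"
      by (intro exI[of _ c]) auto
    have "set (bracket_levels (keep_brackets l (Bracket l' E # D))) = insert (outer_level (keep_brackets l E))
        (set (bracket_levels (keep_brackets l E)) \<union> set (bracket_levels (keep_brackets l D)))"
      using True by simp
    then have "\<exists>i. c \<le> i \<and> i < c + bracket_count (Bracket l' E # D) \<and> set C = ?E i \<union> ?D i"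
      if "C \<in> set (bracket_levels (keep_brackets l (Bracket l' E # D)))" for C
      using that new E'[of C] D'[of C] by (metis (no_types, lifting) UnE insertE)
    then show ?thesis unfolding union using outer by (intro conjI ballI)
  next
    case False
    have "set (outer_level (keep_brackets l (Bracket l' E # D))) = ?E A \<union> ?D A"
      using False E(1) D(1) by (simp add: outer_level_append)
    moreover have "set (bracket_levels (keep_brackets l (Bracket l' E # D)))
        = set (bracket_levels (keep_brackets l E)) \<union> set (bracket_levels (keep_brackets l D))"
      using False by (simp add: bracket_levels_append)
    moreover from this have "\<exists>i. c \<le> i \<and> i < c + bracket_count (Bracket l' E # D) \<and> set C = ?E i \<union> ?D i"
      if "C \<in> set (bracket_levels (keep_brackets l (Bracket l' E # D)))" for C
      using that E'[of C] D'[of C] by (metis (no_types, lifting) UnE)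
    ultimately show ?thesis unfolding union by (intro conjI ballI)
  qed
qed simp

text \<open>
  Each bracket contributes an edge with its new number as one end, and the symbols directly inside
  the bracket lie on this edge. It is added even when there are no such symbols: brackets further
  inside may be attached to its new end. The superfluous edges are dropped at the end
  of the induction step.
\<close>

lemma level_id_forest:
  assumes "distinct (symbols D)" and "forest E\<^sub>0" and "(A, B) \<in> E\<^sub>0" and "\<forall>(i, j)\<in>E\<^sub>0. i < c \<and> j < c"
  shows "forest (E\<^sub>0 \<union> edges (set (symbols D)) (level_id Re_label A c D) (level_id tr_label B c D))"
  using assms
proof (induct D arbitrary: A B c E\<^sub>0 rule: symbols.induct)
  case 1
  then show ?case by (simp add: edges_def)
next
  case (2 k D)
  have "level_id Re_label A c D k = A" "level_id tr_label B c D k = B"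
    using 2(2) by (simp_all add: level_id_outside)
  then show ?case using 2(1)[of E\<^sub>0 A B c] 2(2-5) by (simp add: edges_def insert_absorb)
next
  case (3 l E D)
  let ?A = "if l = Re_label then c else A" and ?B = "if l = tr_label then c else B"
  let ?c\<^sub>1 = "Suc c" and ?c\<^sub>2 = "Suc c + bracket_count E"
  let ?E\<^sub>1 = "insert (?A, ?B) E\<^sub>0"
  let ?E\<^sub>2 = "?E\<^sub>1 \<union> edges (set (symbols E)) (level_id Re_label ?A ?c\<^sub>1 E) (level_id tr_label ?B ?c\<^sub>1 E)"
  have AB: "A < c" "B < c" using 3(5,6) by auto
  have "?A \<notin> Domain E\<^sub>0 \<or> ?B \<notin> Range E\<^sub>0"
    using 3(6) by (cases l) fastforce+
  then have E1: "forest ?E\<^sub>1" by (rule forest.insert[OF 3(4)])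
  have b1: "\<forall>(i, j)\<in>?E\<^sub>1. i < ?c\<^sub>1 \<and> j < ?c\<^sub>1" using 3(6) AB by fastforce
  have E2: "forest ?E\<^sub>2"
    by (rule 3(1)) (use 3(3) E1 b1 in auto)
  have b2: "\<forall>(i, j)\<in>?E\<^sub>2. i < ?c\<^sub>2 \<and> j < ?c\<^sub>2"
  proof -
    have "level_id Re_label ?A ?c\<^sub>1 E x < ?c\<^sub>2" "level_id tr_label ?B ?c\<^sub>1 E x < ?c\<^sub>2" for x
      using level_id_range[of Re_label ?A ?c\<^sub>1 E x] level_id_range[of tr_label ?B ?c\<^sub>1 E x] AB by auto
    then show ?thesis using b1 unfolding edges_def by fastforce
  qed
  have "forest (?E\<^sub>2 \<union> edges (set (symbols D)) (level_id Re_label A ?c\<^sub>2 D) (level_id tr_label B ?c\<^sub>2 D))"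
    by (rule 3(2)) (use 3(3,5) E2 b2 in auto)
  then show ?case
  proof (rule forest_subset)
    have "x \<notin> set (symbols E)" if "x \<in> set (symbols D)" for x using that 3(3) by auto
    then show "E\<^sub>0 \<union> edges (set (symbols (Bracket l E # D))) (level_id Re_label A c (Bracket l E # D))
        (level_id tr_label B c (Bracket l E # D))
      \<subseteq> ?E\<^sub>2 \<union> edges (set (symbols D)) (level_id Re_label A ?c\<^sub>2 D) (level_id tr_label B ?c\<^sub>2 D)"
      unfolding edges_def by auto
  qed
qed

lemma labels_cycles_level_id:
  assumes dist: "distinct (p # symbols D)"
  shows "labels_cycles (insert p (set (symbols D))) (level_id l 0 1 D) (label_perm l p D)"
proof -
  let ?K = "keep_brackets l D" and ?I = "insert p (set (symbols D))"
  let ?Ls = "(p # outer_level ?K) # bracket_levels ?K"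
  have perm: "label_perm l p D = cycles_perm ?Ls" by (simp add: label_perm_eq level_perm_def)
  have dLs: "distinct (concat ?Ls)"
    using distinct_levels[of ?K] set_levels[of ?K] dist by auto
  have p: "level_id l 0 1 D p = 0" using dist by (simp add: level_id_outside)
  have "\<exists>i. set C = {x \<in> ?I. level_id l 0 1 D x = i}" if "C \<in> set ?Ls" for C
  proof (cases "C = p # outer_level ?K")
    case True
    then show ?thesis using level_id_levels[of D 0 1 l] dist p by (intro exI[of _ 0]) auto
  next
    case False
    then have "C \<in> set (bracket_levels ?K)" using that by simp
    moreover have "\<forall>C\<in>set (bracket_levels ?K). \<exists>i. 1 \<le> i \<and> i < 1 + bracket_count D \<and>
        set C = {x \<in> set (symbols D). level_id l 0 1 D x = i}"
      using level_id_levels[of D 0 1 l] dist by simp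
    ultimately obtain i where "1 \<le> i" "set C = {x \<in> set (symbols D). level_id l 0 1 D x = i}"
      by blast
    moreover have "level_id l 0 1 D p \<noteq> i" using p \<open>1 \<le> i\<close> by simp
    ultimately have "set C = {x \<in> ?I. level_id l 0 1 D x = i}" by blast
    then show ?thesis ..
  qed
  moreover have "\<exists>C\<in>set ?Ls. x \<in> set C" if "x \<in> ?I" for x
    using that set_levels[of ?K] by auto
  ultimately show ?thesis
  proof -
    assume label: "\<And>C. C \<in> set ?Ls \<Longrightarrow> \<exists>i. set C = {x \<in> ?I. level_id l 0 1 D x = i}"
      and cover: "\<And>x. x \<in> ?I \<Longrightarrow> \<exists>C\<in>set ?Ls. x \<in> set C"
    show ?thesis
      unfolding labels_cycles_def perm
    proof (intro ballI)
      fix x y assume x: "x \<in> ?I" and y: "y \<in> ?I"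
      obtain C where C: "C \<in> set ?Ls" "x \<in> set C" using cover[OF x] by blast
      obtain i where i: "set C = {x \<in> ?I. level_id l 0 1 D x = i}" using label[OF C(1)] by blast
      then have "level_id l 0 1 D x = i" using C(2) by blast
      then show "y \<in> orbit (cycles_perm ?Ls) x \<longleftrightarrow> level_id l 0 1 D y = level_id l 0 1 D x"
        unfolding orbit_cycles_perm[OF dLs C] i using y by simp
    qed
  qed
qed

lemma forest_relabel:
  assumes fin: "finite I" and forest: "forest (edges I a b)"
    and a: "\<And>x y. x \<in> I \<Longrightarrow> y \<in> I \<Longrightarrow> a x = a y \<longleftrightarrow> a' x = a' y"
    and b: "\<And>x y. x \<in> I \<Longrightarrow> y \<in> I \<Longrightarrow> b x = b y \<longleftrightarrow> b' x = b' y"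
  shows "forest (edges I a' b')"
proof -
  let ?f = "a' \<circ> inv_into I a" and ?g = "b' \<circ> inv_into I b"
  have f: "?f (a x) = a' x" and g: "?g (b x) = b' x" if "x \<in> I" for x
    using that a[of "inv_into I a (a x)" x] b[of "inv_into I b (b x)" x]
    by (auto simp: inv_into_into f_inv_into_f)
  have "edges I a' b' = map_prod ?f ?g ` edges I a b"
    unfolding edges_def image_image by (rule image_cong[OF refl]) (simp add: f[unfolded comp_def] g[unfolded comp_def])
  moreover have "inj_on ?f (Domain (edges I a b))"
  proof (rule inj_onI)
    fix u v assume "u \<in> Domain (edges I a b)" "v \<in> Domain (edges I a b)" and eq: "?f u = ?f v"
    then obtain x y where xy: "x \<in> I" "u = a x" "y \<in> I" "v = a y" by (auto simp: edges_def)
    then show "u = v" using eq a f by metis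
  qed
  moreover have "inj_on ?g (Range (edges I a b))"
  proof (rule inj_onI)
    fix u v assume "u \<in> Range (edges I a b)" "v \<in> Range (edges I a b)" and eq: "?g u = ?g v"
    then obtain x y where xy: "x \<in> I" "u = b x" "y \<in> I" "v = b y" by (auto simp: edges_def)
    then show "u = v" using eq b g by metis
  qed
  ultimately show ?thesis using forest_image[OF forest] by metis
qed

lemma labels_cycles_orbit: "finite I \<Longrightarrow> \<pi> permutes I \<Longrightarrow> labels_cycles I (orbit \<pi>) \<pi>"
  unfolding labels_cycles_def by (metis orbit_eq_iff)

lemma labels_cycles_eq_iff:
  assumes "finite I" and "\<pi> permutes I" and "labels_cycles I a \<pi>" and "x \<in> I" and "y \<in> I"
  shows "a x = a y \<longleftrightarrow> orbit \<pi> x = orbit \<pi> y"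
  using assms orbit_eq_iff[OF assms(1,2)] unfolding labels_cycles_def by metis

lemma diagram_forest:
  assumes dist: "distinct (p # symbols D)"
  shows "forest (edges (insert p (set (symbols D))) (orbit (label_perm Re_label p D))
    (orbit (label_perm tr_label p D)))"
proof -
  let ?I = "insert p (set (symbols D))"
  let ?a = "level_id Re_label 0 1 D" and ?b = "level_id tr_label 0 1 D"
  have "forest {(0::nat, 0::nat)}" using forest.insert[OF forest.empty, of 0 0] by simp
  then have "forest ({(0, 0)} \<union> edges (set (symbols D)) ?a ?b)"
    using dist by (intro level_id_forest) auto
  moreover have "edges ?I ?a ?b = {(0, 0)} \<union> edges (set (symbols D)) ?a ?b"
    using dist by (simp add: edges_def level_id_outside)
  ultimately have "forest (edges ?I ?a ?b)" by simp
  then show ?thesis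
    by (rule forest_relabel[rotated])
      (use labels_cycles_eq_iff[OF _ label_perm_permutes labels_cycles_level_id[OF dist]] in auto)
qed

section \<open>Diagrams, upper bounds and planarity\<close>

lemma diagram_iff_upper_bound:
  assumes fin: "finite I" and p: "p \<in> I" and \<phi>: "\<phi> permutes I" and \<psi>: "\<psi> permutes I"
  shows "(\<exists>D. diagram_on (I - {p}) D \<and> label_perm Re_label p D = \<phi> \<and> label_perm tr_label p D = \<psi>)
    \<longleftrightarrow> (\<exists>\<rho>. perm_le I \<phi> \<rho> \<and> perm_le I \<psi> \<rho>) \<and> forest (edges I (orbit \<phi>) (orbit \<psi>))"
proof
  assume "\<exists>D. diagram_on (I - {p}) D \<and> label_perm Re_label p D = \<phi> \<and> label_perm tr_label p D = \<psi>"
  then obtain D where D: "diagram_on (I - {p}) D"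
    and perms: "label_perm Re_label p D = \<phi>" "label_perm tr_label p D = \<psi>" by blast
  have I: "insert p (set (symbols D)) = I" and dist: "distinct (p # symbols D)"
    using D p by (auto simp: diagram_on_def)
  show "(\<exists>\<rho>. perm_le I \<phi> \<rho> \<and> perm_le I \<psi> \<rho>) \<and> forest (edges I (orbit \<phi>) (orbit \<psi>))"
    using label_perm_le[OF dist, of Re_label] label_perm_le[OF dist, of tr_label]
      diagram_forest[OF dist] unfolding I perms by blast
next
  assume R: "(\<exists>\<rho>. perm_le I \<phi> \<rho> \<and> perm_le I \<psi> \<rho>) \<and> forest (edges I (orbit \<phi>) (orbit \<psi>))"
  then obtain \<rho> where \<rho>: "perm_le I \<phi> \<rho>" "perm_le I \<psi> \<rho>" by blast
  obtain pos where pos: "inj_on pos I" "\<And>x. x \<in> I \<Longrightarrow> x \<noteq> p \<Longrightarrow> pos p < pos x"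
      "noncrossing pos I \<phi>" "noncrossing pos I \<psi>"
    using common_noncrossing_order[OF fin p \<phi> \<psi> \<rho>] by blast
  show "\<exists>D. diagram_on (I - {p}) D \<and> label_perm Re_label p D = \<phi> \<and> label_perm tr_label p D = \<psi>"
    using diagram_exists[OF fin p \<phi> \<psi> labels_cycles_orbit[OF fin \<phi>] labels_cycles_orbit[OF fin \<psi>] _ pos]
      R by blast
qed

lemma cycle_count_conj:
  assumes fin: "finite I" and g: "g permutes I" and h: "h permutes I"
  shows "cycle_count I (h \<circ> g \<circ> inv h) = cycle_count I g"
proof -
  have "orbit (h \<circ> g \<circ> inv h) (h x) = h ` orbit g x" for x
    by (rule orbit_inverse[symmetric])
      (simp_all add: mem_orbit_self[OF fin g] permutes_inverses(2)[OF h])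
  then have "orbit (h \<circ> g \<circ> inv h) ` h ` I = (`) h ` orbit g ` I"
    unfolding image_image by (intro image_cong refl)
  moreover have "inj_on ((`) h) (orbit g ` I)"
    using permutes_inj[OF h] by (simp add: inj_on_def inj_image_eq_iff)
  ultimately show ?thesis
    by (simp add: cycle_count_eq_card permutes_image[OF h] card_image)
qed

lemma orbit_inv_permutes:
  assumes "finite I" and "\<pi> permutes I"
  shows "orbit (inv \<pi>) x = orbit \<pi> x"
proof (rule orbit_inv_eq)
  show "permutation \<pi>" unfolding permutation_permutes using assms by blast
qed

lemma orbit_partition_inv: "finite I \<Longrightarrow> \<pi> permutes I \<Longrightarrow> orbit_partition I (inv \<pi>) = orbit_partition I \<pi>"
  by (simp add: orbit_partition_def orbit_inv_permutes)

lemma planar_on_inv_iff: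
  assumes fin: "finite I" and \<phi>: "\<phi> permutes I" and \<psi>: "\<psi> permutes I"
  shows "planar_on I \<phi> (inv \<psi>) \<longleftrightarrow>
    cycle_count I \<phi> + cycle_count I \<psi> + cycle_count I (inv \<psi> \<circ> \<phi>)
      = 2 * component_count I (orbit \<phi>) (orbit \<psi>) + card I"
proof -
  have g: "inv \<psi> \<circ> \<phi> permutes I" by (rule permutes_compose[OF \<phi> permutes_inv[OF \<psi>]])
  have "\<psi> \<circ> (inv \<psi> \<circ> \<phi>) \<circ> inv \<psi> = \<phi> \<circ> inv \<psi>"
    by (simp add: comp_assoc[symmetric] permutes_inv_o(1)[OF \<psi>])
  then have "cycle_count I (\<phi> \<circ> inv \<psi>) = cycle_count I (inv \<psi> \<circ> \<phi>)"
    using cycle_count_conj[OF fin g \<psi>] by simp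
  then show ?thesis
    unfolding planar_on_def orbit_partition_inv[OF fin \<psi>] card_partition_join[OF fin \<phi> \<psi>]
      cycle_count_def[symmetric] by linarith
qed

text \<open>
  Planarity says that the least number of transpositions leading from \<open>\<psi>\<close> to \<open>\<phi>\<close> is the number of
  vertices minus twice the number of components, which is the case of equality in the genus
  inequality. For the converse, this number is also the bound provided by \<open>diagram_exists\<close>,
  because in a forest the number of edges is the number of vertices minus the number of components.
\<close>

lemma planar_on_inv_iff_upper_bound:
  assumes fin: "finite I" and p: "p \<in> I" and \<phi>: "\<phi> permutes I" and \<psi>: "\<psi> permutes I"
    and forest: "forest (edges I (orbit \<phi>) (orbit \<psi>))"
  shows "planar_on I \<phi> (inv \<psi>) \<longleftrightarrow> (\<exists>\<rho>. perm_le I \<phi> \<rho> \<and> perm_le I \<psi> \<rho>)"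
proof -
  let ?g = "inv \<psi> \<circ> \<phi>" and ?j = "component_count I (orbit \<phi>) (orbit \<psi>)"
  have g: "?g permutes I" by (rule permutes_compose[OF \<phi> permutes_inv[OF \<psi>]])
  obtain ts where ts: "set ts \<subseteq> I \<times> I" "swaps ts = ?g" "length ts + cycle_count I ?g = card I"
    using permutes_swaps_exist[OF fin g] by blast
  have "\<phi> = \<psi> \<circ> swaps ts"
    unfolding ts(2) by (simp add: comp_assoc[symmetric] permutes_inv_o(1)[OF \<psi>])
  note genus = genus_inequality[OF fin \<psi> ts(1) this]
  show ?thesis
  proof
    assume "planar_on I \<phi> (inv \<psi>)"
    then have "2 * ?j + length ts \<le> cycle_count I \<phi> + cycle_count I \<psi>"
      using ts(3) unfolding planar_on_inv_iff[OF fin \<phi> \<psi>] by linarith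
    then show "\<exists>\<rho>. perm_le I \<phi> \<rho> \<and> perm_le I \<psi> \<rho>" using genus by blast
  next
    assume "\<exists>\<rho>. perm_le I \<phi> \<rho> \<and> perm_le I \<psi> \<rho>"
    then obtain \<rho> where \<rho>: "perm_le I \<phi> \<rho>" "perm_le I \<psi> \<rho>" by blast
    obtain pos where pos: "inj_on pos I" "\<And>x. x \<in> I \<Longrightarrow> x \<noteq> p \<Longrightarrow> pos p < pos x"
        "noncrossing pos I \<phi>" "noncrossing pos I \<psi>"
      using common_noncrossing_order[OF fin p \<phi> \<psi> \<rho>] by blast
    obtain us where us: "set us \<subseteq> I \<times> I" "\<phi> = \<psi> \<circ> swaps us"
      "length us + card (orbit \<phi> ` I) + card (orbit \<psi> ` I) \<le> 2 * card (edges I (orbit \<phi>) (orbit \<psi>))"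
      using diagram_exists[OF fin p \<phi> \<psi> labels_cycles_orbit[OF fin \<phi>] labels_cycles_orbit[OF fin \<psi>]
          forest pos] by blast
    have euler: "card (orbit \<phi> ` I) + card (orbit \<psi> ` I)
        = card (edges I (orbit \<phi>) (orbit \<psi>)) + ?j"
      using euler_forest_iff[OF fin, of "orbit \<phi>" "orbit \<psi>"] forest by (simp add: euler_forest_def)
    have "?g = id \<circ> swaps us"
      unfolding us(2) by (simp add: comp_assoc[symmetric] permutes_inv_o(2)[OF \<psi>])
    then have "card I \<le> cycle_count I ?g + length us"
      using cycle_count_swaps(2)[OF fin permutes_id us(1)] by (simp add: cycle_count_id)
    then show "planar_on I \<phi> (inv \<psi>)"
      using us(3) euler genus ts(3)
      unfolding planar_on_inv_iff[OF fin \<phi> \<psi>] cycle_count_eq_card by linarith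
  qed
qed


section \<open>Restriction to a union of cycles\<close>

lemma union_of_cycles_iff:
  assumes fin: "finite T" and \<phi>: "\<phi> permutes T"
  shows "union_of_cycles T \<phi> J \<longleftrightarrow> J \<subseteq> T \<and> (\<forall>x\<in>J. orbit \<phi> x \<subseteq> J)"
proof
  assume "union_of_cycles T \<phi> J"
  then obtain C where C: "C \<subseteq> orbit \<phi> ` T" "J = \<Union>C"
    unfolding union_of_cycles_def orbit_partition_def by blast
  have "J \<subseteq> T" using C permutes_orbit_subset[OF \<phi>] by blast
  moreover have "orbit \<phi> x \<subseteq> J" if x: "x \<in> J" for x
  proof -
    obtain y where y: "orbit \<phi> y \<in> C" "x \<in> orbit \<phi> y" using x C by blast
    then have "orbit \<phi> x = orbit \<phi> y" using orbit_eq_iff[OF fin \<phi>] by blast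
    then show ?thesis using y(1) C(2) by blast
  qed
  ultimately show "J \<subseteq> T \<and> (\<forall>x\<in>J. orbit \<phi> x \<subseteq> J)" by blast
next
  assume J: "J \<subseteq> T \<and> (\<forall>x\<in>J. orbit \<phi> x \<subseteq> J)"
  have "J = \<Union>(orbit \<phi> ` J)" using J mem_orbit_self[OF fin \<phi>] by blast
  then show "union_of_cycles T \<phi> J"
    unfolding union_of_cycles_def orbit_partition_def using J by (intro exI[of _ "orbit \<phi> ` J"]) auto
qed

lemma union_of_cycles_inv:
  "finite T \<Longrightarrow> \<phi> permutes T \<Longrightarrow> union_of_cycles T (inv \<phi>) J \<longleftrightarrow> union_of_cycles T \<phi> J"
  by (simp add: union_of_cycles_def orbit_partition_inv)

lemma perm_restrict_union_of_cycles:
  assumes fin: "finite T" and \<phi>: "\<phi> permutes T" and J: "union_of_cycles T \<phi> J"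
  shows "perm_restrict \<phi> J permutes J"
    and "x \<in> J \<Longrightarrow> orbit (perm_restrict \<phi> J) x = orbit \<phi> x"
    and "perm_restrict (inv \<phi>) J = inv (perm_restrict \<phi> J)"
proof -
  have JT: "J \<subseteq> T" and orb: "\<And>x. x \<in> J \<Longrightarrow> orbit \<phi> x \<subseteq> J"
    using J union_of_cycles_iff[OF fin \<phi>] by blast+
  have closed: "\<phi> x \<in> J" if "x \<in> J" for x using orb[OF that] orbit.base[of \<phi> x] by blast
  show perm: "perm_restrict \<phi> J permutes J"
  proof (rule bij_imp_permutes)
    have "\<phi> ` J = J"
      using finite_subset[OF JT fin] closed permutes_inj[OF \<phi>]
      by (intro endo_inj_surj) (auto intro: inj_on_subset)
    then show "bij_betw (perm_restrict \<phi> J) J J"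
      using permutes_inj[OF \<phi>] unfolding bij_betw_def
      by (auto simp: inj_on_def perm_restrict_def)
    show "perm_restrict \<phi> J x = x" if "x \<notin> J" for x using that by (simp add: perm_restrict_def)
  qed
  show "orbit (perm_restrict \<phi> J) x = orbit \<phi> x" if "x \<in> J"
  proof (rule orbit_cong)
    show "x \<in> orbit \<phi> x" by (rule mem_orbit_self[OF fin \<phi>])
    show "perm_restrict \<phi> J s = \<phi> s" if "s \<in> orbit \<phi> x" for s
      using that orb[OF \<open>x \<in> J\<close>] by (auto simp: perm_restrict_def)
  qed
  have closed': "inv \<phi> x \<in> J" if "x \<in> J" for x
    using orb[OF that] orbit.base[of "inv \<phi>" x] orbit_inv_permutes[OF fin \<phi>, of x] by blast
  show "perm_restrict (inv \<phi>) J = inv (perm_restrict \<phi> J)"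
  proof
    fix x
    have "perm_restrict \<phi> J (perm_restrict (inv \<phi>) J x) = x"
      using closed' permutes_inverses(1)[OF \<phi>] by (auto simp: perm_restrict_def)
    then show "perm_restrict (inv \<phi>) J x = inv (perm_restrict \<phi> J) x"
      by (metis perm permutes_inverses(2))
  qed
qed

lemma edges_perm_restrict:
  assumes "finite T" and "\<phi> permutes T" "\<psi> permutes T"
    and "union_of_cycles T \<phi> J" "union_of_cycles T \<psi> J"
  shows "edges J (orbit (perm_restrict \<phi> J)) (orbit (perm_restrict \<psi> J)) = edges J (orbit \<phi>) (orbit \<psi>)"
  unfolding edges_def
  using perm_restrict_union_of_cycles(2)[OF assms(1,2,4)] perm_restrict_union_of_cycles(2)[OF assms(1,3,5)]
  by (intro image_cong) auto


section \<open>Signed points\<close>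

lemma flip_flip [simp]: "flip (flip x) = x"
  by (cases x) auto

lemma inj_flip: "inj flip"
  by (metis flip_flip injI)

lemma finite_signed_set: "finite K \<Longrightarrow> finite (signed_set K)"
  by (simp add: signed_set_def)

lemma sign_choice_flip: "sign_choice K J \<Longrightarrow> sign_choice K (flip ` J)"
proof -
  assume J: "sign_choice K J"
  have mem: "x \<in> flip ` J \<longleftrightarrow> flip x \<in> J" for x by (metis flip_flip image_iff)
  have "flip ` signed_set K = signed_set K" by (auto simp: signed_set_def image_Un image_image)
  then show ?thesis using J unfolding sign_choice_def mem by (auto simp: mem)
qed

lemma sign_choice_cover:
  assumes "sign_choice K J"
  shows "signed_set K = J \<union> flip ` J" and "J \<inter> flip ` J = {}"
proof -
  have mem: "x \<in> flip ` J \<longleftrightarrow> flip x \<in> J" for x by (metis flip_flip image_iff)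
  have J: "J \<subseteq> signed_set K" "\<And>k. k \<in> K \<Longrightarrow> Pos k \<in> J \<longleftrightarrow> Neg k \<notin> J"
    using assms by (auto simp: sign_choice_def)
  have "x \<in> J \<longleftrightarrow> flip x \<notin> J" if "x \<in> signed_set K" for x
    using that J(2) by (cases x) (auto simp: signed_set_def)
  moreover have "flip x \<in> signed_set K \<longleftrightarrow> x \<in> signed_set K" for x
    by (cases x) (auto simp: signed_set_def)
  ultimately show "signed_set K = J \<union> flip ` J" "J \<inter> flip ` J = {}"
    using J(1) mem by blast+
qed

text \<open>The elements of \<open>PM\<close> are fixed by this operation, which carries \<open>J\<close> to \<open>flip ` J\<close>.\<close>

definition mirror :: "('a signed \<Rightarrow> 'a signed) \<Rightarrow> 'a signed \<Rightarrow> 'a signed" where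
  "mirror \<pi> = flip \<circ> inv \<pi> \<circ> flip"

lemma PM_mirror:
  assumes "\<phi> \<in> PM K"
  shows "\<phi> permutes signed_set K" and "mirror \<phi> = \<phi>"
proof -
  show "\<phi> permutes signed_set K" using assms by (simp add: PM_def)
  have "inv \<phi> = flip \<circ> \<phi> \<circ> flip" using assms by (simp add: PM_def)
  then show "mirror \<phi> = \<phi>" by (simp add: mirror_def fun_eq_iff)
qed

lemma orbit_mirror:
  assumes "finite I" and "\<pi> permutes I"
  shows "orbit (mirror \<pi>) (flip x) = flip ` orbit \<pi> x"
proof -
  have "flip ` orbit (inv \<pi>) x = orbit (mirror \<pi>) (flip x)"
    by (rule orbit_inverse) (use mem_orbit_self[OF assms(1) permutes_inv[OF assms(2)]] in \<open>simp_all add: mirror_def\<close>)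
  then show ?thesis using orbit_inv_permutes[OF assms] by simp
qed

text \<open>
  The inverse of \<open>\<pi> \<circ> (a b)\<close> is \<open>\<pi>\<^sup>-\<^sup>1 \<circ> (\<pi> a \<pi> b)\<close>, so inversion preserves the order
  on permutations, and so does the relabelling by \<open>flip\<close>.
\<close>

lemma joins_cycles_mirror:
  assumes fin: "finite I" and perm: "\<pi> permutes I" and join: "joins_cycles I \<pi> \<rho>"
  shows "joins_cycles (flip ` I) (mirror \<pi>) (mirror \<rho>)"
proof -
  obtain a b where ab: "a \<in> I" "b \<in> I" and ne: "orbit \<pi> a \<noteq> orbit \<pi> b"
    and \<rho>: "\<rho> = \<pi> \<circ> transpose a b"
    using join unfolding joins_cycles_def by blast
  have bij: "bij (inv \<pi>)" by (rule permutes_bij[OF permutes_inv[OF perm]])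
  have "inv \<rho> = transpose a b \<circ> inv \<pi>"
    unfolding \<rho> using permutes_bij[OF perm] by (simp add: o_inv_distrib)
  also have "\<dots> = inv \<pi> \<circ> transpose (\<pi> a) (\<pi> b)"
    using transpose_comp_eq[OF bij, of a b] by (simp add: permutes_inv_inv[OF perm])
  finally have "mirror \<rho> = flip \<circ> inv \<pi> \<circ> transpose (\<pi> a) (\<pi> b) \<circ> flip"
    by (simp add: mirror_def comp_assoc)
  also have "\<dots> = mirror \<pi> \<circ> transpose (flip (\<pi> a)) (flip (\<pi> b))"
    by (auto simp: mirror_def fun_eq_iff transpose_def) (metis flip_flip)+
  finally have eq: "mirror \<rho> = mirror \<pi> \<circ> transpose (flip (\<pi> a)) (flip (\<pi> b))" .
  have "orbit (mirror \<pi>) (flip (\<pi> x)) = flip ` orbit \<pi> x" for x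
    using orbit_mirror[OF fin perm] fin perm by (metis permutation_orbit_step permutation_permutes)
  then have "orbit (mirror \<pi>) (flip (\<pi> a)) \<noteq> orbit (mirror \<pi>) (flip (\<pi> b))"
    using ne by (simp add: inj_image_eq_iff[OF inj_flip])
  then show ?thesis
    unfolding eq using ab permutes_in_image[OF perm] by (intro joins_cyclesI) auto
qed

lemma perm_le_mirror:
  assumes fin: "finite I" and perm: "\<pi> permutes I" and le: "perm_le I \<pi> \<rho>"
  shows "perm_le (flip ` I) (mirror \<pi>) (mirror \<rho>)"
  using le perm unfolding perm_le_def
proof (induct rule: converse_rtranclp_induct)
  case (step \<pi> \<sigma>)
  then show ?case
    using joins_cycles_mirror[OF fin step(4,1)] joins_cycles_permutes[OF step(1,4)]
    by (meson converse_rtranclp_into_rtranclp)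
qed simp

lemma union_of_cycles_flip:
  assumes fin: "finite K" and \<phi>: "\<phi> \<in> PM K" and J: "union_of_cycles (signed_set K) \<phi> J"
  shows "union_of_cycles (signed_set K) \<phi> (flip ` J)"
proof -
  note perm = PM_mirror(1)[OF \<phi>] and T = finite_signed_set[OF fin]
  have "flip ` signed_set K = signed_set K" by (auto simp: signed_set_def image_Un image_image)
  moreover have "J \<subseteq> signed_set K" and closed: "orbit \<phi> x \<subseteq> J" if "x \<in> J" for x
    using J that unfolding union_of_cycles_iff[OF T perm] by blast+
  ultimately have "flip ` J \<subseteq> signed_set K" by blast
  moreover have "orbit \<phi> (flip x) \<subseteq> flip ` J" if "x \<in> J" for x
    using closed[OF that] orbit_mirror[OF T perm, of x] unfolding PM_mirror(2)[OF \<phi>] by blast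
  ultimately show ?thesis unfolding union_of_cycles_iff[OF T perm] by blast
qed

lemma perm_restrict_flip:
  assumes fin: "finite K" and \<phi>: "\<phi> \<in> PM K" and J: "union_of_cycles (signed_set K) \<phi> J"
  shows "perm_restrict \<phi> (flip ` J) = mirror (perm_restrict \<phi> J)"
proof
  fix x
  have inv: "inv (perm_restrict \<phi> J) = perm_restrict (inv \<phi>) J"
    using perm_restrict_union_of_cycles(3)[OF finite_signed_set[OF fin] PM_mirror(1)[OF \<phi>] J] ..
  have "\<phi> x = flip (inv \<phi> (flip x))"
    using PM_mirror(2)[OF \<phi>] by (metis comp_apply mirror_def)
  moreover have "x \<in> flip ` J \<longleftrightarrow> flip x \<in> J" by (metis flip_flip image_iff)
  ultimately show "perm_restrict \<phi> (flip ` J) x = mirror (perm_restrict \<phi> J) x"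
    by (simp add: mirror_def inv perm_restrict_def)
qed

text \<open>The graph on all signed points is the disjoint union of two copies of the graph on \<open>J\<close>.\<close>

lemma forest_sign_choice:
  assumes fin: "finite K" and \<phi>: "\<phi> \<in> PM K" and \<psi>: "\<psi> \<in> PM K" and J: "sign_choice K J"
    and U: "union_of_cycles (signed_set K) \<phi> J" "union_of_cycles (signed_set K) \<psi> J"
  shows "forest (edges (signed_set K) (orbit \<phi>) (orbit \<psi>)) \<longleftrightarrow> forest (edges J (orbit \<phi>) (orbit \<psi>))"
proof
  assume "forest (edges (signed_set K) (orbit \<phi>) (orbit \<psi>))"
  then show "forest (edges J (orbit \<phi>) (orbit \<psi>))"
    by (rule forest_subset) (use J in \<open>auto simp: edges_def sign_choice_def\<close>)
next
  assume forest: "forest (edges J (orbit \<phi>) (orbit \<psi>))"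
  note T = finite_signed_set[OF fin]
  have orb: "orbit \<phi> (flip x) = flip ` orbit \<phi> x" "orbit \<psi> (flip x) = flip ` orbit \<psi> x" for x
    using orbit_mirror[OF T PM_mirror(1)] PM_mirror(2) \<phi> \<psi> by metis+
  have sub: "orbit \<phi> x \<subseteq> J" "orbit \<psi> x \<subseteq> J" if "x \<in> J" for x
    using U that union_of_cycles_iff[OF T PM_mirror(1)] \<phi> \<psi> by blast+
  note cover = sign_choice_cover[OF J]
  let ?E = "edges J (orbit \<phi>) (orbit \<psi>)" and ?F = "edges (flip ` J) (orbit \<phi>) (orbit \<psi>)"
  have F: "?F = map_prod ((`) flip) ((`) flip) ` ?E"
    by (simp add: edges_def image_image orb)
  have inj: "inj_on ((`) flip) X" for X :: "'a signed set set"
    by (simp add: inj_on_def inj_image_eq_iff[OF inj_flip])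
  have "forest ?F" unfolding F by (rule forest_image[OF forest inj inj])
  moreover have "orbit \<phi> x \<noteq> orbit \<phi> (flip y)" "orbit \<psi> x \<noteq> orbit \<psi> (flip y)"
    if "x \<in> J" "y \<in> J" for x y
    using sub that cover(2) orbit_nonempty unfolding orb
    by (metis (no_types, lifting) Int_greatest image_mono order_trans subset_empty)+
  then have "Domain ?E \<inter> Domain ?F = {}" "Range ?E \<inter> Range ?F = {}"
    unfolding edges_def by auto
  ultimately have "forest (?E \<union> ?F)" using forest by (intro forest_union)
  moreover have "edges (signed_set K) (orbit \<phi>) (orbit \<psi>) = ?E \<union> ?F"
    unfolding edges_def cover(1) image_Un ..
  ultimately show "forest (edges (signed_set K) (orbit \<phi>) (orbit \<psi>))" by simp
qed


section \<open>Existence of bracket diagrams\<close>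

lemma finite_pts_inf: "finite (pts_inf n)"
  by (simp add: pts_inf_def pts_def)

lemma pts_eq: "pts n = pts_inf n - {\<infinity>}" "\<infinity> \<notin> pts n" "\<infinity> \<in> pts_inf n"
  by (auto simp: pts_inf_def pts_def)

theorem proposition4p8:
  fixes n :: nat
  assumes "n \<ge> 1"
  shows
    "(\<forall>\<phi>\<^sub>R \<phi>\<^sub>t. \<phi>\<^sub>R permutes pts_inf n \<longrightarrow> \<phi>\<^sub>t permutes pts_inf n \<longrightarrow>
        ((\<exists>D. diagram_on (pts n) D \<and>
              label_perm Re_label \<infinity> D = \<phi>\<^sub>R \<and>
              label_perm tr_label \<infinity> D = \<phi>\<^sub>t)
         \<longleftrightarrow>
         (\<exists>\<rho>. \<rho> permutes pts_inf n \<and> perm_le (pts_inf n) \<phi>\<^sub>R \<rho> \<and> perm_le (pts_inf n) \<phi>\<^sub>t \<rho>) \<and>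
         star_eq (pts_inf n) \<phi>\<^sub>R \<phi>\<^sub>t))
     \<and>
     (\<forall>\<phi>\<^sub>R \<in> PM (pts_inf n). \<forall>\<phi>\<^sub>t \<in> PM (pts_inf n).
        ((\<exists>D S J. sign_choice (pts n) S \<and> diagram_on S D \<and> J = insert (Pos \<infinity>) S \<and>
                  union_of_cycles (signed_set (pts_inf n)) \<phi>\<^sub>R J \<and>
                  union_of_cycles (signed_set (pts_inf n)) \<phi>\<^sub>t J \<and>
                  label_perm Re_label (Pos \<infinity>) D = perm_restrict \<phi>\<^sub>R J \<and>
                  label_perm tr_label (Pos \<infinity>) D = perm_restrict \<phi>\<^sub>t J)
         \<longleftrightarrow>
         PM_planar_on (pts_inf n) \<phi>\<^sub>R (inv \<phi>\<^sub>t) \<and>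
         star_eq (signed_set (pts_inf n)) \<phi>\<^sub>R \<phi>\<^sub>t))"
proof (intro conjI allI impI ballI)
  fix \<phi>\<^sub>R \<phi>\<^sub>t :: "enat \<Rightarrow> enat"
  assume \<phi>: "\<phi>\<^sub>R permutes pts_inf n" and \<psi>: "\<phi>\<^sub>t permutes pts_inf n"
  show "(\<exists>D. diagram_on (pts n) D \<and> label_perm Re_label \<infinity> D = \<phi>\<^sub>R \<and> label_perm tr_label \<infinity> D = \<phi>\<^sub>t)
     \<longleftrightarrow>
     (\<exists>\<rho>. \<rho> permutes pts_inf n \<and> perm_le (pts_inf n) \<phi>\<^sub>R \<rho> \<and> perm_le (pts_inf n) \<phi>\<^sub>t \<rho>) \<and>
     star_eq (pts_inf n) \<phi>\<^sub>R \<phi>\<^sub>t"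
    unfolding star_eq_iff_forest[OF finite_pts_inf \<phi> \<psi>] pts_eq(1)
      diagram_iff_upper_bound[OF finite_pts_inf pts_eq(3) \<phi> \<psi>]
    using perm_le_permutes[OF _ \<phi>] by blast
next
  fix \<phi>\<^sub>R \<phi>\<^sub>t :: "enat signed \<Rightarrow> enat signed"
  assume \<phi>: "\<phi>\<^sub>R \<in> PM (pts_inf n)" and \<psi>: "\<phi>\<^sub>t \<in> PM (pts_inf n)"
  let ?K = "pts_inf n" and ?T = "signed_set (pts_inf n)" and ?p = "Pos (\<infinity>::enat)"
  note fin = finite_pts_inf[of n]
  note T = finite_signed_set[OF fin]
  note perm = PM_mirror(1)[OF \<phi>] PM_mirror(1)[OF \<psi>]
  note star = star_eq_iff_forest[OF T perm]
  have restrict: "finite J" "perm_restrict \<phi>\<^sub>R J permutes J" "perm_restrict \<phi>\<^sub>t J permutes J"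
      "perm_restrict (inv \<phi>\<^sub>t) J = inv (perm_restrict \<phi>\<^sub>t J)"
      "forest (edges J (orbit (perm_restrict \<phi>\<^sub>R J)) (orbit (perm_restrict \<phi>\<^sub>t J))) \<longleftrightarrow>
        star_eq ?T \<phi>\<^sub>R \<phi>\<^sub>t"
    if "sign_choice ?K J" "union_of_cycles ?T \<phi>\<^sub>R J" "union_of_cycles ?T \<phi>\<^sub>t J" for J
  proof -
    show "finite J" using that(1) T finite_subset by (auto simp: sign_choice_def)
    show "perm_restrict \<phi>\<^sub>R J permutes J" "perm_restrict \<phi>\<^sub>t J permutes J"
      "perm_restrict (inv \<phi>\<^sub>t) J = inv (perm_restrict \<phi>\<^sub>t J)"
      using perm_restrict_union_of_cycles[OF T] perm that by blast+
    show "forest (edges J (orbit (perm_restrict \<phi>\<^sub>R J)) (orbit (perm_restrict \<phi>\<^sub>t J))) \<longleftrightarrow>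
        star_eq ?T \<phi>\<^sub>R \<phi>\<^sub>t"
      unfolding star edges_perm_restrict[OF T perm that(2,3)] forest_sign_choice[OF fin \<phi> \<psi> that] ..
  qed
  show "(\<exists>D S J. sign_choice (pts n) S \<and> diagram_on S D \<and> J = insert ?p S \<and>
          union_of_cycles ?T \<phi>\<^sub>R J \<and> union_of_cycles ?T \<phi>\<^sub>t J \<and>
          label_perm Re_label ?p D = perm_restrict \<phi>\<^sub>R J \<and>
          label_perm tr_label ?p D = perm_restrict \<phi>\<^sub>t J)
     \<longleftrightarrow> PM_planar_on ?K \<phi>\<^sub>R (inv \<phi>\<^sub>t) \<and> star_eq ?T \<phi>\<^sub>R \<phi>\<^sub>t"
    (is "?L \<longleftrightarrow> ?R")
  proof
    assume ?L
    then obtain D S J where S: "sign_choice (pts n) S" "diagram_on S D" and J: "J = insert ?p S"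
      and U: "union_of_cycles ?T \<phi>\<^sub>R J" "union_of_cycles ?T \<phi>\<^sub>t J"
      and D: "label_perm Re_label ?p D = perm_restrict \<phi>\<^sub>R J" "label_perm tr_label ?p D = perm_restrict \<phi>\<^sub>t J"
      by blast
    have notin: "?p \<notin> S" "Neg \<infinity> \<notin> S"
      using S(1) pts_eq(2)[of n] by (auto simp: sign_choice_def signed_set_def)
    have choice: "sign_choice ?K J"
      using S(1) notin unfolding J sign_choice_def signed_set_def pts_inf_def by auto
    have SJ: "S = J - {?p}" "?p \<in> J" using notin J by auto
    note r = restrict[OF choice U]
    have up: "(\<exists>\<rho>. perm_le J (perm_restrict \<phi>\<^sub>R J) \<rho> \<and> perm_le J (perm_restrict \<phi>\<^sub>t J) \<rho>)"
      and forest: "forest (edges J (orbit (perm_restrict \<phi>\<^sub>R J)) (orbit (perm_restrict \<phi>\<^sub>t J)))"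
      using diagram_iff_upper_bound[OF r(1) SJ(2) r(2,3)] S(2) D unfolding SJ(1) by blast+
    have "planar_on J (perm_restrict \<phi>\<^sub>R J) (perm_restrict (inv \<phi>\<^sub>t) J)"
      unfolding r(4) using planar_on_inv_iff_upper_bound[OF r(1) SJ(2) r(2,3) forest] up by blast
    then have "PM_planar_on ?K \<phi>\<^sub>R (inv \<phi>\<^sub>t)"
      unfolding PM_planar_on_def union_of_cycles_inv[OF T perm(2)] using choice U by blast
    then show ?R using r(5) forest by blast
  next
    assume R: ?R
    then obtain J where choice: "sign_choice ?K J"
      and U: "union_of_cycles ?T \<phi>\<^sub>R J" "union_of_cycles ?T \<phi>\<^sub>t J"
      and planar: "planar_on J (perm_restrict \<phi>\<^sub>R J) (perm_restrict (inv \<phi>\<^sub>t) J)"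
      unfolding PM_planar_on_def union_of_cycles_inv[OF T perm(2)] by blast
    note r = restrict[OF choice U]
    have inf: "?p \<in> J \<or> Neg \<infinity> \<in> J" using choice pts_eq(3) unfolding sign_choice_def by blast
    then obtain q where q: "q \<in> J" by blast
    have "forest (edges J (orbit (perm_restrict \<phi>\<^sub>R J)) (orbit (perm_restrict \<phi>\<^sub>t J)))"
      using r(5) R by blast
    then obtain \<rho> where \<rho>: "perm_le J (perm_restrict \<phi>\<^sub>R J) \<rho>" "perm_le J (perm_restrict \<phi>\<^sub>t J) \<rho>"
      using planar_on_inv_iff_upper_bound[OF r(1) q r(2,3)] planar unfolding r(4) by blast
    have "\<exists>J' \<rho>. ?p \<in> J' \<and> sign_choice ?K J' \<and> union_of_cycles ?T \<phi>\<^sub>R J' \<and> union_of_cycles ?T \<phi>\<^sub>t J' \<and>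
        perm_le J' (perm_restrict \<phi>\<^sub>R J') \<rho> \<and> perm_le J' (perm_restrict \<phi>\<^sub>t J') \<rho>"
    proof (cases "?p \<in> J")
      case True
      then show ?thesis using choice U \<rho> by blast
    next
      case False
      \<comment> \<open>a diagram contains \<open>\<infinity>\<close> and not \<open>-\<infinity>\<close>, so the mirror image of \<open>J\<close> is used\<close>
      then have "flip (Neg \<infinity>) \<in> flip ` J" using inf by blast
      then have "?p \<in> flip ` J" by simp
      moreover have "perm_le (flip ` J) (perm_restrict \<phi>\<^sub>R (flip ` J)) (mirror \<rho>)"
        "perm_le (flip ` J) (perm_restrict \<phi>\<^sub>t (flip ` J)) (mirror \<rho>)"
        using perm_le_mirror[OF r(1)] r(2,3) \<rho> perm_restrict_flip[OF fin] \<phi> \<psi> U by metis+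
      ultimately show ?thesis
        using sign_choice_flip[OF choice] union_of_cycles_flip[OF fin \<phi> U(1)]
          union_of_cycles_flip[OF fin \<psi> U(2)] by blast
    qed
    then obtain J' \<rho>' where p: "?p \<in> J'" and choice': "sign_choice ?K J'"
      and U': "union_of_cycles ?T \<phi>\<^sub>R J'" "union_of_cycles ?T \<phi>\<^sub>t J'"
      and \<rho>': "perm_le J' (perm_restrict \<phi>\<^sub>R J') \<rho>'" "perm_le J' (perm_restrict \<phi>\<^sub>t J') \<rho>'" by blast
    note r' = restrict[OF choice' U']
    obtain D where D: "diagram_on (J' - {?p}) D" "label_perm Re_label ?p D = perm_restrict \<phi>\<^sub>R J'"
        "label_perm tr_label ?p D = perm_restrict \<phi>\<^sub>t J'"
      using diagram_iff_upper_bound[OF r'(1) p r'(2,3)] \<rho>' r'(5) R by blast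
    have "Neg \<infinity> \<notin> J'" using p choice' pts_eq(3) unfolding sign_choice_def by blast
    then have "sign_choice (pts n) (J' - {?p})"
      using choice' unfolding sign_choice_def signed_set_def pts_eq(1) by auto
    moreover have "J' = insert ?p (J' - {?p})" using p by blast
    ultimately show ?L using D U' by blast
  qed
qed

end
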